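(* Let $F$ be a field of characteristic $2$, let $\phi$ be either an arbitrary (possibly singular) quadratic form over $F$ or a nonsingular symmetric bilinear form over $F$, and let $L/F$ be a finite field extension. Then $N_{L/F}(G_L(\phi_L))\subseteq G_F(\phi)$.
   Context: $N_{L/F}:L\to F$ is the field norm. For a form $\psi$ over a field $E$, $G_E(\psi)=\{c\in E^*:\psi\cong c\psi\}$ is its group of similarity factors. The subscript $L$ denotes scalar extension to $L$. *)

theory Defs
  imports Main "HOL-Combinatorics.Permutations"
begin

text \<open>We work inside a field type 'a, which plays the role of L; the base field F is
a subfield K of 'a. Vectors of F^n / L^n are functions nat => 'a (only indices < n matter),
n x n matrices are functions nat => nat => 'a.\<close>

definition subfield :: "'a::field set \<Rightarrow> bool" where
  "subfield K \<longleftrightarrow> 0 \<in> K \<and> 1 \<in> K \<and>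
     (\<forall>x\<in>K. \<forall>y\<in>K. x + y \<in> K \<and> x * y \<in> K) \<and>
     (\<forall>x\<in>K. - x \<in> K) \<and> (\<forall>x\<in>K. x \<noteq> 0 \<longrightarrow> inverse x \<in> K)"

definition mdet :: "nat \<Rightarrow> (nat \<Rightarrow> nat \<Rightarrow> 'a::comm_ring_1) \<Rightarrow> 'a" where
  "mdet n M = (\<Sum>p | p permutes {..<n}. of_int (sign p) * (\<Prod>i<n. M i (p i)))"

definition matvec :: "nat \<Rightarrow> (nat \<Rightarrow> nat \<Rightarrow> 'a::comm_ring_1) \<Rightarrow> (nat \<Rightarrow> 'a) \<Rightarrow> nat \<Rightarrow> 'a" where
  "matvec n T x = (\<lambda>i. \<Sum>j<n. T i j * x j)"

definition vec_in :: "'a set \<Rightarrow> nat \<Rightarrow> (nat \<Rightarrow> 'a) \<Rightarrow> bool" where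
  "vec_in E n x \<longleftrightarrow> (\<forall>i<n. x i \<in> E)"

definition mat_in :: "'a set \<Rightarrow> nat \<Rightarrow> (nat \<Rightarrow> nat \<Rightarrow> 'a) \<Rightarrow> bool" where
  "mat_in E n T \<longleftrightarrow> (\<forall>i<n. \<forall>j<n. T i j \<in> E)"

definition qf :: "(nat \<Rightarrow> nat \<Rightarrow> 'a::comm_ring_1) \<Rightarrow> nat \<Rightarrow> (nat \<Rightarrow> 'a) \<Rightarrow> 'a" where
  "qf a n x = (\<Sum>i<n. \<Sum>j\<in>{i..<n}. a i j * x i * x j)"

definition is_qform :: "'a set \<Rightarrow> (nat \<Rightarrow> nat \<Rightarrow> 'a) \<Rightarrow> nat \<Rightarrow> bool" where
  "is_qform K a n \<longleftrightarrow> (\<forall>i j. i \<le> j \<longrightarrow> j < n \<longrightarrow> a i j \<in> K)"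

definition qf_isom_scaled :: "'a::field set \<Rightarrow> (nat \<Rightarrow> nat \<Rightarrow> 'a) \<Rightarrow> nat \<Rightarrow> 'a \<Rightarrow> bool" where
  "qf_isom_scaled E a n c \<longleftrightarrow> (\<exists>T. mat_in E n T \<and> mdet n T \<noteq> 0 \<and>
      (\<forall>x. vec_in E n x \<longrightarrow> qf a n (matvec n T x) = c * qf a n x))"

definition G_qf :: "'a::field set \<Rightarrow> (nat \<Rightarrow> nat \<Rightarrow> 'a) \<Rightarrow> nat \<Rightarrow> 'a set" where
  "G_qf E a n = {c \<in> E. c \<noteq> 0 \<and> qf_isom_scaled E a n c}"

definition bf :: "(nat \<Rightarrow> nat \<Rightarrow> 'a::comm_ring_1) \<Rightarrow> nat \<Rightarrow> (nat \<Rightarrow> 'a) \<Rightarrow> (nat \<Rightarrow> 'a) \<Rightarrow> 'a" where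
  "bf B n x y = (\<Sum>i<n. \<Sum>j<n. x i * B i j * y j)"

definition is_nonsing_sym_bform :: "'a::field set \<Rightarrow> (nat \<Rightarrow> nat \<Rightarrow> 'a) \<Rightarrow> nat \<Rightarrow> bool" where
  "is_nonsing_sym_bform K B n \<longleftrightarrow> mat_in K n B \<and> (\<forall>i<n. \<forall>j<n. B i j = B j i) \<and> mdet n B \<noteq> 0"

definition bf_isom_scaled :: "'a::field set \<Rightarrow> (nat \<Rightarrow> nat \<Rightarrow> 'a) \<Rightarrow> nat \<Rightarrow> 'a \<Rightarrow> bool" where
  "bf_isom_scaled E B n c \<longleftrightarrow> (\<exists>T. mat_in E n T \<and> mdet n T \<noteq> 0 \<and>
      (\<forall>x y. vec_in E n x \<longrightarrow> vec_in E n y \<longrightarrow>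
         bf B n (matvec n T x) (matvec n T y) = c * bf B n x y))"

definition G_bf :: "'a::field set \<Rightarrow> (nat \<Rightarrow> nat \<Rightarrow> 'a) \<Rightarrow> nat \<Rightarrow> 'a set" where
  "G_bf E B n = {c \<in> E. c \<noteq> 0 \<and> bf_isom_scaled E B n c}"

definition is_basis_over :: "'a::field set \<Rightarrow> nat \<Rightarrow> (nat \<Rightarrow> 'a) \<Rightarrow> bool" where
  "is_basis_over K m b \<longleftrightarrow> (\<forall>y. \<exists>!c. (\<forall>i<m. c i \<in> K) \<and> (\<forall>i\<ge>m. c i = 0) \<and>
       y = (\<Sum>i<m. c i * b i))"

definition finite_ext :: "'a::field set \<Rightarrow> bool" where
  "finite_ext K \<longleftrightarrow> (\<exists>m b. is_basis_over K m b)"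

definition coords :: "'a::field set \<Rightarrow> nat \<Rightarrow> (nat \<Rightarrow> 'a) \<Rightarrow> 'a \<Rightarrow> nat \<Rightarrow> 'a" where
  "coords K m b y = (THE c. (\<forall>i<m. c i \<in> K) \<and> (\<forall>i\<ge>m. c i = 0) \<and> y = (\<Sum>i<m. c i * b i))"

text \<open>Field norm N_{L/F}(a): determinant of the K-linear map y |-> a*y of L,
computed in a (chosen) K-basis of L.\<close>
definition field_norm :: "'a::field set \<Rightarrow> 'a \<Rightarrow> 'a" where
  "field_norm K a = (let (m, b) = (SOME (m, b). is_basis_over K m b) in
      mdet m (\<lambda>i j. coords K m b (a * b j) i))"

end

theory Submission
  imports Defs "Jordan_Normal_Form.Determinant" "HOL-Library.Function_Algebras" "HOL-Library.Product_Plus"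
begin

text \<open>
Quadratic forms (\<open>\<epsilon> = 1\<close>, \<open>b\<close> the polar form) and symmetric bilinear forms (\<open>\<epsilon> = 0\<close>, \<open>q x = b x x\<close>) are
treated together as pairs \<open>(b, q)\<close> with \<open>q (x + y) = q x + q y + \<epsilon> b x y\<close>.

Let \<open>E = F(c)\<close> and \<open>r = [L : E]\<close>, so that \<open>N(c) = P\<^sub>0\<^sup>r\<close> with \<open>P\<^sub>0\<close> the constant term of the minimal
polynomial of \<open>c\<close>. For even \<open>r\<close> this is a square. For odd \<open>r\<close> the trace form of \<open>L/E\<close> is \<open>\<langle>1\<rangle>\<close> plus an
alternating form, because \<open>tr (y\<^sup>2) = (tr y)\<^sup>2\<close>; transferring the similitude along the trace and
cancelling hyperbolic planes descends it to \<open>E\<close>. Over \<open>E\<close> one transfers along the coefficient of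
the highest power of \<open>c\<close>: the powers of \<open>c\<close> split \<open>s\<^sub>*\<langle>1\<rangle>\<close> and \<open>s\<^sub>*\<langle>c\<^sup>-\<^sup>1\<rangle>\<close> as \<open>\<langle>1\<rangle>\<close> and \<open>\<langle>P\<^sub>0\<^sup>-\<^sup>1\<rangle>\<close> plus metabolic
forms (after adding \<open>\<langle>1\<rangle>\<close> to both when the degree is even), and cancellation gives the claim.

Metabolic forms are not hyperbolic on the part where \<open>q\<close> is additive (the radical of a quadratic
form, everything for a bilinear one). Let \<open>D\<close> be the set of values of \<open>q\<close> there. If \<open>D \<noteq> 0\<close>, then
\<open>c D \<subseteq> \<Sum> c\<^sup>2\<^sup>k D\<close> forces the minimal polynomial of \<open>c\<close> to have coefficients in the field
\<open>{a. a D \<subseteq> D}\<close>, so the diagonal entries of the metabolic forms can be absorbed.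

Throughout, maps preserving the forms need not be injective; injectivity is restored at the end
by changing such a map on the null radical.
\<close>

section \<open>Linear algebra over subfields\<close>

text \<open>The obstacle is that Witt cancellation fails in characteristic 2. For the bilinear
  planes H = [[0,1],[1,0]] and M = [[0,1],[1,1]], the sums M + M and H + M are isometric, although H
  is alternating and M is not. A metabolic summand can therefore be cancelled only if its diagonal
  entries can be moved away. An entry d is removed by adding a vector of value d q(y), taken from
  the part of the form that survives; so d has to map the relevant values of q to such values. The
  entries that occur are values of the transfer functional on products of Euler's dual basis, hence
  polynomials in the coefficients of the minimal polynomial, and only these coefficients need
  control. That control rests on unique expansions: a single nonzero value of q on its additive part
  already makes c a combination of powers of c^2. These powers are then a basis of F(c) over F, and
  the coefficients of c in it are quotients of values of q. The transfer is taken of c^-1, not of c,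
  because the functional sends c^-1 to the inverse of the constant term and the powers c, c^2, ...
  then supply the isotropic vectors.\<close>

lemma subfieldD:
  assumes "subfield K"
  shows subfield_zero: "0 \<in> K" and subfield_one: "1 \<in> K"
    and subfield_add: "\<And>x y. x \<in> K \<Longrightarrow> y \<in> K \<Longrightarrow> x + y \<in> K"
    and subfield_mult: "\<And>x y. x \<in> K \<Longrightarrow> y \<in> K \<Longrightarrow> x * y \<in> K"
    and subfield_uminus: "\<And>x. x \<in> K \<Longrightarrow> - x \<in> K"
    and subfield_inverse: "\<And>x. x \<in> K \<Longrightarrow> inverse x \<in> K"
proof -
  show "inverse x \<in> K" if "x \<in> K" for x
    using assms that unfolding subfield_def by (cases "x = 0") auto
qed (use assms in \<open>auto simp: subfield_def\<close>)

lemma subfield_diff: "subfield K \<Longrightarrow> x \<in> K \<Longrightarrow> y \<in> K \<Longrightarrow> x - y \<in> K"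
  by (metis diff_conv_add_uminus subfield_add subfield_uminus)

lemma subfield_divide: "subfield K \<Longrightarrow> x \<in> K \<Longrightarrow> y \<in> K \<Longrightarrow> x / y \<in> K"
  by (metis divide_inverse subfield_mult subfield_inverse)

lemma subfield_sum: "subfield K \<Longrightarrow> (\<And>i. i \<in> I \<Longrightarrow> f i \<in> K) \<Longrightarrow> sum f I \<in> K"
  by (induction I rule: infinite_finite_induct) (auto simp: subfield_zero subfield_add)

lemma subfield_power: "subfield K \<Longrightarrow> x \<in> K \<Longrightarrow> x ^ n \<in> K"
  by (induction n) (auto simp: subfield_one subfield_mult)

lemmas subfield_intros = subfield_zero subfield_one subfield_add subfield_mult subfield_uminus
  subfield_inverse subfield_diff subfield_divide subfield_sum subfield_power

lemma subfield_UNIV: "subfield UNIV"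
  by (simp add: subfield_def)

text \<open>Gaussian elimination, one row at a time. Every dimension count rests on it; since F is
  only a subset of the type, the solution must be tracked inside \<open>K\<close>.\<close>

lemma homogeneous_system_nontrivial:
  fixes M :: "'i \<Rightarrow> 'j \<Rightarrow> 'a::field"
  assumes K: "subfield K" and I: "finite I" and "finite J" and "card I < card J"
    and "\<And>i j. i \<in> I \<Longrightarrow> j \<in> J \<Longrightarrow> M i j \<in> K"
  shows "\<exists>c. (\<forall>j\<in>J. c j \<in> K) \<and> (\<exists>j\<in>J. c j \<noteq> 0) \<and> (\<forall>i\<in>I. (\<Sum>j\<in>J. M i j * c j) = 0)"
  using I assms(3-)
proof (induction I arbitrary: J M rule: finite_induct)
  case empty
  then have "J \<noteq> {}" by auto
  then show ?case using subfield_one[OF K] by (intro exI[of _ "\<lambda>_. 1"]) auto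
next
  case (insert k I)
  show ?case
  proof (cases "\<forall>j\<in>J. M k j = 0")
    case True
    obtain c where "(\<forall>j\<in>J. c j \<in> K) \<and> (\<exists>j\<in>J. c j \<noteq> 0) \<and> (\<forall>i\<in>I. (\<Sum>j\<in>J. M i j * c j) = 0)"
      using insert.IH[of J M] insert.prems insert.hyps by auto
    with True show ?thesis by (intro exI[of _ c]) auto
  next
    case False
    then obtain l where l: "l \<in> J" "M k l \<noteq> 0" by auto
    define J' where "J' = J - {l}"
    \<comment> \<open>Elimination with the pivot \<open>M k l\<close>: column \<open>l\<close> drops
      out of the remaining rows, and \<open>e\<close> later restores row \<open>k\<close>.\<close>
    define M' where "M' i j = M i j - M i l * M k j / M k l" for i j
    have J': "finite J'" "card I < card J'"
      using l insert by (auto simp: J'_def)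
    have "M' i j \<in> K" if "i \<in> I" "j \<in> J'" for i j
      using that l insert.prems(3) unfolding M'_def J'_def
      by (auto intro!: subfield_intros[OF K])
    then obtain c where
      c: "\<forall>j\<in>J'. c j \<in> K" "\<exists>j\<in>J'. c j \<noteq> 0" "\<forall>i\<in>I. (\<Sum>j\<in>J'. M' i j * c j) = 0"
      using insert.IH[OF J', of M'] by auto
    define e where "e = - (\<Sum>j\<in>J'. M k j * c j) / M k l"
    define c' where "c' = c(l := e)"
    have eK: "e \<in> K" unfolding e_def
      using c(1) l insert.prems(3) by (auto intro!: subfield_intros[OF K] simp: J'_def)
    have split: "(\<Sum>j\<in>J. M i j * c' j) = M i l * e + (\<Sum>j\<in>J'. M i j * c j)" for i
    proof -
      have "(\<Sum>j\<in>J. M i j * c' j) = M i l * c' l + (\<Sum>j\<in>J'. M i j * c' j)"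
        unfolding J'_def using insert.prems(1) l(1) by (simp add: sum.remove)
      moreover have "(\<Sum>j\<in>J'. M i j * c' j) = (\<Sum>j\<in>J'. M i j * c j)"
        by (rule sum.cong) (auto simp: J'_def c'_def)
      ultimately show ?thesis by (simp add: c'_def)
    qed
    have "(\<Sum>j\<in>J. M i j * c' j) = 0" if i: "i \<in> insert k I" for i
    proof (cases "i = k")
      case True
      then show ?thesis using l by (simp add: split e_def)
    next
      case False
      have "(\<Sum>j\<in>J'. M' i j * c j) = (\<Sum>j\<in>J'. M i j * c j) - M i l / M k l * (\<Sum>j\<in>J'. M k j * c j)"
        unfolding M'_def sum_distrib_left sum_subtractf[symmetric]
        by (rule sum.cong) (auto simp: field_simps)
      also have "\<dots> = (\<Sum>j\<in>J. M i j * c' j)" by (simp add: split e_def)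
      finally show ?thesis using c(3) i False by auto
    qed
    moreover have "\<forall>j\<in>J. c' j \<in> K" using c(1) eK by (auto simp: c'_def J'_def)
    moreover have "\<exists>j\<in>J. c' j \<noteq> 0" using c(2) by (auto simp: c'_def J'_def)
    ultimately show ?thesis by blast
  qed
qed

lemma dependent_in_span:
  fixes v w :: "nat \<Rightarrow> 'a::field"
  assumes K: "subfield K" and I: "finite I" "finite J" "card I < card J"
    and span: "\<And>j. j \<in> J \<Longrightarrow> \<exists>k. (\<forall>i\<in>I. k i \<in> K) \<and> w j = (\<Sum>i\<in>I. k i * v i)"
  shows "\<exists>c. (\<forall>j\<in>J. c j \<in> K) \<and> (\<exists>j\<in>J. c j \<noteq> 0) \<and> (\<Sum>j\<in>J. c j * w j) = 0"
proof -
  obtain M where M: "\<And>j i. j \<in> J \<Longrightarrow> i \<in> I \<Longrightarrow> M j i \<in> K" "\<And>j. j \<in> J \<Longrightarrow> w j = (\<Sum>i\<in>I. M j i * v i)"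
    using span by metis
  obtain c where c: "\<forall>j\<in>J. c j \<in> K" "\<exists>j\<in>J. c j \<noteq> 0" "\<forall>i\<in>I. (\<Sum>j\<in>J. M j i * c j) = 0"
    using homogeneous_system_nontrivial[OF K I, of "\<lambda>i j. M j i"] M(1) by auto
  have "(\<Sum>j\<in>J. c j * w j) = (\<Sum>j\<in>J. \<Sum>i\<in>I. c j * (M j i * v i))"
    by (simp add: M(2) sum_distrib_left)
  also have "\<dots> = (\<Sum>i\<in>I. (\<Sum>j\<in>J. M j i * c j) * v i)"
    by (subst sum.swap) (simp add: sum_distrib_left sum_distrib_right mult_ac)
  also have "\<dots> = 0" using c(3) by simp
  finally show ?thesis using c by blast
qed

text \<open>Maximality does the work of basis extension: dual, independent and symplectic families
  are taken as long as possible, and any missing property would lengthen them.\<close>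

lemma bounded_nat_maximal:
  assumes "P (0::nat)" and "\<And>r. P r \<Longrightarrow> r \<le> N"
  obtains r where "P r" "\<not> P (Suc r)"
  using assms by (metis GreatestI_nat Greatest_le_nat not_less_eq_eq)

section \<open>Isometries and hyperbolic systems\<close>

text \<open>Carriers and scalar actions are arguments because the same vectors are viewed over F, E
  and L in turn.\<close>

definition lin_on :: "'a set \<Rightarrow> ('a \<Rightarrow> 'v \<Rightarrow> 'v) \<Rightarrow> ('a \<Rightarrow> 'w \<Rightarrow> 'w) \<Rightarrow> 'v::ab_group_add set \<Rightarrow> 'w::ab_group_add set \<Rightarrow> ('v \<Rightarrow> 'w) \<Rightarrow> bool" where
  "lin_on K sv sw V W f \<longleftrightarrow> (\<forall>x\<in>V. f x \<in> W) \<and> (\<forall>x\<in>V. \<forall>y\<in>V. f (x + y) = f x + f y) \<and>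
     (\<forall>k\<in>K. \<forall>x\<in>V. f (sv k x) = sw k (f x))"

lemma lin_onD:
  assumes "lin_on K sv sw V W f"
  shows "x \<in> V \<Longrightarrow> f x \<in> W" "x \<in> V \<Longrightarrow> y \<in> V \<Longrightarrow> f (x + y) = f x + f y"
    "k \<in> K \<Longrightarrow> x \<in> V \<Longrightarrow> f (sv k x) = sw k (f x)"
  using assms unfolding lin_on_def by auto

lemma lin_on_comp: "lin_on K sv sw V W f \<Longrightarrow> lin_on K sw su W U g \<Longrightarrow> lin_on K sv su V U (\<lambda>x. g (f x))"
  unfolding lin_on_def by auto

text \<open>In characteristic 2 the last axiom says that \<open>b\<close> is alternating when
  \<open>\<epsilon> = 1\<close> and that \<open>q\<close> is the diagonal of \<open>b\<close> when
  \<open>\<epsilon> = 0\<close>, so one computation serves both kinds of form.\<close>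

locale form_space = Modules.module scale
  for scale :: "'a::field \<Rightarrow> 'w::ab_group_add \<Rightarrow> 'w" (infixr "*s" 75) +
  fixes K :: "'a set" and W :: "'w set" and b :: "'w \<Rightarrow> 'w \<Rightarrow> 'a" and q :: "'w \<Rightarrow> 'a" and \<epsilon> :: 'a
  assumes K: "subfield K" and char2: "(2::'a) = 0" and eps: "\<epsilon> = 0 \<or> \<epsilon> = 1"
    and W_zero: "0 \<in> W" and W_add: "\<And>x y. x \<in> W \<Longrightarrow> y \<in> W \<Longrightarrow> x + y \<in> W"
    and W_scale: "\<And>k x. k \<in> K \<Longrightarrow> x \<in> W \<Longrightarrow> k *s x \<in> W"
    and b_in: "\<And>x y. x \<in> W \<Longrightarrow> y \<in> W \<Longrightarrow> b x y \<in> K"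
    and q_in: "\<And>x. x \<in> W \<Longrightarrow> q x \<in> K"
    and b_sym: "\<And>x y. x \<in> W \<Longrightarrow> y \<in> W \<Longrightarrow> b x y = b y x"
    and b_add_left: "\<And>x y z. x \<in> W \<Longrightarrow> y \<in> W \<Longrightarrow> z \<in> W \<Longrightarrow> b (x + y) z = b x z + b y z"
    and b_scale_left: "\<And>k x z. k \<in> K \<Longrightarrow> x \<in> W \<Longrightarrow> z \<in> W \<Longrightarrow> b (k *s x) z = k * b x z"
    and q_add: "\<And>x y. x \<in> W \<Longrightarrow> y \<in> W \<Longrightarrow> q (x + y) = q x + q y + \<epsilon> * b x y"
    and q_scale: "\<And>k x. k \<in> K \<Longrightarrow> x \<in> W \<Longrightarrow> q (k *s x) = k * k * q x"
    and b_diag: "\<And>x. x \<in> W \<Longrightarrow> b x x = (1 + \<epsilon>) * q x"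
begin

lemma b_add_right: "x \<in> W \<Longrightarrow> y \<in> W \<Longrightarrow> z \<in> W \<Longrightarrow> b z (x + y) = b z x + b z y"
  by (metis W_add b_add_left b_sym)

lemma b_scale_right: "k \<in> K \<Longrightarrow> x \<in> W \<Longrightarrow> z \<in> W \<Longrightarrow> b z (k *s x) = k * b z x"
  by (metis W_scale b_scale_left b_sym)

lemma double_eq_0: "(x::'a) + x = 0" and double_left: "(x::'a) + (x + y) = y"
  using char2 by (metis mult_2 mult_zero_left, metis add.assoc add_0 mult_2 mult_zero_left)

lemma double_vec_eq_0: "(x::'w) + x = 0"
  by (metis double_eq_0 scale_left_distrib scale_one scale_zero_left)

lemma double_vec_left: "(x::'w) + (x + y) = y"
  by (metis add.assoc add_0 double_vec_eq_0)

lemmas c2 = double_eq_0 double_left double_vec_eq_0 double_vec_left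

lemma W_sum: "(\<And>i. i \<in> I \<Longrightarrow> f i \<in> W) \<Longrightarrow> sum f I \<in> W"
  by (induction I rule: infinite_finite_induct) (auto simp: W_zero W_add)

lemma b_zero_left: "x \<in> W \<Longrightarrow> b 0 x = 0"
  using b_scale_left[of 0 0 x] W_zero subfield_zero[OF K] by simp

lemma b_zero_right: "x \<in> W \<Longrightarrow> b x 0 = 0"
  using b_zero_left b_sym W_zero by metis

lemma q_zero: "q 0 = 0"
  using q_scale[of 0 0] W_zero subfield_zero[OF K] by simp

lemma b_sum_left: "(\<And>i. i \<in> I \<Longrightarrow> f i \<in> W) \<Longrightarrow> z \<in> W \<Longrightarrow> b (sum f I) z = (\<Sum>i\<in>I. b (f i) z)"
  by (induction I rule: infinite_finite_induct) (auto simp: b_zero_left b_add_left W_sum)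

lemma b_sum_right: "(\<And>i. i \<in> I \<Longrightarrow> f i \<in> W) \<Longrightarrow> z \<in> W \<Longrightarrow> b z (sum f I) = (\<Sum>i\<in>I. b z (f i))"
  by (induction I rule: infinite_finite_induct) (auto simp: b_zero_right b_add_right W_sum)

lemma q_sum:
  assumes "\<And>i. i \<in> I \<Longrightarrow> f i \<in> W" "\<And>i j. i \<in> I \<Longrightarrow> j \<in> I \<Longrightarrow> i \<noteq> j \<Longrightarrow> \<epsilon> * b (f i) (f j) = 0"
  shows "q (sum f I) = (\<Sum>i\<in>I. q (f i))"
  using assms
proof (induction I rule: infinite_finite_induct)
  case (insert x F)
  have "\<epsilon> * b (f x) (sum f F) = (\<Sum>i\<in>F. \<epsilon> * b (f x) (f i))"
    using insert.prems by (simp add: b_sum_right sum_distrib_left)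
  also have "\<dots> = 0" using insert.prems(2) insert.hyps by (intro sum.neutral) auto
  finally show ?case using insert by (simp add: q_add W_sum)
qed (auto simp: q_zero)

definition isometry :: "('w \<Rightarrow> 'w) \<Rightarrow> bool" where
  "isometry \<sigma> \<longleftrightarrow> lin_on K (*s) (*s) W W \<sigma> \<and>
     (\<forall>x\<in>W. \<forall>y\<in>W. b (\<sigma> x) (\<sigma> y) = b x y) \<and> (\<forall>x\<in>W. q (\<sigma> x) = q x)"

lemma isometry_comp: "isometry \<sigma> \<Longrightarrow> isometry \<tau> \<Longrightarrow> isometry (\<lambda>x. \<tau> (\<sigma> x))"
  unfolding isometry_def using lin_on_comp lin_onD(1) by metis

lemma isometry_id: "isometry (\<lambda>x. x)"
  by (auto simp: isometry_def lin_on_def)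

lemma isometryD:
  assumes "isometry \<sigma>"
  shows "x \<in> W \<Longrightarrow> \<sigma> x \<in> W" "x \<in> W \<Longrightarrow> y \<in> W \<Longrightarrow> b (\<sigma> x) (\<sigma> y) = b x y" "x \<in> W \<Longrightarrow> q (\<sigma> x) = q x"
  using assms lin_onD(1) unfolding isometry_def by metis+

lemmas bq_simps = b_add_left b_add_right b_scale_left b_scale_right q_add q_scale W_add W_scale
  b_in q_in subfield_intros[OF K]

text \<open>For \<open>\<epsilon> = 1\<close> the condition forces \<open>a = 1 / q u\<close> and
  gives the orthogonal reflection in \<open>u\<close>; for \<open>\<epsilon> = 0\<close> it gives a
  transvection along \<open>u\<close>, with \<open>b u u = 0\<close>.\<close>

lemma reflection_isometry:
  assumes u: "u \<in> W" "a \<in> K" "a * q u = \<epsilon>" "b u u = 0"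
  shows "isometry (\<lambda>x. x + (a * b x u) *s u)"
proof -
  have "b (x + (a * b x u) *s u) (y + (a * b y u) *s u) = b x y" if "x \<in> W" "y \<in> W" for x y
    using that u by (simp add: bq_simps b_sym[of u x] b_sym[of u y] algebra_simps c2)
  moreover have "q (x + (a * b x u) *s u) = q x" if "x \<in> W" for x
  proof -
    have "q (x + (a * b x u) *s u) = q x + (a * b x u) * b x u * (a * q u) + \<epsilon> * ((a * b x u) * b x u)"
      using that u by (simp add: bq_simps algebra_simps)
    then show ?thesis using u by (simp add: algebra_simps c2)
  qed
  moreover have "lin_on K (*s) (*s) W W (\<lambda>x. x + (a * b x u) *s u)"
    using u unfolding lin_on_def by (auto simp: bq_simps algebra_simps)
  ultimately show ?thesis unfolding isometry_def by blast
qed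

text \<open>Eichler transformation: unlike a reflection it also moves \<open>f\<close> to \<open>f'\<close> when \<open>b f f' = 0\<close>.\<close>

lemma eichler_isometry:
  assumes e: "e \<in> W" "q e = 0" and u: "u \<in> W" "b e u = 0" "b u u = 0" and k: "k \<in> K" "q u = \<epsilon> * k"
  shows "isometry (\<lambda>x. x + (b x e *s u + (b x u + k * b x e) *s e))"
proof -
  have ee: "b e e = 0" using b_diag e by simp
  have ue: "b u e = 0" using b_sym e u by metis
  have "b (x + (b x e *s u + (b x u + k * b x e) *s e)) (y + (b y e *s u + (b y u + k * b y e) *s e)) = b x y"
    if "x \<in> W" "y \<in> W" for x y
    using that e u k ee ue by (simp add: bq_simps b_sym[of u y] b_sym[of e y] algebra_simps c2)
  moreover have "q (x + (b x e *s u + (b x u + k * b x e) *s e)) = q x" if "x \<in> W" for x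
    using that e u k ee ue by (simp add: bq_simps algebra_simps c2)
  moreover have "lin_on K (*s) (*s) W W (\<lambda>x. x + (b x e *s u + (b x u + k * b x e) *s e))"
    using e u k unfolding lin_on_def by (auto simp: bq_simps algebra_simps)
  ultimately show ?thesis unfolding isometry_def by blast
qed

text \<open>Reflect in \<open>e + e'\<close>: its value is \<open>\<epsilon> * b e e'\<close>, so
  the scalar of the reflection is the inverse of \<open>b e e'\<close>. The vectors left fixed are
  recorded so that later moves do not disturb what is already placed.\<close>

lemma move_null_vector:
  assumes e: "e \<in> W" "q e = 0" and e': "e' \<in> W" "q e' = 0" and ne: "b e e' \<noteq> 0"
  shows "\<exists>\<sigma>. isometry \<sigma> \<and> \<sigma> e = e' \<and> (\<forall>z\<in>W. b z e = 0 \<longrightarrow> b z e' = 0 \<longrightarrow> \<sigma> z = z)"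
proof -
  define a where "a = inverse (b e e')"
  define u where "u = e + e'"
  have ee: "b e e = 0" "b e' e' = 0" using b_diag e e' by auto
  have aK: "a \<in> K" using e e' by (simp add: a_def bq_simps)
  have uW: "u \<in> W" using e e' by (simp add: u_def W_add)
  have qu: "a * q u = \<epsilon>" using e e' ne by (simp add: u_def a_def bq_simps)
  have buu: "b u u = 0" using e e' ee by (simp add: u_def bq_simps b_sym[of e' e] c2)
  have "e + (a * b e u) *s u = e'"
    using e e' ne ee by (simp add: u_def a_def bq_simps c2)
  moreover have "\<forall>z\<in>W. b z e = 0 \<longrightarrow> b z e' = 0 \<longrightarrow> z + (a * b z u) *s u = z"
    using e e' by (simp add: u_def bq_simps)
  ultimately show ?thesis using reflection_isometry[OF uW aK qu buu] by blast
qed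

section \<open>Witt's theorem for hyperbolic pairs and systems\<close>

definition hyp_pair :: "'w \<Rightarrow> 'w \<Rightarrow> bool" where
  "hyp_pair e f \<longleftrightarrow> e \<in> W \<and> f \<in> W \<and> q e = 0 \<and> q f = 0 \<and> b e f = 1"

text \<open>First \<open>e\<close> is moved, by one reflection or by two through an auxiliary null
  vector; then the image of \<open>f\<close> is moved to \<open>f'\<close> by an Eichler
  transformation that holds \<open>e'\<close> fixed.\<close>

lemma move_hyp_pair:
  assumes ef: "hyp_pair e f" and ef': "hyp_pair e' f'"
  shows "\<exists>\<sigma>. isometry \<sigma> \<and> \<sigma> e = e' \<and> \<sigma> f = f' \<and>
    (\<forall>z\<in>W. b z e = 0 \<longrightarrow> b z f = 0 \<longrightarrow> b z e' = 0 \<longrightarrow> b z f' = 0 \<longrightarrow> \<sigma> z = z)"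
proof -
  note h = ef[unfolded hyp_pair_def] ef'[unfolded hyp_pair_def]
  have fe: "b f e = 1" "b f' e' = 1" using h b_sym by metis+
  have "\<exists>\<sigma>. isometry \<sigma> \<and> \<sigma> e = e' \<and>
    (\<forall>z\<in>W. b z e = 0 \<longrightarrow> b z f = 0 \<longrightarrow> b z e' = 0 \<longrightarrow> b z f' = 0 \<longrightarrow> \<sigma> z = z)"
  proof (cases "b e e' = 0")
    case False
    then show ?thesis using move_null_vector[of e e'] h by blast
  next
    case True
    then have sy: "b e' e = 0" using h b_sym by metis
    have ee: "b e e = 0" "b e' e' = 0" using b_diag h by auto
    have "\<exists>g\<in>W. q g = 0 \<and> b e g \<noteq> 0 \<and> b g e' \<noteq> 0 \<and>
        (\<forall>z\<in>W. b z e = 0 \<longrightarrow> b z f = 0 \<longrightarrow> b z e' = 0 \<longrightarrow> b z f' = 0 \<longrightarrow> b z g = 0)"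
    proof -
      consider "b f e' \<noteq> 0" | "b e f' \<noteq> 0" | "b f e' = 0" "b e f' = 0" by blast
      then show ?thesis
      proof cases
        case 1 then show ?thesis using h by (intro bexI[of _ f]) auto
      next
        case 2 then show ?thesis using h fe by (intro bexI[of _ f']) auto
      next
        case 3
        \<comment> \<open>The value of \<open>f + f'\<close> is \<open>\<epsilon> * b f f'\<close>;
          the multiple of \<open>e\<close> contributes the same amount through
          \<open>b f e = 1\<close> and cancels it.\<close>
        define g where "g = f + f' + b f f' *s e"
        have "b f' e = 0" using 3 h b_sym by metis
        then have "q g = 0" using h fe 3 by (simp add: g_def bq_simps c2 algebra_simps)
        moreover have "b e g = 1" "b g e' = 1" "g \<in> W"
          using h fe 3 ee True by (simp_all add: g_def bq_simps)
        moreover have "\<forall>z\<in>W. b z e = 0 \<longrightarrow> b z f = 0 \<longrightarrow> b z e' = 0 \<longrightarrow> b z f' = 0 \<longrightarrow> b z g = 0"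
          using h by (simp add: g_def bq_simps)
        ultimately show ?thesis by auto
      qed
    qed
    then obtain g where g: "g \<in> W" "q g = 0" "b e g \<noteq> 0" "b g e' \<noteq> 0"
      "\<And>z. z \<in> W \<Longrightarrow> b z e = 0 \<Longrightarrow> b z f = 0 \<Longrightarrow> b z e' = 0 \<Longrightarrow> b z f' = 0 \<Longrightarrow> b z g = 0" by blast
    obtain \<sigma> where s: "isometry \<sigma>" "\<sigma> e = g" "\<And>z. z \<in> W \<Longrightarrow> b z e = 0 \<Longrightarrow> b z g = 0 \<Longrightarrow> \<sigma> z = z"
      using move_null_vector[of e g] h g by blast
    obtain \<tau> where t: "isometry \<tau>" "\<tau> g = e'" "\<And>z. z \<in> W \<Longrightarrow> b z g = 0 \<Longrightarrow> b z e' = 0 \<Longrightarrow> \<tau> z = z"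
      using move_null_vector[of g e'] h g by blast
    show ?thesis
      using isometry_comp[OF s(1) t(1)] s t g(5) by (intro exI[of _ "\<lambda>x. \<tau> (\<sigma> x)"]) auto
  qed
  then obtain \<sigma> where s: "isometry \<sigma>" "\<sigma> e = e'"
    "\<And>z. z \<in> W \<Longrightarrow> b z e = 0 \<Longrightarrow> b z f = 0 \<Longrightarrow> b z e' = 0 \<Longrightarrow> b z f' = 0 \<Longrightarrow> \<sigma> z = z" by blast
  define g where "g = \<sigma> f"
  have g: "g \<in> W" "q g = 0" "b e' g = 1"
    using isometryD[OF s(1)] h s(2) by (simp_all add: g_def, metis)
  then have ge: "b g e' = 1" using h b_sym by metis
  \<comment> \<open>Both \<open>g\<close> and \<open>f'\<close> pair to 1 with \<open>e'\<close>, so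
    \<open>u\<close> is orthogonal to \<open>e'\<close> and the transformation below fixes
    \<open>e'\<close>.\<close>
  define u where "u = g + f'"
  define k where "k = b g f'"
  have dd: "b g g = 0" "b f' f' = 0" using b_diag h g by auto
  have u: "u \<in> W" "b e' u = 0" "b u u = 0" "k \<in> K" "q u = \<epsilon> * k"
    using h g dd by (simp_all add: u_def k_def bq_simps c2 b_sym[of f' g])
  define \<tau> where "\<tau> x = x + (b x e' *s u + (b x u + k * b x e') *s e')" for x
  have t: "isometry \<tau>" unfolding \<tau>_def by (rule eichler_isometry) (use h u in auto)
  have "b e' e' = 0" using b_diag h by simp
  then have te: "\<tau> e' = e'" using u by (simp add: \<tau>_def)
  have "b g u = k" using g h dd by (simp add: u_def k_def bq_simps)
  then have tg: "\<tau> g = f'" using ge by (simp add: \<tau>_def c2) (simp add: u_def c2)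
  have "\<tau> (\<sigma> z) = z" if z: "z \<in> W" "b z e = 0" "b z f = 0" "b z e' = 0" "b z f' = 0" for z
  proof -
    have sz: "\<sigma> z = z" using s(3) z by blast
    then have "b z g = 0" using isometryD(2)[OF s(1) z(1), of f] h z by (simp add: g_def)
    then have "b z u = 0" using z g h by (simp add: u_def bq_simps)
    then show ?thesis using sz z by (simp add: \<tau>_def)
  qed
  then show ?thesis using isometry_comp[OF s(1) t] te tg s(2) g_def
    by (intro exI[of _ "\<lambda>x. \<tau> (\<sigma> x)"]) auto
qed

definition hyp_system :: "nat \<Rightarrow> (nat \<Rightarrow> 'w) \<Rightarrow> (nat \<Rightarrow> 'w) \<Rightarrow> bool" where
  "hyp_system r e f \<longleftrightarrow> (\<forall>i<r. e i \<in> W \<and> f i \<in> W \<and> q (e i) = 0 \<and> q (f i) = 0) \<and>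
     (\<forall>i<r. \<forall>j<r. b (e i) (e j) = 0 \<and> b (f i) (f j) = 0 \<and> b (e i) (f j) = of_bool (i = j))"

text \<open>Pairs already placed are orthogonal to the next pair before and after the move, so the
  fixing clause of \<open>move_hyp_pair\<close> keeps them in place.\<close>

lemma move_hyp_system:
  assumes "hyp_system r e f" "hyp_system r e' f'"
  shows "\<exists>\<sigma>. isometry \<sigma> \<and> (\<forall>i<r. \<sigma> (e i) = e' i \<and> \<sigma> (f i) = f' i)"
  using assms
proof (induction r)
  case 0
  then show ?case using isometry_id by auto
next
  case (Suc r)
  have "hyp_system r e f" "hyp_system r e' f'"
    using Suc.prems unfolding hyp_system_def by auto
  then obtain \<sigma> where s: "isometry \<sigma>" "\<And>i. i < r \<Longrightarrow> \<sigma> (e i) = e' i \<and> \<sigma> (f i) = f' i"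
    using Suc.IH by blast
  have W: "e i \<in> W" "f i \<in> W" "e' i \<in> W" "f' i \<in> W" if "i < Suc r" for i
    using Suc.prems that unfolding hyp_system_def by auto
  have "hyp_pair (\<sigma> (e r)) (\<sigma> (f r))" "hyp_pair (e' r) (f' r)"
    using Suc.prems isometryD[OF s(1)] unfolding hyp_pair_def hyp_system_def by auto
  then obtain \<tau> where t: "isometry \<tau>" "\<tau> (\<sigma> (e r)) = e' r" "\<tau> (\<sigma> (f r)) = f' r"
    "\<And>z. z \<in> W \<Longrightarrow> b z (\<sigma> (e r)) = 0 \<Longrightarrow> b z (\<sigma> (f r)) = 0 \<Longrightarrow> b z (e' r) = 0 \<Longrightarrow> b z (f' r) = 0 \<Longrightarrow> \<tau> z = z"
    using move_hyp_pair by blast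
  have "\<tau> (\<sigma> (e i)) = e' i \<and> \<tau> (\<sigma> (f i)) = f' i" if i: "i < r" for i
  proof
    have s': "b (e' i) (\<sigma> w) = b (e i) w" "b (f' i) (\<sigma> w) = b (f i) w" if "w \<in> W" for w
      using isometryD(2)[OF s(1) W(1), of i w] isometryD(2)[OF s(1) W(2), of i w] s(2)[OF i] i that by auto
    have fe: "b (f i) (e r) = 0" "b (f' i) (e' r) = 0"
      using Suc.prems i b_sym[of "f i" "e r"] b_sym[of "f' i" "e' r"] W unfolding hyp_system_def by auto
    have "\<tau> (e' i) = e' i" "\<tau> (f' i) = f' i"
      by (rule t(4); use Suc.prems i W s' fe in \<open>auto simp: hyp_system_def\<close>)+
    then show "\<tau> (\<sigma> (e i)) = e' i" "\<tau> (\<sigma> (f i)) = f' i" using s(2)[OF i] by auto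
  qed
  then show ?case using isometry_comp[OF s(1) t(1)] t
    by (intro exI[of _ "\<lambda>x. \<tau> (\<sigma> x)"]) (auto simp: less_Suc_eq)
qed

text \<open>Multiples of the \<open>e j\<close> are added to the \<open>f i\<close>. This changes
  \<open>q (f i)\<close> only through \<open>\<epsilon>\<close>; in the bilinear case the value is
  invariant, so there it has to vanish from the start. The correction stays in the span of the
  \<open>e j\<close>, whence the clause on orthogonal vectors.\<close>

lemma complete_to_hyp_system:
  assumes W: "\<And>i. i < r \<Longrightarrow> e i \<in> W" "\<And>i. i < r \<Longrightarrow> f i \<in> W"
    and qe: "\<And>i. i < r \<Longrightarrow> q (e i) = 0"
    and bee: "\<And>i j. i < r \<Longrightarrow> j < r \<Longrightarrow> b (e i) (e j) = 0"
    and bef: "\<And>i j. i < r \<Longrightarrow> j < r \<Longrightarrow> b (e i) (f j) = of_bool (i = j)"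
    and qf: "\<And>i. i < r \<Longrightarrow> \<epsilon> = 0 \<Longrightarrow> q (f i) = 0"
  shows "\<exists>f'. hyp_system r e f' \<and>
    (\<forall>w\<in>W. (\<forall>i<r. b w (e i) = 0 \<and> b w (f i) = 0) \<longrightarrow> (\<forall>i<r. b w (f' i) = 0))"
proof -
  \<comment> \<open>The sum \<open>X i j + X j i\<close> has to equal \<open>b (f i) (f j)\<close>.
    Halving is impossible in characteristic 2, so the whole value goes below the diagonal; the
    diagonal entry removes \<open>q (f i)\<close>.\<close>
  define X where "X i j = (if j < i then b (f i) (f j) else if j = i then q (f i) else 0)" for i j
  define g where "g i = (\<Sum>j<r. X i j *s e j)" for i
  have X: "X i j \<in> K" if "i < r" "j < r" for i j
    using that W b_in q_in by (auto simp: X_def subfield_zero[OF K])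
  have g: "g i \<in> W" if "i < r" for i
    unfolding g_def using that W X by (intro W_sum W_scale) auto
  have bg: "b w (g i) = (\<Sum>j<r. X i j * b w (e j))" if "w \<in> W" "i < r" for w i
    unfolding g_def using that W X by (subst b_sum_right) (auto simp: W_scale b_scale_right)
  have fe: "b (f j) (e i) = of_bool (i = j)" if "i < r" "j < r" for i j
    using that bef b_sym W by metis
  have beg: "b (e i) (g j) = 0" if "i < r" "j < r" for i j
    using that W bee by (simp add: bg)
  have bgg: "b (g i) (g j) = 0" if "i < r" "j < r" for i j
    using that W g bg[of "g i" j] b_sym[of "g i" "e _"] by (simp add: beg)
  have bfg: "b (f j) (g i) = X i j" if "i < r" "j < r" for i j
  proof -
    have "b (f j) (g i) = (\<Sum>l<r. X i l * b (f j) (e l))"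
      using that W by (simp add: bg)
    also have "\<dots> = (\<Sum>l<r. if l = j then X i l else 0)"
      using that by (intro sum.cong) (auto simp: fe)
    finally show ?thesis using that by simp
  qed
  have qg: "q (g i) = 0" if "i < r" for i
  proof -
    have "q (g i) = (\<Sum>j<r. q (X i j *s e j))"
      unfolding g_def using that W X bee by (intro q_sum) (auto simp: W_scale b_scale_left b_scale_right)
    then show ?thesis using that W X qe by (simp add: q_scale)
  qed
  define f' where "f' i = f i + g i" for i
  have f': "f' i \<in> W" if "i < r" for i using that W g by (simp add: f'_def W_add)
  have q': "q (f' i) = 0" if "i < r" for i
    using that W g qg bfg qf[OF that] eps by (auto simp: f'_def q_add X_def c2)
  have diag: "b (f i) (f i) = 0" if "i < r" for i
    using that W b_diag[of "f i"] qf[OF that] eps c2(1)[of 1] by auto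
  have "b (f' i) (f' j) = 0" if "i < r" "j < r" for i j
  proof -
    have "b (f' i) (f' j) = b (f i) (f j) + X j i + X i j"
      using that W g by (simp add: f'_def bq_simps bgg bfg b_sym[of "g i" "f j"] algebra_simps)
    then show ?thesis using that W diag
      by (cases i j rule: linorder_cases) (auto simp: X_def c2 b_sym[of "f i" "f j"])
  qed
  moreover have "b (e i) (f' j) = of_bool (i = j)" if "i < r" "j < r" for i j
    using that W g bef beg by (simp add: f'_def b_add_right)
  ultimately have "hyp_system r e f'"
    unfolding hyp_system_def using W f' q' qe bee by auto
  moreover have "b w (f' i) = 0" if "w \<in> W" "\<And>i. i < r \<Longrightarrow> b w (e i) = 0 \<and> b w (f i) = 0" "i < r" for w i
    using that W g by (simp add: f'_def b_add_right bg)
  ultimately show ?thesis by blast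
qed

end

section \<open>Assembling linear maps; the radical and dual systems\<close>

context form_space
begin

lemma lin_on_plus:
  "lin_on K sv (*s) V W f \<Longrightarrow> lin_on K sv (*s) V W g \<Longrightarrow> lin_on K sv (*s) V W (\<lambda>x. f x + g x)"
  unfolding lin_on_def by (auto simp: W_add algebra_simps)

lemma lin_on_zero: "lin_on K sv (*s) V W (\<lambda>x. 0)"
  unfolding lin_on_def by (auto simp: W_zero)

lemma lin_on_sum:
  "(\<And>i. i \<in> I \<Longrightarrow> lin_on K sv (*s) V W (f i)) \<Longrightarrow> lin_on K sv (*s) V W (\<lambda>x. \<Sum>i\<in>I. f i x)"
  by (induction I rule: infinite_finite_induct) (auto intro: lin_on_plus lin_on_zero)

lemma lin_on_functional:
  assumes "p \<in> W" "\<And>x. x \<in> V \<Longrightarrow> c x \<in> K" "\<And>x y. x \<in> V \<Longrightarrow> y \<in> V \<Longrightarrow> c (x + y) = c x + c y"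
    "\<And>k x. k \<in> K \<Longrightarrow> x \<in> V \<Longrightarrow> c (sv k x) = k * c x"
  shows "lin_on K sv (*s) V W (\<lambda>x. c x *s p)"
  using assms unfolding lin_on_def by (auto simp: W_scale algebra_simps)

definition Rad :: "'w set" where
  "Rad = {x \<in> W. \<forall>y\<in>W. b x y = 0}"

text \<open>A finite substitute for a basis modulo the radical: orthogonality to the
  \<open>p i\<close> alone decides membership in \<open>Rad\<close>.\<close>

definition dual_system :: "nat \<Rightarrow> (nat \<Rightarrow> 'w) \<Rightarrow> (nat \<Rightarrow> 'w) \<Rightarrow> bool" where
  "dual_system r p p' \<longleftrightarrow> (\<forall>i<r. p i \<in> W \<and> p' i \<in> W) \<and>
     (\<forall>i<r. \<forall>j<r. b (p i) (p' j) = of_bool (i = j)) \<and>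
     (\<forall>y\<in>W. (\<forall>i<r. b y (p i) = 0) \<longrightarrow> y \<in> Rad)"

end

section \<open>Cancellation of metabolic forms\<close>

text \<open>A frame exhibits \<open>W\<close> as containing the tensor product of \<open>V\<close> with the symmetric bilinear
form with Gram matrix \<open>\<langle>u\<rangle> \<bottom> [[0, 1], [1, d]]\<close>.\<close>

locale frame = V: form_space sv K V bV qV \<epsilon> + W: form_space sw K W bW qW \<epsilon>
  for sv :: "'a::field \<Rightarrow> 'v::ab_group_add \<Rightarrow> 'v" and K V bV qV \<epsilon>
    and sw :: "'a \<Rightarrow> 'w::ab_group_add \<Rightarrow> 'w" and W bW qW +
  fixes h :: nat and u :: 'a and d :: "nat \<Rightarrow> nat \<Rightarrow> 'a"
    and \<omega> :: "'v \<Rightarrow> 'w" and \<alpha> \<beta> :: "nat \<Rightarrow> 'v \<Rightarrow> 'w"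
  assumes lin_\<omega>: "lin_on K sv sw V W \<omega>"
    and lin_\<alpha>: "\<And>j. j < h \<Longrightarrow> lin_on K sv sw V W (\<alpha> j)"
    and lin_\<beta>: "\<And>j. j < h \<Longrightarrow> lin_on K sv sw V W (\<beta> j)"
    and u_in: "u \<in> K"
    and \<omega>\<omega>: "\<And>x y. x \<in> V \<Longrightarrow> y \<in> V \<Longrightarrow> bW (\<omega> x) (\<omega> y) = u * bV x y"
    and q\<omega>: "\<And>x. x \<in> V \<Longrightarrow> qW (\<omega> x) = u * qV x"
    and \<omega>\<alpha>: "\<And>j x y. j < h \<Longrightarrow> x \<in> V \<Longrightarrow> y \<in> V \<Longrightarrow> bW (\<omega> x) (\<alpha> j y) = 0"
    and \<omega>\<beta>: "\<And>j x y. j < h \<Longrightarrow> x \<in> V \<Longrightarrow> y \<in> V \<Longrightarrow> bW (\<omega> x) (\<beta> j y) = 0"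
    and \<alpha>\<alpha>: "\<And>i j x y. i < h \<Longrightarrow> j < h \<Longrightarrow> x \<in> V \<Longrightarrow> y \<in> V \<Longrightarrow> bW (\<alpha> i x) (\<alpha> j y) = 0"
    and q\<alpha>: "\<And>j x. j < h \<Longrightarrow> x \<in> V \<Longrightarrow> qW (\<alpha> j x) = 0"
    and \<alpha>\<beta>: "\<And>i j x y. i < h \<Longrightarrow> j < h \<Longrightarrow> x \<in> V \<Longrightarrow> y \<in> V \<Longrightarrow>
      bW (\<alpha> i x) (\<beta> j y) = of_bool (i = j) * bV x y"
    and \<beta>\<beta>: "\<And>i j x y. i < h \<Longrightarrow> j < h \<Longrightarrow> x \<in> V \<Longrightarrow> y \<in> V \<Longrightarrow> bW (\<beta> i x) (\<beta> j y) = d i j * bV x y"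
    and q\<beta>: "\<And>j x. j < h \<Longrightarrow> x \<in> V \<Longrightarrow> qW (\<beta> j x) = d j j * qV x"
begin

lemma \<omega>_in: "x \<in> V \<Longrightarrow> \<omega> x \<in> W" and \<alpha>_in: "j < h \<Longrightarrow> x \<in> V \<Longrightarrow> \<alpha> j x \<in> W"
  and \<beta>_in: "j < h \<Longrightarrow> x \<in> V \<Longrightarrow> \<beta> j x \<in> W"
  using lin_\<omega> lin_\<alpha> lin_\<beta> lin_onD(1) by metis+

lemma \<alpha>\<omega>: "j < h \<Longrightarrow> x \<in> V \<Longrightarrow> y \<in> V \<Longrightarrow> bW (\<alpha> j y) (\<omega> x) = 0"
  using \<omega>\<alpha> W.b_sym \<omega>_in \<alpha>_in by metis

lemma \<beta>\<omega>: "j < h \<Longrightarrow> x \<in> V \<Longrightarrow> y \<in> V \<Longrightarrow> bW (\<beta> j y) (\<omega> x) = 0"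
  using \<omega>\<beta> W.b_sym \<omega>_in \<beta>_in by metis

lemma \<beta>\<alpha>: "i < h \<Longrightarrow> j < h \<Longrightarrow> x \<in> V \<Longrightarrow> y \<in> V \<Longrightarrow> bW (\<beta> j y) (\<alpha> i x) = of_bool (i = j) * bV y x"
  using \<alpha>\<beta> W.b_sym \<beta>_in \<alpha>_in V.b_sym by metis

lemmas pairings = \<omega>\<omega> \<omega>\<alpha> \<omega>\<beta> \<alpha>\<alpha> \<alpha>\<beta> \<beta>\<beta> \<alpha>\<omega> \<beta>\<omega> \<beta>\<alpha>
lemmas ins = \<omega>_in \<alpha>_in \<beta>_in

text \<open>The vectors \<open>\<alpha> j (p i)\<close> and corrected
  \<open>\<beta> j (p' i)\<close> make the metabolic part hyperbolic up to the radical. Correcting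
  \<open>\<beta>\<close> by \<open>\<omega>\<close> spoils the orthogonality of
  \<open>\<omega>\<close> to it, so the copy of the form scaled by \<open>u\<close> is tilted along
  the \<open>\<alpha> j\<close>, at no cost since these are isotropic and orthogonal to
  \<open>\<omega>\<close>.\<close>

lemma hyperbolic_part:
  assumes dual: "V.dual_system r p p'"
    and lin_g: "\<And>j. j < h \<Longrightarrow> lin_on K sv sv V V (g j)"
    and q_g: "\<And>j y. \<epsilon> = 0 \<Longrightarrow> j < h \<Longrightarrow> y \<in> V \<Longrightarrow> u * qV (g j y) = d j j * qV y"
  shows "\<exists>e f \<iota>. W.hyp_system (h * r) e f \<and> (\<forall>i<r. \<forall>j<h. \<exists>t < h * r. e t = \<alpha> j (p i)) \<and>
    lin_on K sv sw V W \<iota> \<and> (\<forall>x\<in>V. \<forall>y\<in>V. bW (\<iota> x) (\<iota> y) = u * bV x y) \<and>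
    (\<forall>x\<in>V. qW (\<iota> x) = u * qV x) \<and>
    (\<forall>x\<in>V. \<forall>t < h * r. bW (\<iota> x) (e t) = 0 \<and> bW (\<iota> x) (f t) = 0)"
proof -
  have p: "p i \<in> V" "p' i \<in> V" if "i < r" for i
    using dual that unfolding V.dual_system_def by auto
  have pp': "bV (p i) (p' j) = of_bool (i = j)" if "i < r" "j < r" for i j
    using dual that unfolding V.dual_system_def by auto
  \<comment> \<open>For \<open>\<epsilon> = 0\<close> the value \<open>d j j * qV y\<close> is
    cancelled by the equal value \<open>u * qV (g j y)\<close> of the shift. For
    \<open>\<epsilon> = 1\<close> no shift is made, since \<open>complete_to_hyp_system\<close>
    repairs the value itself.\<close>
  define G where "G j y = (if \<epsilon> = 0 then g j y else 0)" for j y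
  have G: "G j y \<in> V" if "j < h" "y \<in> V" for j y
    using lin_onD(1)[OF lin_g] that V.W_zero by (auto simp: G_def)
  \<comment> \<open>The pair of indices j, i is coded as \<open>t = j * r + i\<close>.\<close>
  define e where "e t = \<alpha> (t div r) (p (t mod r))" for t
  define f where "f t = \<beta> (t div r) (p' (t mod r)) + \<omega> (G (t div r) (p' (t mod r)))" for t
  have idx: "t div r < h \<and> t mod r < r" if "t < h * r" for t
    using that by (metis less_mult_imp_div_less mod_less_divisor mult_0_right neq0_conv not_less_zero)
  have idx_eq: "t div r = s div r \<and> t mod r = s mod r \<longleftrightarrow> t = s" for s t
    by (metis div_mult_mod_eq)
  have fW: "f t \<in> W" if "t < h * r" for t
    using idx[OF that] p G by (simp add: f_def ins W.W_add)
  have eW: "e t \<in> W" if "t < h * r" for t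
    using idx[OF that] p by (simp add: e_def ins)
  have bef: "bW (e s) (f t) = of_bool (s = t)" if "s < h * r" "t < h * r" for s t
    using idx[OF that(1)] idx[OF that(2)] p G pp' idx_eq[of s t]
    by (auto simp: e_def f_def W.b_add_right ins pairings)
  have qf: "qW (f t) = 0" if "t < h * r" "\<epsilon> = 0" for t
    using idx[OF that(1)] p G that(2)
    by (simp add: f_def W.q_add ins q\<beta> q\<omega>) (simp add: G_def q_g W.c2)
  have bee: "bW (e s) (e t) = 0" if "s < h * r" "t < h * r" for s t
    using idx[OF that(1)] idx[OF that(2)] p by (auto simp: e_def pairings)
  have qe: "qW (e s) = 0" if "s < h * r" for s
    using idx[OF that] p by (auto simp: e_def q\<alpha>)
  obtain f' where f': "W.hyp_system (h * r) e f'"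
    "\<And>w i. w \<in> W \<Longrightarrow> (\<forall>i < h * r. bW w (e i) = 0 \<and> bW w (f i) = 0) \<Longrightarrow> i < h * r \<Longrightarrow> bW w (f' i) = 0"
    using W.complete_to_hyp_system[of "h * r" e f, OF eW fW qe bee bef qf] by blast
  \<comment> \<open>Chosen so that pairing with \<open>p' i\<close> gives
    \<open>u * bV (G j (p' i)) x\<close>, the amount by which \<open>\<omega> x\<close> fails to be
    orthogonal to the shifted vector.\<close>
  define X where "X j x = (\<Sum>i<r. sv (u * bV (G j (p' i)) x) (p i))" for j x
  have lin_X: "lin_on K sv sv V V (X j)" if "j < h" for j
    unfolding X_def using that p G u_in
    by (intro V.lin_on_sum V.lin_on_functional) (auto simp: V.bq_simps algebra_simps)
  have XV: "X j x \<in> V" if "j < h" "x \<in> V" for j x using lin_X lin_onD(1) that by metis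
  have bX: "bV (X j x) (p' i) = u * bV (G j (p' i)) x" if "j < h" "x \<in> V" "i < r" for i j x
  proof -
    have "bV (X j x) (p' i) = (\<Sum>l<r. bV (sv (u * bV (G j (p' l)) x) (p l)) (p' i))"
      unfolding X_def by (subst V.b_sum_left) (use that p G u_in in \<open>auto simp: V.bq_simps\<close>)
    also have "\<dots> = (\<Sum>l<r. if l = i then u * bV (G j (p' l)) x else 0)"
      using that p G u_in pp' by (intro sum.cong) (auto simp: V.bq_simps)
    finally show ?thesis using that by simp
  qed
  define A where "A x = (\<Sum>j<h. \<alpha> j (X j x))" for x
  have lin_A: "lin_on K sv sw V W A"
    unfolding A_def by (intro W.lin_on_sum) (rule lin_on_comp[OF lin_X lin_\<alpha>], auto)
  have AW: "A x \<in> W" if "x \<in> V" for x using lin_A lin_onD(1) that by metis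
  have bA: "bW w (A x) = (\<Sum>j<h. bW w (\<alpha> j (X j x)))" if "w \<in> W" "x \<in> V" for w x
    unfolding A_def using that XV by (intro W.b_sum_right) (auto simp: ins)
  have wA: "bW (\<omega> y) (A x) = 0" "bW (A x) (\<omega> y) = 0" if "x \<in> V" "y \<in> V" for x y
    using bA[of "\<omega> y" x] that XV W.b_sym[of "\<omega> y" "A x"] AW by (auto simp: ins pairings)
  have \<alpha>A: "bW (\<alpha> j y) (A x) = 0" "bW (A x) (\<alpha> j y) = 0" if "x \<in> V" "y \<in> V" "j < h" for x y j
    using bA[of "\<alpha> j y" x] that XV W.b_sym[of "\<alpha> j y" "A x"] AW by (auto simp: ins pairings)
  have AA: "bW (A y) (A x) = 0" if "x \<in> V" "y \<in> V" for x y
    using bA[of "A y" x] that XV AW by (auto simp: \<alpha>A)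
  have \<beta>A: "bW (A x) (\<beta> j y) = bV (X j x) y" if "x \<in> V" "y \<in> V" "j < h" for x y j
  proof -
    have "bW (A x) (\<beta> j y) = (\<Sum>i<h. bW (\<alpha> i (X i x)) (\<beta> j y))"
      unfolding A_def using that XV by (intro W.b_sum_left) (auto simp: ins)
    also have "\<dots> = (\<Sum>i<h. if i = j then bV (X i x) y else 0)"
      using that XV by (intro sum.cong) (auto simp: pairings)
    finally show ?thesis using that by simp
  qed
  have qA: "qW (A x) = 0" if "x \<in> V" for x
  proof -
    have "qW (A x) = (\<Sum>j<h. qW (\<alpha> j (X j x)))"
      unfolding A_def using that XV by (intro W.q_sum) (auto simp: ins pairings)
    then show ?thesis using that XV by (simp add: q\<alpha>)
  qed
  define \<iota> where "\<iota> x = \<omega> x + A x" for x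
  have "lin_on K sv sw V W \<iota>"
    unfolding \<iota>_def by (intro W.lin_on_plus lin_A lin_\<omega>)
  moreover have "bW (\<iota> x) (\<iota> y) = u * bV x y" if "x \<in> V" "y \<in> V" for x y
    using that by (simp add: \<iota>_def W.b_add_left W.b_add_right W.W_add ins AW wA AA pairings)
  moreover have "qW (\<iota> x) = u * qV x" if "x \<in> V" for x
    using that by (simp add: \<iota>_def W.q_add ins AW wA qA q\<omega>)
  moreover have \<iota>e: "bW (\<iota> x) (e t) = 0" if "x \<in> V" "t < h * r" for x t
    using that idx[OF that(2)] p by (simp add: \<iota>_def e_def W.b_add_left ins AW pairings \<alpha>A)
  moreover have \<iota>f: "bW (\<iota> x) (f t) = 0" if "x \<in> V" "t < h * r" for x t
    using that idx[OF that(2)] p G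
    by (simp add: \<iota>_def f_def W.b_add_left W.b_add_right W.W_add ins AW pairings \<beta>A wA bX V.b_sym[of x] W.c2)
  moreover have "bW (\<iota> x) (f' t) = 0" if "x \<in> V" "t < h * r" for x t
    using that \<iota>e \<iota>f by (intro f'(2)) (auto simp: \<iota>_def ins AW W.W_add)
  moreover have "\<exists>t < h * r. e t = \<alpha> j (p i)" if "i < r" "j < h" for i j
  proof (intro exI conjI)
    have "j * r + i < j * r + r" using that by simp
    also have "\<dots> \<le> h * r" using that(2) mult_le_mono1[of "Suc j" h r] by simp
    finally show "j * r + i < h * r" .
    show "e (j * r + i) = \<alpha> j (p i)" using that by (simp add: e_def)
  qed
  ultimately show ?thesis using f'(1) by blast
qed

end

locale complete_frame = frame +
  fixes \<Omega> :: "'c \<Rightarrow> 'b" and X Y :: "nat \<Rightarrow> 'c \<Rightarrow> 'b"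
  assumes lin_\<Omega>: "lin_on K sw sv W V \<Omega>"
    and X_in: "\<And>j w. j < h \<Longrightarrow> w \<in> W \<Longrightarrow> X j w \<in> V"
    and lin_Y: "\<And>j. j < h \<Longrightarrow> lin_on K sw sv W V (Y j)"
    and decomp: "\<And>w. w \<in> W \<Longrightarrow> w = \<omega> (\<Omega> w) + (\<Sum>j<h. \<alpha> j (X j w)) + (\<Sum>j<h. \<beta> j (Y j w))"
begin

lemma \<Omega>_in: "w \<in> W \<Longrightarrow> \<Omega> w \<in> V" and Y_in: "j < h \<Longrightarrow> w \<in> W \<Longrightarrow> Y j w \<in> V"
  using lin_\<Omega> lin_Y lin_onD(1) by metis+

lemma b_decomp:
  assumes "w \<in> W" "z \<in> W"
  shows "bW w z = bW (\<omega> (\<Omega> w)) z + (\<Sum>j<h. bW (\<alpha> j (X j w)) z) + (\<Sum>j<h. bW (\<beta> j (Y j w)) z)"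
proof -
  have AB: "(\<Sum>j<h. \<alpha> j (X j w)) \<in> W" "(\<Sum>j<h. \<beta> j (Y j w)) \<in> W"
    using assms by (auto intro!: W.W_sum simp: ins X_in Y_in)
  have "bW w z = bW (\<omega> (\<Omega> w) + (\<Sum>j<h. \<alpha> j (X j w)) + (\<Sum>j<h. \<beta> j (Y j w))) z"
    using decomp[OF assms(1)] by simp
  also have "\<dots> = bW (\<omega> (\<Omega> w)) z + bW (\<Sum>j<h. \<alpha> j (X j w)) z + bW (\<Sum>j<h. \<beta> j (Y j w)) z"
    using assms AB by (simp add: W.b_add_left W.W_add ins \<Omega>_in)
  also have "bW (\<Sum>j<h. \<alpha> j (X j w)) z = (\<Sum>j<h. bW (\<alpha> j (X j w)) z)"
    using assms by (intro W.b_sum_left) (auto simp: ins X_in)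
  also have "bW (\<Sum>j<h. \<beta> j (Y j w)) z = (\<Sum>j<h. bW (\<beta> j (Y j w)) z)"
    using assms by (intro W.b_sum_left) (auto simp: ins Y_in)
  finally show ?thesis .
qed

text \<open>Reads off the \<open>\<beta>\<close>-coordinate of \<open>w\<close>: being orthogonal to
  the image of \<open>\<alpha> j\<close> means that this coordinate is radical.\<close>

lemma b_\<alpha>: 
  assumes "w \<in> W" "j < h" "x \<in> V"
  shows "bW w (\<alpha> j x) = bV (Y j w) x"
proof -
  have "bW w (\<alpha> j x) = (\<Sum>i<h. bW (\<beta> i (Y i w)) (\<alpha> j x))"
    using assms b_decomp[of w "\<alpha> j x"] by (simp add: ins pairings \<Omega>_in X_in)
  also have "\<dots> = (\<Sum>i<h. if i = j then bV (Y i w) x else 0)"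
    using assms Y_in by (intro sum.cong) (auto simp: pairings)
  finally show ?thesis using assms by simp
qed

text \<open>Radical \<open>\<beta>\<close>-coordinates pair to zero with everything, so the
  \<open>\<alpha>\<close>-coordinates lose their partners and drop out. Beyond
  \<open>\<omega>\<close> only the values of \<open>q\<close> on the radical remain.\<close>

lemma radical_complement:
  assumes w: "w \<in> W" "\<And>j. j < h \<Longrightarrow> Y j w \<in> V.Rad" and z: "z \<in> W" "\<And>j. j < h \<Longrightarrow> Y j z \<in> V.Rad"
  shows "bW w z = u * bV (\<Omega> w) (\<Omega> z)" "qW w = u * qV (\<Omega> w) + (\<Sum>j<h. d j j * qV (Y j w))"
proof -
  have R: "bV (Y j w) x = 0" "bV (Y j z) x = 0" "bV x (Y j w) = 0" "bV x (Y j z) = 0" if "j < h" "x \<in> V" for j x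
  proof -
    show 1: "bV (Y j w) x = 0" "bV (Y j z) x = 0" using w z that unfolding V.Rad_def by auto
    show "bV x (Y j w) = 0" "bV x (Y j z) = 0" using 1 w z that Y_in V.b_sym by metis+
  qed
  have az: "bW (\<alpha> j x) z = 0" if "j < h" "x \<in> V" for j x
    using b_\<alpha>[of z j x] W.b_sym[of "\<alpha> j x" z] that z R by (simp add: ins)
  have "bW z (\<omega> x) = u * bV (\<Omega> z) x" if "x \<in> V" for x
    using b_decomp[of z "\<omega> x"] that z by (simp add: ins pairings \<Omega>_in X_in Y_in)
  then have wz: "bW (\<omega> x) z = u * bV x (\<Omega> z)" if "x \<in> V" for x
    using that W.b_sym[of "\<omega> x" z] V.b_sym[of x "\<Omega> z"] z by (simp add: ins \<Omega>_in)
  have "bW z (\<beta> j (Y j w)) = 0" if "j < h" for j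
  proof -
    have "(\<Sum>i<h. bW (\<alpha> i (X i z)) (\<beta> j (Y j w))) = 0" "(\<Sum>i<h. bW (\<beta> i (Y i z)) (\<beta> j (Y j w))) = 0"
      using that z w X_in Y_in R by (auto intro!: sum.neutral simp: pairings)
    then show ?thesis using b_decomp[of z "\<beta> j (Y j w)"] that z w
      by (simp add: ins pairings \<Omega>_in Y_in)
  qed
  then have "bW (\<beta> j (Y j w)) z = 0" if "j < h" for j
    using that W.b_sym[of "\<beta> j (Y j w)" z] z w by (simp add: ins Y_in)
  then show "bW w z = u * bV (\<Omega> w) (\<Omega> z)"
    using b_decomp[of w z] w z by (simp add: wz az \<Omega>_in X_in)
  define A where "A = (\<Sum>j<h. \<alpha> j (X j w))"
  define B where "B = (\<Sum>j<h. \<beta> j (Y j w))"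
  have AB: "A \<in> W" "B \<in> W" unfolding A_def B_def using w by (auto intro!: W.W_sum simp: ins X_in Y_in)
  have "qW A = (\<Sum>j<h. qW (\<alpha> j (X j w)))"
    unfolding A_def using w by (intro W.q_sum) (auto simp: ins pairings X_in)
  then have qA: "qW A = 0" using w by (simp add: q\<alpha> X_in)
  have "qW B = (\<Sum>j<h. qW (\<beta> j (Y j w)))"
    unfolding B_def using w R by (intro W.q_sum) (auto simp: ins pairings Y_in)
  then have qB: "qW B = (\<Sum>j<h. d j j * qV (Y j w))" using w by (simp add: q\<beta> Y_in)
  have wA: "bW (\<omega> x) A = 0" if "x \<in> V" for x
    unfolding A_def using that w by (subst W.b_sum_right) (auto simp: ins pairings X_in)
  have wB: "bW (\<omega> x) B = 0" if "x \<in> V" for x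
    unfolding B_def using that w by (subst W.b_sum_right) (auto simp: ins pairings Y_in)
  have aB: "bW (\<alpha> i x) B = 0" if "i < h" "x \<in> V" for i x
    unfolding B_def using that w R by (subst W.b_sum_right) (auto simp: ins pairings Y_in intro!: sum.neutral)
  have "bW A B = 0"
    unfolding A_def using AB w aB by (subst W.b_sum_left) (auto simp: ins X_in)
  then have "qW (\<omega> (\<Omega> w) + A + B) = u * qV (\<Omega> w) + (\<Sum>j<h. d j j * qV (Y j w))"
    using w AB qA qB wA wB by (simp add: W.q_add W.b_add_left W.W_add ins \<Omega>_in q\<omega>)
  then show "qW w = u * qV (\<Omega> w) + (\<Sum>j<h. d j j * qV (Y j w))"
    using decomp[OF w(1)] unfolding A_def B_def by simp
qed

end

text \<open>Once the hyperbolic planes are aligned, the copy of the scaled form lands in their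
  orthogonal complement, where \<open>radical_complement\<close> compares it with the form on
  \<open>V\<close>. The only discrepancy consists of values of \<open>q\<close> on the radical, and
  \<open>g'\<close> realises these by radical vectors.\<close>

theorem metabolic_cancellation:
  fixes \<epsilon> :: "'a::field"
  assumes src: "frame sv K V bV qV \<epsilon> sw1 W1 bW1 qW1 h u d \<omega> \<alpha> \<beta>"
    and tgt: "complete_frame sv K V bV qV \<epsilon> sw2 W2 bW2 qW2 h 1 d' \<omega>' \<alpha>' \<beta>' \<Omega> X Y"
    and T: "lin_on K sw1 sw2 W1 W2 T" "\<And>x y. x \<in> W1 \<Longrightarrow> y \<in> W1 \<Longrightarrow> bW2 (T x) (T y) = bW1 x y"
      "\<And>x. x \<in> W1 \<Longrightarrow> qW2 (T x) = qW1 x"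
    and dual: "form_space.dual_system V bV r p p'"
    and g: "\<And>j. j < h \<Longrightarrow> lin_on K sv sv V V (g j)"
      "\<And>j y. \<epsilon> = 0 \<Longrightarrow> j < h \<Longrightarrow> y \<in> V \<Longrightarrow> u * qV (g j y) = d j j * qV y"
    and g': "\<And>j. j < h \<Longrightarrow> lin_on K sv sv V V (g' j)"
      "\<And>j y. \<epsilon> = 0 \<Longrightarrow> j < h \<Longrightarrow> y \<in> V \<Longrightarrow> qV (g' j y) = d' j j * qV y"
      "\<And>j y. j < h \<Longrightarrow> y \<in> form_space.Rad V bV \<Longrightarrow>
         g' j y \<in> form_space.Rad V bV \<and> qV (g' j y) = d' j j * qV y"
  shows "\<exists>S. lin_on K sv sv V V S \<and> (\<forall>x\<in>V. \<forall>y\<in>V. bV (S x) (S y) = u * bV x y) \<and> (\<forall>x\<in>V. qV (S x) = u * qV x)"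
proof -
  interpret S: frame sv K V bV qV \<epsilon> sw1 W1 bW1 qW1 h u d \<omega> \<alpha> \<beta> by (rule src)
  interpret T: complete_frame sv K V bV qV \<epsilon> sw2 W2 bW2 qW2 h 1 d' \<omega>' \<alpha>' \<beta>' \<Omega> X Y by (rule tgt)
  note hS = S.hyperbolic_part[of r p p' g, OF dual g(1) g(2), simplified]
  have "1 * qV (g' j y) = d' j j * qV y" if "\<epsilon> = 0" "j < h" "y \<in> V" for j y using g'(2) that by simp
  note hT = T.hyperbolic_part[of r p p' g', OF dual g'(1) this, simplified]
  obtain e f \<iota> where ef: "S.W.hyp_system (h * r) e f"
    and \<iota>: "lin_on K sv sw1 V W1 \<iota>" "\<And>x y. x \<in> V \<Longrightarrow> y \<in> V \<Longrightarrow> bW1 (\<iota> x) (\<iota> y) = u * bV x y"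
      "\<And>x. x \<in> V \<Longrightarrow> qW1 (\<iota> x) = u * qV x"
      "\<And>x t. x \<in> V \<Longrightarrow> t < h * r \<Longrightarrow> bW1 (\<iota> x) (e t) = 0 \<and> bW1 (\<iota> x) (f t) = 0"
    using hS by blast
  obtain e' f' where ef': "T.W.hyp_system (h * r) e' f'"
    and e': "\<And>i j. i < r \<Longrightarrow> j < h \<Longrightarrow> \<exists>t < h * r. e' t = \<alpha>' j (p i)"
    using hT by blast
  \<comment> \<open>Source and target systems have the same length, so an isometry of the target
    carries the image of the one to the other.\<close>
  have "T.W.hyp_system (h * r) (\<lambda>t. T (e t)) (\<lambda>t. T (f t))"
    using ef T lin_onD(1)[OF T(1)] unfolding S.W.hyp_system_def T.W.hyp_system_def by auto
  then obtain \<sigma> where s: "T.W.isometry \<sigma>" "\<And>t. t < h * r \<Longrightarrow> \<sigma> (T (e t)) = e' t"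
    using T.W.move_hyp_system[OF _ ef'] by blast
  define \<tau> where "\<tau> x = \<sigma> (T (\<iota> x))" for x
  have \<iota>W: "\<iota> x \<in> W1" if "x \<in> V" for x using \<iota>(1) lin_onD(1) that by metis
  have eW: "e t \<in> W1" if "t < h * r" for t using ef that unfolding S.W.hyp_system_def by auto
  have lin_\<sigma>: "lin_on K sw2 sw2 W2 W2 \<sigma>" using s(1) unfolding T.W.isometry_def by simp
  have \<tau>: "lin_on K sv sw2 V W2 \<tau>"
    unfolding \<tau>_def using lin_on_comp[OF lin_on_comp[OF \<iota>(1) T(1)] lin_\<sigma>] .
  have \<tau>W: "\<tau> x \<in> W2" if "x \<in> V" for x using \<tau> lin_onD(1) that by metis
  have TW: "T x \<in> W2" if "x \<in> W1" for x using T(1) lin_onD(1) that by metis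
  have \<tau>b: "bW2 (\<tau> x) (\<tau> y) = u * bV x y" "qW2 (\<tau> x) = u * qV x" if "x \<in> V" "y \<in> V" for x y
    using that T.W.isometryD[OF s(1)] by (simp_all add: \<tau>_def TW \<iota>W T \<iota>)
  have Rad: "Y j (\<tau> x) \<in> S.V.Rad" if "j < h" "x \<in> V" for j x
  proof -
    have "bV (Y j (\<tau> x)) (p i) = 0" if i: "i < r" for i
    proof -
      have "p i \<in> V" using dual i unfolding S.V.dual_system_def by auto
      obtain t where t: "t < h * r" "e' t = \<alpha>' j (p i)" using e' i \<open>j < h\<close> by blast
      have "bV (Y j (\<tau> x)) (p i) = bW2 (\<tau> x) (e' t)"
        using T.b_\<alpha> \<tau>W that \<open>p i \<in> V\<close> t \<open>x \<in> V\<close> \<open>j < h\<close> by simp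
      also have "\<dots> = bW2 (\<sigma> (T (\<iota> x))) (\<sigma> (T (e t)))" using s(2) t by (simp add: \<tau>_def)
      also have "\<dots> = 0" using T.W.isometryD(2)[OF s(1)] \<open>x \<in> V\<close> t by (simp add: TW \<iota>W eW T \<iota>)
      finally show ?thesis .
    qed
    then show ?thesis using dual T.Y_in[OF that(1) \<tau>W[OF that(2)]] unfolding S.V.dual_system_def by blast
  qed
  define H where "H x = (\<Sum>j<h. g' j (Y j (\<tau> x)))" for x
  \<comment> \<open>Adding the radical vector \<open>H x\<close> leaves \<open>bV\<close> unchanged
    and contributes exactly the diagonal terms of \<open>radical_complement\<close>.\<close>
  define S where "S x = \<Omega> (\<tau> x) + H x" for x
  have lin_H: "lin_on K sv sv V V H"
    unfolding H_def by (intro S.V.lin_on_sum) (rule lin_on_comp[OF lin_on_comp[OF \<tau> T.lin_Y] g'(1)], auto)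
  have lin_S: "lin_on K sv sv V V S"
    unfolding S_def by (intro S.V.lin_on_plus lin_H lin_on_comp[OF \<tau> T.lin_\<Omega>])
  have gR: "g' j (Y j (\<tau> x)) \<in> S.V.Rad" "qV (g' j (Y j (\<tau> x))) = d' j j * qV (Y j (\<tau> x))" if "j < h" "x \<in> V" for j x
    using g'(3) Rad that by blast+
  have gV: "g' j (Y j (\<tau> x)) \<in> V" if "j < h" "x \<in> V" for j x using gR that unfolding S.V.Rad_def by blast
  have HV: "H x \<in> V" if "x \<in> V" for x using lin_H lin_onD(1) that by metis
  have bH: "bV (H x) y = 0" "bV y (H x) = 0" if "x \<in> V" "y \<in> V" for x y
  proof -
    have "bV (H x) y = (\<Sum>j<h. bV (g' j (Y j (\<tau> x))) y)"
      unfolding H_def using that gV by (intro S.V.b_sum_left) auto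
    then show "bV (H x) y = 0" using gR that unfolding S.V.Rad_def by simp
    then show "bV y (H x) = 0" using S.V.b_sym HV that by metis
  qed
  have qH: "qV (H x) = (\<Sum>j<h. d' j j * qV (Y j (\<tau> x)))" if "x \<in> V" for x
  proof -
    have "qV (H x) = (\<Sum>j<h. qV (g' j (Y j (\<tau> x))))"
      unfolding H_def using that gV gR unfolding S.V.Rad_def by (intro S.V.q_sum) auto
    then show ?thesis using gR that by simp
  qed
  have OV: "\<Omega> (\<tau> x) \<in> V" if "x \<in> V" for x using T.\<Omega>_in \<tau>W that by blast
  have "bV (S x) (S y) = u * bV x y" if "x \<in> V" "y \<in> V" for x y
    using that T.radical_complement(1)[of "\<tau> x" "\<tau> y"] \<tau>W Rad OV HV bH \<tau>b
    by (simp add: S_def S.V.b_add_left S.V.b_add_right S.V.W_add)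
  moreover have "qV (S x) = u * qV x" if "x \<in> V" for x
    using that T.radical_complement(2)[of "\<tau> x" "\<tau> x"] \<tau>W Rad OV HV bH \<tau>b qH
    by (simp add: S_def S.V.q_add)
  ultimately show ?thesis using lin_S by blast
qed

section \<open>Coordinate vectors\<close>

lemma sum_fun_apply: "(\<Sum>i\<in>I. f i) x = (\<Sum>i\<in>I. f i x)"
  by (induction I rule: infinite_finite_induct) auto

lemma homogeneous_system_nat:
  fixes M :: "nat \<Rightarrow> nat \<Rightarrow> 'a::field"
  assumes "subfield K" and "n < r" and "\<And>i j. i < n \<Longrightarrow> j < r \<Longrightarrow> M i j \<in> K"
  shows "\<exists>c. (\<forall>j<r. c j \<in> K) \<and> (\<exists>j<r. c j \<noteq> 0) \<and> (\<forall>i<n. (\<Sum>j<r. M i j * c j) = 0)"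
  using homogeneous_system_nontrivial[of K "{..<n}" "{..<r}" M] assms
  by (simp add: Ball_def Bex_def)

lemma additive_sum:
  fixes F :: "'v::comm_monoid_add \<Rightarrow> 'b::comm_monoid_add"
  assumes "F 0 = 0" "\<And>x y. F (x + y) = F x + F y"
  shows "F (sum f I) = (\<Sum>i\<in>I. F (f i))"
  using assms by (induction I rule: infinite_finite_induct) auto

lemma sum_closed:
  fixes f :: "'i \<Rightarrow> 'v::comm_monoid_add"
  assumes "0 \<in> X" "\<And>x y. x \<in> X \<Longrightarrow> y \<in> X \<Longrightarrow> x + y \<in> X" "\<And>i. i \<in> I \<Longrightarrow> f i \<in> X"
  shows "sum f I \<in> X"
  using assms by (induction I rule: infinite_finite_induct) auto

definition sc :: "'a::field \<Rightarrow> (nat \<Rightarrow> 'a) \<Rightarrow> nat \<Rightarrow> 'a" where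
  "sc k x = (\<lambda>i. k * x i)"

text \<open>Zeros beyond \<open>n\<close> make the representing function unique, so equality of
  vectors is equality of functions; \<open>restr\<close> produces this normal form.\<close>

definition kvec :: "'a::field set \<Rightarrow> nat \<Rightarrow> (nat \<Rightarrow> 'a) set" where
  "kvec E n = {x. (\<forall>i<n. x i \<in> E) \<and> (\<forall>i\<ge>n. x i = 0)}"

definition evec :: "nat \<Rightarrow> nat \<Rightarrow> 'a::field" where
  "evec j = (\<lambda>i. of_bool (i = j))"

lemma sc_apply [simp]: "sc k x i = k * x i" by (simp add: sc_def)

lemma module_sc: "Modules.module sc"
  by standard (auto simp: algebra_simps)

lemma kvec_zero: "subfield E \<Longrightarrow> 0 \<in> kvec E n"
  and kvec_add: "subfield E \<Longrightarrow> x \<in> kvec E n \<Longrightarrow> y \<in> kvec E n \<Longrightarrow> x + y \<in> kvec E n"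
  and kvec_sc: "subfield E \<Longrightarrow> k \<in> E \<Longrightarrow> x \<in> kvec E n \<Longrightarrow> sc k x \<in> kvec E n"
  and kvec_evec: "subfield E \<Longrightarrow> j < n \<Longrightarrow> evec j \<in> kvec E n"
  by (auto simp: kvec_def evec_def subfield_intros of_bool_def)

lemma kvec_sum: "subfield E \<Longrightarrow> (\<And>i. i \<in> I \<Longrightarrow> f i \<in> kvec E n) \<Longrightarrow> sum f I \<in> kvec E n"
  by (rule sum_closed) (auto simp: kvec_zero kvec_add)

lemma kvec_expand: "x \<in> kvec E n \<Longrightarrow> x = (\<Sum>j<n. sc (x j) (evec j))"
proof
  fix i assume "x \<in> kvec E n"
  have "(\<Sum>j<n. sc (x j) (evec j)) i = (\<Sum>j<n. if j = i then x j else 0)"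
    unfolding sum_fun_apply by (rule sum.cong) (auto simp: evec_def)
  then show "x i = (\<Sum>j<n. sc (x j) (evec j)) i" using \<open>x \<in> kvec E n\<close> by (auto simp: kvec_def)
qed

lemma kvec_mono: "K \<subseteq> E \<Longrightarrow> kvec K n \<subseteq> kvec E n"
  by (auto simp: kvec_def)

definition restr :: "nat \<Rightarrow> (nat \<Rightarrow> 'a::zero) \<Rightarrow> nat \<Rightarrow> 'a" where
  "restr n x = (\<lambda>i. if i < n then x i else 0)"

lemma restr_kvec: "vec_in E n x \<Longrightarrow> restr n x \<in> kvec E n"
  by (auto simp: vec_in_def kvec_def restr_def)

lemma matvec_restr: "matvec n T (restr n x) = matvec n T x"
  by (auto simp: matvec_def restr_def)

lemma matvec_in: "subfield E \<Longrightarrow> mat_in E n T \<Longrightarrow> vec_in E n x \<Longrightarrow> vec_in E n (matvec n T x)"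
  unfolding vec_in_def mat_in_def matvec_def by (auto intro!: subfield_intros)

lemma matvec_add: "matvec n T (x + y) = matvec n T x + matvec n T y"
  by (auto simp: matvec_def sum.distrib algebra_simps)

lemma matvec_sc: "matvec n T (sc k x) = sc k (matvec n T x)"
  by (auto simp: matvec_def sum_distrib_left algebra_simps)

section \<open>Determinants\<close>

lemma mdet_det: "mdet n M = det (mat n n (\<lambda>(i,j). M i j))"
proof -
  have "det (mat n n (\<lambda>(i,j). M i j)) = (\<Sum>p | p permutes {0..<n}. of_int (sign p) * (\<Prod>i = 0..<n. M i (p i)))"
  proof -
    have "(mat n n (\<lambda>(i,j). M i j)) $$ (i, p i) = M i (p i)" if "p permutes {0..<n}" "i < n" for p i
      using permutes_in_image[OF that(1), of i] that(2) by simp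
    then show ?thesis unfolding det_def by (auto intro!: sum.cong prod.cong)
  qed
  then show ?thesis by (simp add: mdet_def lessThan_atLeast0)
qed

lemma mdet_cong: "(\<And>i j. i < n \<Longrightarrow> j < n \<Longrightarrow> M i j = M' i j) \<Longrightarrow> mdet n M = mdet n M'"
  unfolding mdet_det by (rule arg_cong[of _ _ det]) auto

lemma mdet_mult: "mdet n (\<lambda>i j. \<Sum>k<n. M i k * R k j) = mdet n M * mdet n R"
proof -
  have "mat n n (\<lambda>(i,j). M i j) * mat n n (\<lambda>(i,j). R i j) = mat n n (\<lambda>(i,j). \<Sum>k<n. M i k * R k j)"
    by (rule eq_matI) (auto simp: scalar_prod_def lessThan_atLeast0)
  then show ?thesis unfolding mdet_det by (metis det_mult mat_carrier)
qed

lemma mdet_one: "mdet n (\<lambda>i j. of_bool (i = j)) = 1"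
proof -
  have "mat n n (\<lambda>(i,j). of_bool (i = j)) = (1\<^sub>m n :: 'a mat)" by (rule eq_matI) auto
  then show ?thesis by (simp add: mdet_det)
qed

lemma mdet_nonzero_inverse:
  fixes M :: "nat \<Rightarrow> nat \<Rightarrow> 'a::field"
  assumes "mdet n M \<noteq> 0"
  shows "\<exists>R. \<forall>i<n. \<forall>j<n. (\<Sum>k<n. M i k * R k j) = of_bool (i = j)"
proof -
  define A where "A = mat n n (\<lambda>(i,j). M i j)"
  have A: "A \<in> carrier_mat n n" by (simp add: A_def)
  note adj = adj_mat[OF A]
  have "(\<Sum>k<n. M i k * (adj_mat A $$ (k, j) / det A)) = of_bool (i = j)" if ij: "i < n" "j < n" for i j
  proof -
    have "(A * adj_mat A) $$ (i, j) = (\<Sum>k<n. M i k * adj_mat A $$ (k, j))"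
      using ij adj(1) by (auto simp: A_def scalar_prod_def lessThan_atLeast0 intro!: sum.cong)
    moreover have "(A * adj_mat A) $$ (i, j) = det A * of_bool (i = j)"
      using ij adj(2) by simp
    ultimately have "(\<Sum>k<n. M i k * adj_mat A $$ (k, j)) = det A * of_bool (i = j)" by simp
    moreover have "(\<Sum>k<n. M i k * (adj_mat A $$ (k, j) / det A)) = (\<Sum>k<n. M i k * adj_mat A $$ (k, j)) / det A"
      by (simp add: sum_divide_distrib)
    moreover have "det A \<noteq> 0" using assms by (simp add: mdet_det A_def)
    ultimately show ?thesis by simp
  qed
  then show ?thesis by (intro exI[of _ "\<lambda>k j. adj_mat A $$ (k, j) / det A"]) simp
qed

text \<open>Among the columns of \<open>M\<close> and one unit vector there is a relation, and
  injectivity forces the unit vector to occur in it. Solving for it column by column builds a right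
  inverse.\<close>

lemma mdet_nonzero_if_injective:
  fixes M :: "nat \<Rightarrow> nat \<Rightarrow> 'a::field"
  assumes K: "subfield K" and M: "mat_in K n M"
    and inj: "\<And>x. x \<in> kvec K n \<Longrightarrow> (\<And>i. i < n \<Longrightarrow> matvec n M x i = 0) \<Longrightarrow> x = 0"
  shows "mdet n M \<noteq> 0"
proof -
  have "\<exists>R. \<forall>i<n. (\<Sum>k<n. M i k * R k) = of_bool (i = l)" if l: "l < n" for l
  proof -
    \<comment> \<open>The last column is the right-hand side to be solved for.\<close>
    define N where "N i j = (if j < n then M i j else of_bool (i = l))" for i j
    have "N i j \<in> K" if "i < n" "j < Suc n" for i j
      using M that K by (auto simp: N_def mat_in_def of_bool_def subfield_intros)
    with lessI obtain c where c: "\<forall>j<Suc n. c j \<in> K" "\<exists>j<Suc n. c j \<noteq> 0" "\<forall>i<n. (\<Sum>j<Suc n. N i j * c j) = 0"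
      using homogeneous_system_nat[OF K, of n "Suc n" N] by blast
    have eq: "(\<Sum>j<n. M i j * c j) + of_bool (i = l) * c n = 0" if "i < n" for i
      using c(3) that by (simp add: N_def)
    have cn: "c n \<noteq> 0"
    proof
      assume c0: "c n = 0"
      have "matvec n M (restr n c) i = 0" if "i < n" for i
        using eq[OF that] c0 unfolding matvec_restr by (simp add: matvec_def)
      moreover have "restr n c \<in> kvec K n" using c(1) by (intro restr_kvec) (simp add: vec_in_def)
      ultimately have "restr n c = 0" using inj by blast
      then have "c j = 0" if "j < n" for j using that by (metis restr_def zero_fun_apply)
      then show False using c(2) c0 less_Suc_eq by auto
    qed
    have "(\<Sum>k<n. M i k * (- c k / c n)) = of_bool (i = l)" if "i < n" for i
    proof -
      have "(\<Sum>k<n. M i k * (- c k / c n)) = - (\<Sum>k<n. M i k * c k) / c n"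
        by (simp add: sum_divide_distrib sum_negf)
      also have "\<dots> = of_bool (i = l)" using eq[OF that] cn by (simp add: eq_neg_iff_add_eq_0 [symmetric])
      finally show ?thesis .
    qed
    then show ?thesis by (intro exI[of _ "\<lambda>k. - c k / c n"]) simp
  qed
  then have "\<forall>l. \<exists>R. l < n \<longrightarrow> (\<forall>i<n. (\<Sum>k<n. M i k * R k) = of_bool (i = l))" by blast
  then obtain R where R: "\<forall>l. l < n \<longrightarrow> (\<forall>i<n. (\<Sum>k<n. M i k * R l k) = of_bool (i = l))"
    by (rule choice[THEN exE])
  have "mdet n M * mdet n (\<lambda>k l. R l k) = mdet n (\<lambda>i l. \<Sum>k<n. M i k * R l k)"
    by (rule mdet_mult[symmetric])
  also have "\<dots> = mdet n (\<lambda>i l. of_bool (i = l))"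
    by (rule mdet_cong) (use R in blast)
  finally show ?thesis by (auto simp: mdet_one)
qed

section \<open>Dual systems\<close>

text \<open>A rank factorisation of a pairing. Applied to the form on all of coordinate space it
  yields a dual system; applied to the dot product on a subspace it yields a projection.\<close>

lemma dual_pair_exists:
  fixes \<beta> :: "(nat \<Rightarrow> 'a::field) \<Rightarrow> (nat \<Rightarrow> 'a) \<Rightarrow> 'a"
  assumes K: "subfield K" and X: "X \<subseteq> kvec K n"
    and X0: "0 \<in> X" "\<And>x y. x \<in> X \<Longrightarrow> y \<in> X \<Longrightarrow> x + y \<in> X" "\<And>k x. k \<in> K \<Longrightarrow> x \<in> X \<Longrightarrow> sc k x \<in> X"
    and Y0: "0 \<in> Y" "\<And>x y. x \<in> Y \<Longrightarrow> y \<in> Y \<Longrightarrow> x + y \<in> Y" "\<And>k x. k \<in> K \<Longrightarrow> x \<in> Y \<Longrightarrow> sc k x \<in> Y"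
    and \<beta>: "\<And>x y. x \<in> X \<Longrightarrow> y \<in> Y \<Longrightarrow> \<beta> x y \<in> K"
      "\<And>x x' y. \<beta> (x + x') y = \<beta> x y + \<beta> x' y" "\<And>k x y. \<beta> (sc k x) y = k * \<beta> x y"
      "\<And>x y y'. \<beta> x (y + y') = \<beta> x y + \<beta> x y'" "\<And>k x y. \<beta> x (sc k y) = k * \<beta> x y"
  shows "\<exists>(r::nat) x y. (\<forall>i<r. x i \<in> X \<and> y i \<in> Y) \<and> (\<forall>i<r. \<forall>j<r. \<beta> (x i) (y j) = of_bool (i = j)) \<and>
    (\<forall>z\<in>X. \<forall>w\<in>Y. \<beta> z w = (\<Sum>i<r. \<beta> z (y i) * \<beta> (x i) w))"
proof -
  have sX: "sum f I \<in> X" if "\<And>i. i \<in> I \<Longrightarrow> f i \<in> X" for f and I :: "nat set"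
    using that X0 by (intro sum_closed) auto
  have sY: "sum f I \<in> Y" if "\<And>i. i \<in> I \<Longrightarrow> f i \<in> Y" for f and I :: "nat set"
    using that Y0 by (intro sum_closed) auto
  have z: "\<beta> 0 y = 0" "\<beta> x 0 = 0" for x y
    using \<beta>(3)[of 0 0 y] \<beta>(5)[of x 0 0] by (simp_all add: sc_def zero_fun_def)
  have bl: "\<beta> (sum f I) y = (\<Sum>i\<in>I. \<beta> (f i) y)" for f y and I :: "nat set"
    by (rule additive_sum[of "\<lambda>x. \<beta> x y"]) (rule z \<beta>(2))+
  have br: "\<beta> x (sum f I) = (\<Sum>i\<in>I. \<beta> x (f i))" for f x and I :: "nat set"
    by (rule additive_sum[of "\<beta> x"]) (rule z \<beta>(4))+
  define P where "P r \<longleftrightarrow> (\<exists>x y. (\<forall>i<r. x i \<in> X \<and> y i \<in> Y) \<and> (\<forall>i<r. \<forall>j<r. \<beta> (x i) (y j) = of_bool (i = j)))" for r :: nat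
  have P0: "P 0" by (simp add: P_def)
  have Pn: "r \<le> n" if r: "P r" for r
  proof (rule ccontr)
    assume "\<not> r \<le> n"
    obtain x y where xy: "\<forall>i<r. x i \<in> X \<and> y i \<in> Y" "\<forall>i<r. \<forall>j<r. \<beta> (x i) (y j) = of_bool (i = j)"
      using r unfolding P_def by blast
    have xK: "x j i \<in> K" if "i < n" "j < r" for i j
      using xy(1) X that by (auto simp: kvec_def)
    have "n < r" using \<open>\<not> r \<le> n\<close> by simp
    from homogeneous_system_nat[OF K this, of "\<lambda>i j. x j i", OF xK]
    obtain c where c: "\<exists>j<r. c j \<noteq> 0" "\<forall>i<n. (\<Sum>j<r. x j i * c j) = 0" by blast
    have "(\<Sum>j<r. sc (c j) (x j)) = 0"
    proof
      fix i show "(\<Sum>j<r. sc (c j) (x j)) i = 0 i"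
      proof (cases "i < n")
        case True
        then show ?thesis using c(2) by (simp add: sum_fun_apply mult.commute)
      next
        case False
        then have "x j i = 0" if "j < r" for j using xy(1) X that by (auto simp: kvec_def)
        then show ?thesis by (simp add: sum_fun_apply)
      qed
    qed
    then have eq: "(\<Sum>j<r. c j * \<beta> (x j) (y l)) = 0" for l
      using bl[of "\<lambda>j. sc (c j) (x j)" "{..<r}" "y l"] by (simp add: z \<beta>)
    have "c l = 0" if "l < r" for l
    proof -
      have "(\<Sum>j<r. c j * \<beta> (x j) (y l)) = (\<Sum>j<r. if j = l then c j else 0)"
        using xy(2) that by (intro sum.cong) auto
      then show ?thesis using eq[of l] that by simp
    qed
    then show False using c(1) by blast
  qed
  obtain r where r: "P r" "\<not> P (Suc r)" using bounded_nat_maximal[of P n] P0 Pn by blast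
  then obtain x y where xy: "\<And>i. i < r \<Longrightarrow> x i \<in> X" "\<And>i. i < r \<Longrightarrow> y i \<in> Y"
    "\<And>i j. i < r \<Longrightarrow> j < r \<Longrightarrow> \<beta> (x i) (y j) = of_bool (i = j)"
    unfolding P_def by blast
  have key: "\<beta> v w = (\<Sum>i<r. \<beta> v (y i) * \<beta> (x i) w)" if vw: "v \<in> X" "w \<in> Y" for v w
  proof (rule ccontr)
    assume ne: "\<beta> v w \<noteq> (\<Sum>i<r. \<beta> v (y i) * \<beta> (x i) w)"
    \<comment> \<open>After projecting off the family, the pairing of \<open>v'\<close> with
      \<open>w'\<close> is exactly the defect in the claimed identity. A nonzero defect would
      lengthen the maximal family.\<close>
    define v' where "v' = v + (\<Sum>i<r. sc (- \<beta> v (y i)) (x i))"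
    define w' where "w' = w + (\<Sum>i<r. sc (- \<beta> (x i) w) (y i))"
    have v'X: "v' \<in> X" unfolding v'_def using vw xy \<beta>(1)
      by (intro X0(2,3) sX) (auto intro: X0(3) subfield_intros[OF K])
    have w'Y: "w' \<in> Y" unfolding w'_def using vw xy \<beta>(1)
      by (intro Y0(2,3) sY) (auto intro: Y0(3) subfield_intros[OF K])
    have v'y: "\<beta> v' (y j) = 0" if "j < r" for j
    proof -
      have "\<beta> v' (y j) = \<beta> v (y j) + (\<Sum>i<r. - \<beta> v (y i) * \<beta> (x i) (y j))"
        by (simp add: v'_def bl \<beta>)
      also have "(\<Sum>i<r. - \<beta> v (y i) * \<beta> (x i) (y j)) = (\<Sum>i<r. if i = j then - \<beta> v (y i) else 0)"
        using xy that by (intro sum.cong) auto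
      finally show ?thesis using that by simp
    qed
    have xw': "\<beta> (x j) w' = 0" if "j < r" for j
    proof -
      have "\<beta> (x j) w' = \<beta> (x j) w + (\<Sum>i<r. - \<beta> (x i) w * \<beta> (x j) (y i))"
        by (simp add: w'_def br \<beta>)
      also have "(\<Sum>i<r. - \<beta> (x i) w * \<beta> (x j) (y i)) = (\<Sum>i<r. if i = j then - \<beta> (x i) w else 0)"
        using xy that by (intro sum.cong) auto
      finally show ?thesis using that by simp
    qed
    have "\<beta> v' w' = \<beta> v' w" using v'y by (simp add: w'_def br \<beta>)
    also have "\<dots> = \<beta> v w - (\<Sum>i<r. \<beta> v (y i) * \<beta> (x i) w)"
      by (simp add: v'_def bl \<beta> sum_negf)
    finally have c: "\<beta> v' w' \<noteq> 0" using ne by simp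
    have "inverse (\<beta> v' w') \<in> K" using v'X w'Y \<beta>(1) K by (intro subfield_intros) auto
    then have "P (Suc r)" unfolding P_def using xy v'X w'Y v'y xw' c Y0(3) \<beta>(5)
      by (intro exI[of _ "x(r := v')"] exI[of _ "y(r := sc (inverse (\<beta> v' w')) w')"])
        (auto simp: less_Suc_eq)
    then show False using r by simp
  qed
  have "(\<forall>i<r. x i \<in> X \<and> y i \<in> Y) \<and> (\<forall>i<r. \<forall>j<r. \<beta> (x i) (y j) = of_bool (i = j)) \<and>
    (\<forall>z\<in>X. \<forall>w\<in>Y. \<beta> z w = (\<Sum>i<r. \<beta> z (y i) * \<beta> (x i) w))"
    using xy key by blast
  then show ?thesis by blast
qed

text \<open>Factor the dot product between \<open>X\<close> and the whole space: evaluated at unit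
  vectors, the factorisation says that the sum of the \<open>sc (dot z (y i)) (x i)\<close>
  reproduces every \<open>z\<close> in \<open>X\<close>.\<close>

lemma projection_exists:
  assumes K: "subfield K" and X: "X \<subseteq> kvec K n"
    and X0: "0 \<in> X" "\<And>x y. x \<in> X \<Longrightarrow> y \<in> X \<Longrightarrow> x + y \<in> X" "\<And>k x. k \<in> K \<Longrightarrow> x \<in> X \<Longrightarrow> sc k x \<in> X"
  shows "\<exists>\<kappa>. lin_on K sc sc (kvec K n) X \<kappa> \<and> (\<forall>x\<in>X. \<kappa> x = x)"
proof -
  define dot :: "(nat \<Rightarrow> 'a) \<Rightarrow> (nat \<Rightarrow> 'a) \<Rightarrow> 'a" where "dot x y = (\<Sum>i<n. x i * y i)" for x y
  have dot: "dot (x + x') y = dot x y + dot x' y" "dot (sc k x) y = k * dot x y"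
      "dot x (y + y') = dot x y + dot x y'" "dot x (sc k y) = k * dot x y" "dot x y = dot y x" for x x' y y' k
    unfolding dot_def by (auto simp: algebra_simps sum.distrib sum_distrib_left)
  have dotK: "dot x y \<in> K" if "x \<in> kvec K n" "y \<in> kvec K n" for x y
    using that K unfolding dot_def kvec_def by (auto intro!: subfield_intros)
  obtain r :: nat and x y where xy: "\<forall>i<r. x i \<in> X \<and> y i \<in> kvec K n"
    "\<forall>z\<in>X. \<forall>w\<in>kvec K n. dot z w = (\<Sum>i<r. dot z (y i) * dot (x i) w)"
    using dual_pair_exists[OF K X X0, of "kvec K n" dot] dotK X K dot
    by (auto simp: kvec_zero kvec_add kvec_sc subset_iff)
  define \<kappa> where "\<kappa> z = (\<Sum>i<r. sc (dot z (y i)) (x i))" for z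
  have \<kappa>X: "\<kappa> z \<in> X" if "z \<in> kvec K n" for z
    unfolding \<kappa>_def using that xy(1) dotK X0(3) by (intro sum_closed[OF X0(1,2)]) auto
  then have "lin_on K sc sc (kvec K n) X \<kappa>"
    unfolding lin_on_def
    by (auto intro!: ext simp: \<kappa>_def dot sum_fun_apply sum_distrib_left algebra_simps sum.distrib)
  moreover have "\<kappa> z = z" if z: "z \<in> X" for z
  proof
    fix j
    have kz: "\<kappa> z \<in> X" using \<kappa>X z X by auto
    show "\<kappa> z j = z j"
    proof (cases "j < n")
      case True
      have de: "dot w (evec j) = w j" for w
      proof -
        have "dot w (evec j) = (\<Sum>i<n. if i = j then w i else 0)"
          unfolding dot_def evec_def by (rule sum.cong) auto
        then show ?thesis using True by simp
      qed
      have "z j = dot z (evec j)" by (simp add: de)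
      also have "\<dots> = (\<Sum>i<r. dot z (y i) * dot (x i) (evec j))"
        using xy(2) z kvec_evec[OF K True] by blast
      also have "\<dots> = (\<Sum>i<r. dot z (y i) * x i j)" by (simp only: de)
      finally show ?thesis by (simp add: \<kappa>_def sum_fun_apply)
    next
      case False
      moreover have "z \<in> kvec K n" "\<kappa> z \<in> kvec K n" using z kz X by auto
      ultimately show ?thesis by (simp add: kvec_def)
    qed
  qed
  ultimately show ?thesis by blast
qed

lemma lin_on_sum_apply:
  fixes v :: "'i \<Rightarrow> 'v::ab_group_add"
  assumes f: "lin_on K sv sw V W f" and V: "0 \<in> V" "\<And>x y. x \<in> V \<Longrightarrow> y \<in> V \<Longrightarrow> x + y \<in> V"
    and v: "\<And>i. i \<in> I \<Longrightarrow> v i \<in> V"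
  shows "f (sum v I) = (\<Sum>i\<in>I. f (v i))"
proof -
  have f0: "f 0 = 0" using lin_onD(2)[OF f V(1) V(1)] by simp
  show ?thesis using v
  proof (induction I rule: infinite_finite_induct)
    case (insert i I)
    then have "v i \<in> V" "sum v I \<in> V" using sum_closed[OF V, of I v] by auto
    then show ?case using lin_onD(2)[OF f] insert by simp
  qed (auto simp: f0)
qed

section \<open>Similitudes of forms on coordinate space\<close>

text \<open>The forms are defined over all of L and rational over every field above
  \<open>K\<close>; by \<open>nform_ext\<close> the same \<open>b\<close> and \<open>q\<close> then
  serve over F, E and L. Nondegeneracy is demanded in the bilinear case, while quadratic forms may
  be singular.\<close>

locale nform =
  fixes b :: "(nat \<Rightarrow> 'a::field) \<Rightarrow> (nat \<Rightarrow> 'a) \<Rightarrow> 'a" and q :: "(nat \<Rightarrow> 'a) \<Rightarrow> 'a" and \<epsilon> :: 'a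
    and n :: nat and K :: "'a set"
  assumes K: "subfield K" and char2: "(2::'a) = 0" and eps: "\<epsilon> = 0 \<or> \<epsilon> = 1"
    and b_sym: "\<And>x y. b x y = b y x"
    and b_add: "\<And>x y z. b (x + y) z = b x z + b y z"
    and b_sc: "\<And>k x z. b (sc k x) z = k * b x z"
    and q_add: "\<And>x y. q (x + y) = q x + q y + \<epsilon> * b x y"
    and q_sc: "\<And>k x. q (sc k x) = k * k * q x"
    and b_diag: "\<And>x. b x x = (1 + \<epsilon>) * q x"
    and b_in: "\<And>E x y. subfield E \<Longrightarrow> K \<subseteq> E \<Longrightarrow> x \<in> kvec E n \<Longrightarrow> y \<in> kvec E n \<Longrightarrow> b x y \<in> E"
    and q_in: "\<And>E x. subfield E \<Longrightarrow> K \<subseteq> E \<Longrightarrow> x \<in> kvec E n \<Longrightarrow> q x \<in> E"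
    and b_cong: "\<And>x x' z. (\<And>i. i < n \<Longrightarrow> x i = x' i) \<Longrightarrow> b x z = b x' z"
    and q_cong: "\<And>x x'. (\<And>i. i < n \<Longrightarrow> x i = x' i) \<Longrightarrow> q x = q x'"
    and nondeg: "\<And>x i. \<epsilon> = 0 \<Longrightarrow> (\<And>y. b x y = 0) \<Longrightarrow> i < n \<Longrightarrow> x i = 0"
begin

sublocale V: form_space sc K "kvec K n" b q \<epsilon>
  by (intro form_space.intro form_space_axioms.intro module_sc)
    (auto simp: K char2 eps kvec_zero kvec_add kvec_sc b_in q_in b_add b_sc q_add q_sc b_diag, rule b_sym)

lemma nform_ext:
  assumes "subfield E" "K \<subseteq> E"
  shows "nform b q \<epsilon> n E"
proof
  show "b x y \<in> E'" if "subfield E'" "E \<subseteq> E'" "x \<in> kvec E' n" "y \<in> kvec E' n" for E' x y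
    using b_in[of E'] that assms by auto
  show "q x \<in> E'" if "subfield E'" "E \<subseteq> E'" "x \<in> kvec E' n" for E' x
    using q_in[of E'] that assms by auto
qed (fact assms char2 eps b_sym b_add b_sc q_add q_sc b_diag b_cong q_cong nondeg)+

lemma b_add_right: "b z (x + y) = b z x + b z y" and b_sc_right: "b z (sc k x) = k * b z x"
  using b_sym[of z "x + y"] b_sym[of z x] b_sym[of z y] b_sym[of z "sc k x"] b_add[of x y z] b_sc[of k x z] by simp_all

lemma b_sum: "b (\<Sum>i\<in>I. f i) z = (\<Sum>i\<in>I. b (f i) z)"
proof -
  have "b 0 z = 0" using b_sc[of 0 0 z] by (simp add: sc_def zero_fun_def)
  then show ?thesis by (rule additive_sum[of "\<lambda>x. b x z"]) (rule b_add)
qed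

lemma b_restr: "b (restr n x) y = b x y" "b x (restr n y) = b x y"
proof -
  show 1: "b (restr n x) y = b x y" for x y by (rule b_cong) (simp add: restr_def)
  show "b x (restr n y) = b x y" using 1[of y x] b_sym by metis
qed

lemma q_restr: "q (restr n x) = q x"
  using q_cong[of "restr n x" x] by (simp add: restr_def)

definition similitude_factor :: "'a \<Rightarrow> bool" where
  "similitude_factor u \<longleftrightarrow> (\<exists>T. mat_in K n T \<and> mdet n T \<noteq> 0 \<and>
     (\<forall>x y. vec_in K n x \<longrightarrow> vec_in K n y \<longrightarrow> b (matvec n T x) (matvec n T y) = u * b x y) \<and>
     (\<forall>x. vec_in K n x \<longrightarrow> q (matvec n T x) = u * q x))"

lemma dual_system_exists:
  "\<exists>r p p'. V.dual_system r p p' \<and>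
     (\<forall>z\<in>kvec K n. \<forall>w\<in>kvec K n. b z w = (\<Sum>i<r. b z (p' i) * b (p i) w))"
proof -
  have "\<exists>(r::nat) p p'. (\<forall>i<r. p i \<in> kvec K n \<and> p' i \<in> kvec K n) \<and> (\<forall>i<r. \<forall>j<r. b (p i) (p' j) = of_bool (i = j)) \<and>
    (\<forall>z\<in>kvec K n. \<forall>w\<in>kvec K n. b z w = (\<Sum>i<r. b z (p' i) * b (p i) w))"
    by (rule dual_pair_exists[where \<beta> = b and n = n, OF K order.refl])
      (auto simp: K kvec_zero kvec_add kvec_sc b_add b_sc b_add_right b_sc_right V.b_in)
  then obtain r :: nat and p p' where pp: "\<forall>i<r. p i \<in> kvec K n \<and> p' i \<in> kvec K n"
      "\<forall>i<r. \<forall>j<r. b (p i) (p' j) = of_bool (i = j)"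
      "\<forall>z\<in>kvec K n. \<forall>w\<in>kvec K n. b z w = (\<Sum>i<r. b z (p' i) * b (p i) w)"
    by blast
  have "y \<in> V.Rad" if y: "y \<in> kvec K n" "\<forall>i<r. b y (p i) = 0" for y
  proof -
    have "b y z = 0" if z: "z \<in> kvec K n" for z
    proof -
      have "b z y = (\<Sum>i<r. b z (p' i) * b (p i) y)" using pp(3) y z by blast
      also have "\<dots> = 0" using y(2) b_sym by (intro sum.neutral) auto
      finally show ?thesis using b_sym by metis
    qed
    then show ?thesis using y by (simp add: V.Rad_def)
  qed
  then have "V.dual_system r p p'" using pp(1,2) unfolding V.dual_system_def by blast
  with pp(3) have "V.dual_system r p p' \<and>
     (\<forall>z\<in>kvec K n. \<forall>w\<in>kvec K n. b z w = (\<Sum>i<r. b z (p' i) * b (p i) w))" by blast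
  then show ?thesis by blast
qed

text \<open>The radical is preserved because the matrix is invertible: a vector orthogonal to all
  images of unit vectors is orthogonal to everything.\<close>

lemma morphism_from_similitude:
  assumes "similitude_factor u"
  shows "\<exists>\<tau>. lin_on K sc sc (kvec K n) (kvec K n) \<tau> \<and>
    (\<forall>x\<in>kvec K n. \<forall>y\<in>kvec K n. b (\<tau> x) (\<tau> y) = u * b x y) \<and> (\<forall>x\<in>kvec K n. q (\<tau> x) = u * q x) \<and>
    (\<forall>y\<in>V.Rad. \<tau> y \<in> V.Rad)"
proof -
  obtain T where T: "mat_in K n T" "mdet n T \<noteq> 0"
     "\<And>x y. vec_in K n x \<Longrightarrow> vec_in K n y \<Longrightarrow> b (matvec n T x) (matvec n T y) = u * b x y"
     "\<And>x. vec_in K n x \<Longrightarrow> q (matvec n T x) = u * q x"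
    using assms unfolding similitude_factor_def by auto
  define \<tau> where "\<tau> x = restr n (matvec n T x)" for x
  have vi: "vec_in K n x" if "x \<in> kvec K n" for x using that by (simp add: kvec_def vec_in_def)
  have \<tau>V: "\<tau> x \<in> kvec K n" if "x \<in> kvec K n" for x
    unfolding \<tau>_def using matvec_in[OF K T(1) vi[OF that]] by (rule restr_kvec)
  have radd: "restr n (x + y) = restr n x + restr n y" "restr n (sc k x) = sc k (restr n x)" for x y :: "nat \<Rightarrow> 'a" and k
    by (auto simp: restr_def)
  have lin: "lin_on K sc sc (kvec K n) (kvec K n) \<tau>"
    unfolding lin_on_def using \<tau>V by (auto simp: \<tau>_def matvec_add matvec_sc radd)
  have \<tau>b: "b (\<tau> x) (\<tau> y) = u * b x y" "q (\<tau> x) = u * q x" if "x \<in> kvec K n" "y \<in> kvec K n" for x y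
    using that T(3,4) vi by (simp_all add: \<tau>_def b_restr q_restr)
  have "\<tau> y \<in> V.Rad" if y: "y \<in> V.Rad" for y
  proof -
    have yV: "y \<in> kvec K n" using y by (simp add: V.Rad_def)
    obtain R where R: "\<forall>i<n. \<forall>j<n. (\<Sum>k<n. T i k * R k j) = of_bool (i = j)"
      using mdet_nonzero_inverse[OF T(2)] by blast
    have "b (\<tau> y) w = 0" if w: "w \<in> kvec K n" for w
    proof -
      \<comment> \<open>The inverse \<open>R\<close> may have entries outside \<open>K\<close>;
        bilinearity of \<open>b\<close> over the whole field is what is used.\<close>
      define c where "c k = (\<Sum>j<n. R k j * w j)" for k
      have "w i = (\<Sum>k<n. sc (c k) (\<tau> (evec k))) i" if i: "i < n" for i
      proof -
        have col: "\<tau> (evec k) i = T i k" if "k < n" for k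
        proof -
          have "\<tau> (evec k) i = (\<Sum>l<n. if l = k then T i l else 0)"
            using i by (simp add: \<tau>_def restr_def matvec_def evec_def)
          then show ?thesis using that by simp
        qed
        have "(\<Sum>k<n. sc (c k) (\<tau> (evec k))) i = (\<Sum>k<n. c k * T i k)"
          unfolding sum_fun_apply by (rule sum.cong) (auto simp: col)
        also have "\<dots> = (\<Sum>k<n. \<Sum>j<n. T i k * R k j * w j)"
          by (simp add: c_def sum_distrib_left sum_distrib_right mult_ac)
        also have "\<dots> = (\<Sum>j<n. (\<Sum>k<n. T i k * R k j) * w j)"
          by (subst sum.swap) (simp add: sum_distrib_right)
        also have "\<dots> = (\<Sum>j<n. if j = i then w j else 0)"
          using R i by (intro sum.cong) auto
        finally show ?thesis using i by simp
      qed
      then have "b w (\<tau> y) = b (\<Sum>k<n. sc (c k) (\<tau> (evec k))) (\<tau> y)" by (rule b_cong)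
      also have "\<dots> = (\<Sum>k<n. c k * b (\<tau> (evec k)) (\<tau> y))" by (simp only: b_sum b_sc)
      also have "\<dots> = (\<Sum>k<n. c k * (u * b (evec k) y))"
        using \<tau>b(1) yV kvec_evec[OF K] by (intro sum.cong) auto
      also have "\<dots> = 0"
        using y kvec_evec[OF K] b_sym[of y] unfolding V.Rad_def by (intro sum.neutral) auto
      finally show ?thesis using b_sym by metis
    qed
    then show ?thesis using \<tau>V yV by (simp add: V.Rad_def)
  qed
  then show ?thesis using lin \<tau>b
    by (intro exI[of _ \<tau>]) auto
qed

text \<open>A map that scales the forms need not be injective on the null radical; replacing it there by
the identity repairs this.\<close>

lemma similitude_from_morphism:
  assumes S: "lin_on K sc sc (kvec K n) (kvec K n) S"
    and Sb: "\<And>x y. x \<in> kvec K n \<Longrightarrow> y \<in> kvec K n \<Longrightarrow> b (S x) (S y) = u * b x y"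
    and Sq: "\<And>x. x \<in> kvec K n \<Longrightarrow> q (S x) = u * q x" and u: "u \<noteq> 0"
  shows "similitude_factor u"
proof -
  define N where "N = {x \<in> V.Rad. q x = 0}"
  have NV: "N \<subseteq> kvec K n" by (auto simp: N_def V.Rad_def)
  have N0: "0 \<in> N" by (auto simp: N_def V.Rad_def V.W_zero V.b_zero_left V.q_zero)
  have Nadd: "x + y \<in> N" if "x \<in> N" "y \<in> N" for x y
    using that by (auto simp: N_def V.Rad_def b_add q_add kvec_add K)
  have Nsc: "sc k x \<in> N" if "k \<in> K" "x \<in> N" for k x
    using that by (auto simp: N_def V.Rad_def b_sc q_sc kvec_sc K)
  obtain \<kappa> where \<kappa>: "lin_on K sc sc (kvec K n) N \<kappa>" "\<forall>x\<in>N. \<kappa> x = x"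
    using projection_exists[OF K NV N0 Nadd Nsc] by blast
  have \<kappa>N: "\<kappa> x \<in> N" if "x \<in> kvec K n" for x using \<kappa>(1) lin_onD(1) that by metis
  have \<kappa>V: "\<kappa> x \<in> kvec K n" if "x \<in> kvec K n" for x using \<kappa>N that NV by auto
  have SV: "S x \<in> kvec K n" if "x \<in> kvec K n" for x using S lin_onD(1) that by metis
  have lin_\<kappa>: "lin_on K sc sc (kvec K n) (kvec K n) \<kappa>" using \<kappa>(1) NV unfolding lin_on_def by blast
  have Nb: "b x y = 0" "b y x = 0" "q x = 0" if "x \<in> N" "y \<in> kvec K n" for x y
    using that b_sym[of y x] by (auto simp: N_def V.Rad_def)
  \<comment> \<open>In characteristic 2 this is the identity minus \<open>\<kappa>\<close>, the
    complementary projection. \<open>S'\<close> follows \<open>S\<close> on the complement and is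
    the identity on \<open>N\<close>.\<close>
  define D where "D x = x + \<kappa> x" for x
  have DV: "D x \<in> kvec K n" if "x \<in> kvec K n" for x using that \<kappa>V K by (simp add: D_def kvec_add)
  have lin_id: "lin_on K sc sc (kvec K n) (kvec K n) (\<lambda>x. x)" by (simp add: lin_on_def)
  have lin_D: "lin_on K sc sc (kvec K n) (kvec K n) D"
    unfolding D_def by (rule V.lin_on_plus[OF lin_id lin_\<kappa>])
  define S' where "S' x = S (D x) + \<kappa> x" for x
  have lin: "lin_on K sc sc (kvec K n) (kvec K n) S'"
    unfolding S'_def by (rule V.lin_on_plus[OF lin_on_comp[OF lin_D S] lin_\<kappa>])
  have Db: "b (D x) (D y) = b x y" "q (D x) = q x" if "x \<in> kvec K n" "y \<in> kvec K n" for x y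
    using that Nb \<kappa>N \<kappa>V by (simp_all add: D_def b_add b_add_right q_add)
  have S'b: "b (S' x) (S' y) = u * b x y" "q (S' x) = u * q x" if "x \<in> kvec K n" "y \<in> kvec K n" for x y
    using that Nb \<kappa>N \<kappa>V SV DV Sb Sq Db by (simp_all add: S'_def b_add b_add_right q_add)
  have S'V: "S' x \<in> kvec K n" if "x \<in> kvec K n" for x using lin lin_onD(1) that by metis
  have inj: "x = 0" if x: "x \<in> kvec K n" "S' x = 0" for x
  proof -
    \<comment> \<open>A vector sent into the null radical by a map scaling the forms by
      \<open>u \<noteq> 0\<close> is itself in the null radical. So \<open>x\<close> lies in
      \<open>N\<close>, where \<open>S'\<close> is the identity.\<close>
    have "S (D x) = \<kappa> x" using x(2) unfolding S'_def
      by (metis V.double_vec_eq_0 add_right_imp_eq)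
    then have SN: "S (D x) \<in> N" using \<kappa>N x by simp
    have "q (D x) = 0" using SN Sq[OF DV[OF x(1)]] u by (simp add: N_def)
    moreover have "b (D x) y = 0" if "y \<in> kvec K n" for y
      using Sb[OF DV[OF x(1)] that] Nb(1)[OF SN SV[OF that]] u by simp
    ultimately have DN: "D x \<in> N" using DV x by (simp add: N_def V.Rad_def)
    have "x = D x + \<kappa> x" by (simp add: D_def add.assoc V.double_vec_eq_0)
    then have "x \<in> N" using Nadd[OF DN \<kappa>N[OF x(1)]] by simp
    then have kx: "\<kappa> x = x" using \<kappa> by simp
    then have "D x = 0" by (simp add: D_def V.double_vec_eq_0)
    moreover have "S 0 = 0" using lin_onD(2)[OF S V.W_zero V.W_zero] by simp
    ultimately show ?thesis using \<open>S (D x) = \<kappa> x\<close> kx by simp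
  qed
  define T where "T i j = S' (evec j) i" for i j
  have TK: "mat_in K n T"
    using S'V kvec_evec[OF K] unfolding mat_in_def T_def by (fastforce simp: kvec_def)
  have mv: "restr n (matvec n T x) = S' (restr n x)" if x: "vec_in K n x" for x
  proof -
    have xV: "restr n x \<in> kvec K n" by (rule restr_kvec[OF x])
    have xK: "x j \<in> K" if "j < n" for j using x that by (simp add: vec_in_def)
    have e: "evec j \<in> kvec K n" "sc (x j) (evec j) \<in> kvec K n" if "j < n" for j
      using that kvec_evec[OF K] kvec_sc[OF K] xK by auto
    have "S' (\<Sum>j<n. sc (x j) (evec j)) = (\<Sum>j<n. S' (sc (x j) (evec j)))"
      by (rule lin_on_sum_apply[OF lin V.W_zero V.W_add]) (use e in auto)
    also have "\<dots> = (\<Sum>j<n. sc (x j) (S' (evec j)))"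
      by (rule sum.cong) (use lin_onD(3)[OF lin xK e(1)] in auto)
    finally have S'x: "S' (\<Sum>j<n. sc (x j) (evec j)) = (\<Sum>j<n. sc (x j) (S' (evec j)))" .
    have "restr n x = (\<Sum>j<n. sc (restr n x j) (evec j))" by (rule kvec_expand[OF xV])
    also have "\<dots> = (\<Sum>j<n. sc (x j) (evec j))" by (rule sum.cong) (auto simp: restr_def)
    finally have eq: "S' (restr n x) = (\<Sum>j<n. sc (x j) (S' (evec j)))" using S'x by simp
    show ?thesis
    proof
      fix i
      show "restr n (matvec n T x) i = S' (restr n x) i"
      proof (cases "i < n")
        case True
        then show ?thesis unfolding eq sum_fun_apply by (simp add: restr_def matvec_def T_def mult.commute)
      next
        case False
        then show ?thesis using S'V[OF xV] by (simp add: restr_def kvec_def)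
      qed
    qed
  qed
  have "mdet n T \<noteq> 0"
  proof (rule mdet_nonzero_if_injective[OF K TK])
    fix x assume x: "x \<in> kvec K n" "\<And>i. i < n \<Longrightarrow> matvec n T x i = 0"
    have "vec_in K n x" "restr n x = x" using x(1) by (auto simp: kvec_def vec_in_def restr_def)
    then have "S' x = restr n (matvec n T x)" using mv[of x] by simp
    also have "\<dots> = 0" using x(2) by (auto simp: restr_def fun_eq_iff)
    finally have "S' x = 0" .
    then show "x = 0" using inj x by blast
  qed
  moreover have "b (matvec n T x) (matvec n T y) = u * b x y" "q (matvec n T x) = u * q x"
    if "vec_in K n x" "vec_in K n y" for x y
    using S'b[OF restr_kvec[OF that(1)] restr_kvec[OF that(2)]] unfolding mv[OF that(1), symmetric] mv[OF that(2), symmetric]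
    by (simp_all add: b_restr q_restr)
  ultimately show ?thesis unfolding similitude_factor_def using TK by blast
qed

lemma similitude_factor_mult_square:
  assumes "similitude_factor u" "k \<in> K" "k \<noteq> 0" "u \<noteq> 0"
  shows "similitude_factor (u * (k * k))"
proof -
  obtain \<tau> where \<tau>: "lin_on K sc sc (kvec K n) (kvec K n) \<tau>"
    "\<And>x y. x \<in> kvec K n \<Longrightarrow> y \<in> kvec K n \<Longrightarrow> b (\<tau> x) (\<tau> y) = u * b x y"
    "\<And>x. x \<in> kvec K n \<Longrightarrow> q (\<tau> x) = u * q x"
    using morphism_from_similitude[OF assms(1)] by blast
  have "lin_on K sc sc (kvec K n) (kvec K n) (\<lambda>x. sc k (\<tau> x))"
    using \<tau>(1) assms(2) unfolding lin_on_def by (auto simp: kvec_sc K algebra_simps)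
  then show ?thesis
    by (rule similitude_from_morphism) (use \<tau> assms in \<open>auto simp: b_sc b_sc_right q_sc mult_ac\<close>)
qed

lemma similitude_factor_one: "similitude_factor 1"
  by (rule similitude_from_morphism[of "\<lambda>x. x"]) (auto simp: lin_on_def)

section \<open>Values of q where it is additive, and their multipliers\<close>

definition Rq :: "(nat \<Rightarrow> 'a) set" where
  "Rq = {x \<in> kvec K n. \<forall>y\<in>kvec K n. \<epsilon> * b x y = 0}"

definition multipliers :: "'a set" where
  "multipliers = {a \<in> K. \<forall>y\<in>Rq. \<exists>z\<in>Rq. q z = a * q y}"

lemma Rq_add: "x \<in> Rq \<Longrightarrow> y \<in> Rq \<Longrightarrow> x + y \<in> Rq"
  and Rq_sc: "k \<in> K \<Longrightarrow> x \<in> Rq \<Longrightarrow> sc k x \<in> Rq"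
  and Rq_q_add: "x \<in> Rq \<Longrightarrow> y \<in> Rq \<Longrightarrow> q (x + y) = q x + q y"
  and Rq_zero: "0 \<in> Rq"
  by (auto simp: Rq_def kvec_add kvec_sc K b_add b_sc q_add V.W_zero V.b_zero_left)

lemma multipliers_square:
  assumes "k \<in> K"
  shows "k * k \<in> multipliers"
proof -
  have "\<exists>z\<in>Rq. q z = k * k * q y" if "y \<in> Rq" for y
    using q_sc Rq_sc[OF assms that] by (intro bexI[of _ "sc k y"])
  then show ?thesis using assms by (simp add: multipliers_def subfield_intros[OF K])
qed

text \<open>Sums work because \<open>q\<close> is additive on \<open>Rq\<close>. Inverses work
  because \<open>inverse x\<close> is \<open>x\<close> times a square, and squares of
  \<open>K\<close> are multipliers by homogeneity of \<open>q\<close>.\<close>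

lemma subfield_multipliers: "subfield multipliers"
proof -
  have add: "x + y \<in> multipliers" if xy: "x \<in> multipliers" "y \<in> multipliers" for x y
  proof -
    have "\<exists>z\<in>Rq. q z = (x + y) * q w" if w: "w \<in> Rq" for w
    proof -
      obtain z1 z2 where "z1 \<in> Rq" "q z1 = x * q w" "z2 \<in> Rq" "q z2 = y * q w"
        using xy w unfolding multipliers_def by blast
      then show ?thesis using Rq_add Rq_q_add by (intro bexI[of _ "z1 + z2"]) (auto simp: algebra_simps)
    qed
    then show ?thesis using xy by (auto simp: multipliers_def subfield_intros[OF K])
  qed
  have mult: "x * y \<in> multipliers" if xy: "x \<in> multipliers" "y \<in> multipliers" for x y
  proof -
    have "\<exists>z\<in>Rq. q z = (x * y) * q w" if w: "w \<in> Rq" for w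
    proof -
      obtain z1 where z1: "z1 \<in> Rq" "q z1 = y * q w" using xy w unfolding multipliers_def by blast
      then obtain z2 where "z2 \<in> Rq" "q z2 = x * q z1" using xy unfolding multipliers_def by blast
      then show ?thesis using z1 by (intro bexI[of _ z2]) auto
    qed
    then show ?thesis using xy by (auto simp: multipliers_def subfield_intros[OF K])
  qed
  have "- x = x" for x :: 'a using V.double_eq_0[of x] by (simp only: neg_eq_iff_add_eq_0)
  then have neg: "- x \<in> multipliers" if "x \<in> multipliers" for x using that by metis
  have inv: "inverse x \<in> multipliers" if "x \<in> multipliers" "x \<noteq> 0" for x
  proof -
    have "x \<in> K" using that by (simp add: multipliers_def)
    then have "x * (inverse x * inverse x) \<in> multipliers"
      using that by (intro mult multipliers_square subfield_intros[OF K])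
    then show ?thesis using that by (simp add: field_simps)
  qed
  have "0 \<in> multipliers" "1 \<in> multipliers"
    using multipliers_square[of 0] multipliers_square[of 1] subfield_intros(1,2)[OF K] by auto
  then show ?thesis unfolding subfield_def using add mult inv neg by auto
qed

text \<open>A multiplier supplies a vector for each value separately; the cancellation needs a
  linear choice. Since \<open>q\<close> is additive on \<open>Rq\<close>, it is enough to choose
  images for the projected unit vectors and extend linearly.\<close>

lemma multiplier_map:
  assumes d: "d \<in> multipliers"
  shows "\<exists>g. lin_on K sc sc (kvec K n) (kvec K n) g \<and> (\<forall>y\<in>Rq. g y \<in> Rq \<and> q (g y) = d * q y)"
proof -
  obtain r p p' where pp: "V.dual_system r p p'"
    "\<forall>z\<in>kvec K n. \<forall>w\<in>kvec K n. b z w = (\<Sum>i<r. b z (p' i) * b (p i) w)"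
    using dual_system_exists by blast
  have p: "p i \<in> kvec K n" "p' i \<in> kvec K n" if "i < r" for i
    using pp(1) that unfolding V.dual_system_def by auto
  \<comment> \<open>A projection onto \<open>Rq\<close>: for \<open>\<epsilon> = 1\<close> it
    removes the part seen by the dual system, for \<open>\<epsilon> = 0\<close> it is the
    identity.\<close>
  define \<rho> where "\<rho> y = y + (\<Sum>i<r. sc (\<epsilon> * b y (p' i)) (p i))" for y
  have eK: "\<epsilon> \<in> K" using eps subfield_intros(1,2)[OF K] by auto
  have \<rho>V: "\<rho> y \<in> kvec K n" if "y \<in> kvec K n" for y
    unfolding \<rho>_def using that p eK V.b_in by (intro kvec_add kvec_sum kvec_sc K subfield_intros) auto
  have \<rho>R: "\<rho> y \<in> Rq" if y: "y \<in> kvec K n" for y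
  proof -
    have "\<epsilon> * b (\<rho> y) w = 0" if w: "w \<in> kvec K n" for w
    proof -
      have "b (\<rho> y) w = b y w + \<epsilon> * (\<Sum>i<r. b y (p' i) * b (p i) w)"
        by (simp add: \<rho>_def b_add b_sum b_sc sum_distrib_left mult.assoc)
      also have "(\<Sum>i<r. b y (p' i) * b (p i) w) = b y w" using pp(2) y w by simp
      finally show ?thesis using eps V.double_eq_0 by auto
    qed
    then show ?thesis using \<rho>V[OF y] unfolding Rq_def by blast
  qed
  have \<rho>id: "\<rho> y = y" if y: "y \<in> Rq" for y
  proof -
    have "sc (\<epsilon> * b y (p' i)) (p i) = 0" if "i < r" for i
      using y p that by (auto simp: Rq_def fun_eq_iff)
    then have "(\<Sum>i<r. sc (\<epsilon> * b y (p' i)) (p i)) = 0" by (intro sum.neutral) auto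
    then show ?thesis by (simp only: \<rho>_def add_0_right)
  qed
  have "\<forall>j. \<exists>z. j < n \<longrightarrow> z \<in> Rq \<and> q z = d * q (\<rho> (evec j))"
    using d \<rho>R kvec_evec[OF K] unfolding multipliers_def by blast
  then obtain z where "\<forall>j. j < n \<longrightarrow> z j \<in> Rq \<and> q (z j) = d * q (\<rho> (evec j))" by (rule choice[THEN exE])
  then have z: "z j \<in> Rq" "q (z j) = d * q (\<rho> (evec j))" if "j < n" for j using that by auto
  define g where "g y = (\<Sum>j<n. sc (y j) (z j))" for y
  have qsum: "q (\<Sum>j<n. sc (y j) (v j)) = (\<Sum>j<n. y j * y j * q (v j))"
    "(\<Sum>j<n. sc (y j) (v j)) \<in> Rq"
    if y: "y \<in> kvec K n" and v: "\<And>j. j < n \<Longrightarrow> v j \<in> Rq" for y v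
  proof -
    have yK: "y j \<in> K" if "j < n" for j using y that by (simp add: kvec_def)
    show "(\<Sum>j<n. sc (y j) (v j)) \<in> Rq"
      by (rule sum_closed[OF Rq_zero Rq_add]) (auto intro: Rq_sc v yK)
    have "q (\<Sum>j<n. sc (y j) (v j)) = (\<Sum>j<n. q (sc (y j) (v j)))"
    proof (rule V.q_sum)
      show "sc (y i) (v i) \<in> kvec K n" if "i \<in> {..<n}" for i
        using that v yK kvec_sc[OF K] unfolding Rq_def by auto
      show "\<epsilon> * b (sc (y i) (v i)) (sc (y j) (v j)) = 0" if "i \<in> {..<n}" "j \<in> {..<n}" for i j
        using that v unfolding Rq_def by (auto simp: b_sc b_sc_right)
    qed
    then show "q (\<Sum>j<n. sc (y j) (v j)) = (\<Sum>j<n. y j * y j * q (v j))" by (simp only: q_sc)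
  qed
  have "g y \<in> Rq \<and> q (g y) = d * q y" if y: "y \<in> Rq" for y
  proof -
    have yV: "y \<in> kvec K n" using y by (simp add: Rq_def)
    have lin_\<rho>: "\<rho> (x + x') = \<rho> x + \<rho> x'" "\<rho> (sc k x) = sc k (\<rho> x)" for x x' k
      unfolding \<rho>_def by (auto simp: fun_eq_iff sum_fun_apply b_add b_sc sum.distrib sum_distrib_left algebra_simps)
    have \<rho>0: "\<rho> 0 = 0" using lin_\<rho>(2)[of 0 0] by (simp add: sc_def zero_fun_def)
    have "\<rho> (\<Sum>j<n. sc (y j) (evec j)) = (\<Sum>j<n. \<rho> (sc (y j) (evec j)))"
      by (rule additive_sum[of \<rho>]) (rule \<rho>0 lin_\<rho>(1))+
    then have "y = (\<Sum>j<n. sc (y j) (\<rho> (evec j)))"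
      using kvec_expand[OF yV] \<rho>id[OF y] by (simp only: lin_\<rho>(2))
    then have "q y = (\<Sum>j<n. y j * y j * q (\<rho> (evec j)))"
      using qsum(1)[OF yV, of "\<lambda>j. \<rho> (evec j)"] \<rho>R kvec_evec[OF K] by metis
    moreover have "q (g y) = (\<Sum>j<n. y j * y j * q (z j))" "g y \<in> Rq"
      unfolding g_def using qsum[OF yV] z by auto
    ultimately show ?thesis using z by (simp add: sum_distrib_left mult_ac)
  qed
  moreover have "lin_on K sc sc (kvec K n) (kvec K n) g"
  proof -
    have "g y \<in> kvec K n" if "y \<in> kvec K n" for y
      using qsum(2)[OF that, of z] z unfolding g_def Rq_def by auto
    then show ?thesis unfolding lin_on_def g_def
      by (auto simp: fun_eq_iff sum_fun_apply sum_distrib_left sum.distrib algebra_simps)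
  qed
  ultimately show ?thesis by blast
qed

end

section \<open>Finite field extensions\<close>

text \<open>A version of \<open>is_basis_over\<close> with the upper field as a parameter, so that E
  over F and L over E are treated alike.\<close>

definition kbasis :: "'a::field set \<Rightarrow> 'a set \<Rightarrow> nat \<Rightarrow> (nat \<Rightarrow> 'a) \<Rightarrow> bool" where
  "kbasis K E m v \<longleftrightarrow> (\<forall>i<m. v i \<in> E) \<and> (\<forall>x\<in>E. \<exists>c. (\<forall>i<m. c i \<in> K) \<and> x = (\<Sum>i<m. c i * v i)) \<and>
     (\<forall>c. (\<forall>i<m. c i \<in> K) \<longrightarrow> (\<Sum>i<m. c i * v i) = 0 \<longrightarrow> (\<forall>i<m. c i = 0))"

lemma kbasisD:
  assumes "kbasis K E m v"
  shows "\<And>i. i < m \<Longrightarrow> v i \<in> E" "\<And>x. x \<in> E \<Longrightarrow> \<exists>c. (\<forall>i<m. c i \<in> K) \<and> x = (\<Sum>i<m. c i * v i)"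
    "\<And>c i. (\<And>i. i < m \<Longrightarrow> c i \<in> K) \<Longrightarrow> (\<Sum>i<m. c i * v i) = 0 \<Longrightarrow> i < m \<Longrightarrow> c i = 0"
  using assms unfolding kbasis_def by blast+

lemma kbasis_unique:
  assumes "subfield K" "kbasis K E m v" "\<And>i. i < m \<Longrightarrow> c i \<in> K" "\<And>i. i < m \<Longrightarrow> c' i \<in> K"
    "(\<Sum>i<m. c i * v i) = (\<Sum>i<m. c' i * v i)" "i < m"
  shows "c i = c' i"
proof -
  have "(\<Sum>i<m. (c i - c' i) * v i) = 0" using assms(5) by (simp add: left_diff_distrib sum_subtractf)
  then have "c i - c' i = 0"
    using kbasisD(3)[OF assms(2), of "\<lambda>i. c i - c' i"] assms subfield_diff by blast
  then show ?thesis by simp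
qed

lemma kbasis_coordinates:
  assumes K: "subfield K" and E: "subfield E" "K \<subseteq> E" and v: "kbasis K E m v"
  obtains co where "\<And>x i. x \<in> E \<Longrightarrow> i < m \<Longrightarrow> co x i \<in> K" "\<And>x. x \<in> E \<Longrightarrow> x = (\<Sum>i<m. co x i * v i)"
    "\<And>c i. (\<And>i. i < m \<Longrightarrow> c i \<in> K) \<Longrightarrow> i < m \<Longrightarrow> co (\<Sum>i<m. c i * v i) i = c i"
    "\<And>x y i. x \<in> E \<Longrightarrow> y \<in> E \<Longrightarrow> i < m \<Longrightarrow> co (x + y) i = co x i + co y i"
    "\<And>k x i. k \<in> K \<Longrightarrow> x \<in> E \<Longrightarrow> i < m \<Longrightarrow> co (k * x) i = k * co x i"
proof -
  have "\<forall>x. \<exists>c. x \<in> E \<longrightarrow> (\<forall>i<m. c i \<in> K) \<and> x = (\<Sum>i<m. c i * v i)" using kbasisD(2)[OF v] by blast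
  then obtain co where "\<forall>x. x \<in> E \<longrightarrow> (\<forall>i<m. co x i \<in> K) \<and> x = (\<Sum>i<m. co x i * v i)"
    by (rule choice[THEN exE])
  then have co: "co x i \<in> K" "x = (\<Sum>i<m. co x i * v i)" if "x \<in> E" "i < m" for x i
    using that by auto
  have co2: "x = (\<Sum>i<m. co x i * v i)" if "x \<in> E" for x
    using \<open>\<forall>x. x \<in> E \<longrightarrow> (\<forall>i<m. co x i \<in> K) \<and> x = (\<Sum>i<m. co x i * v i)\<close> that by auto
  have uniq: "co (\<Sum>i<m. c i * v i) i = c i" if c: "\<And>i. i < m \<Longrightarrow> c i \<in> K" "i < m" for c i
  proof -
    have inE: "(\<Sum>i<m. c i * v i) \<in> E"
      using c(1) kbasisD(1)[OF v] E by (intro subfield_intros) auto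
    show ?thesis
      using kbasis_unique[OF K v, of "co (\<Sum>i<m. c i * v i)" c i] co(1)[OF inE] co2[OF inE] c by simp
  qed
  have "co (x + y) i = co x i + co y i" if xy: "x \<in> E" "y \<in> E" "i < m" for x y i
  proof -
    have "x + y = (\<Sum>i<m. (co x i + co y i) * v i)"
      using co2[OF xy(1)] co2[OF xy(2)] by (simp add: distrib_right sum.distrib)
    then show ?thesis using uniq[of "\<lambda>i. co x i + co y i" i] co xy subfield_add[OF K] by simp
  qed
  moreover have "co (k * x) i = k * co x i" if kx: "k \<in> K" "x \<in> E" "i < m" for k x i
  proof -
    have "k * x = (\<Sum>i<m. (k * co x i) * v i)"
      using co2[OF kx(2)] by (simp add: mult.assoc sum_distrib_left[symmetric])
    then show ?thesis using uniq[of "\<lambda>i. k * co x i" i] co kx subfield_mult[OF K] by simp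
  qed
  ultimately show thesis using that[of co] co(1) co2 uniq by blast
qed

lemma solve_linear:
  fixes y :: "'a::field"
  assumes "A + k * y = 0" "k \<noteq> 0"
  shows "y = - A / k"
proof -
  have "k * y = - A" using assms(1) by (simp add: eq_neg_iff_add_eq_0 add.commute)
  then show ?thesis using assms(2) by (metis nonzero_mult_div_cancel_left)
qed

lemma dependent_nat:
  fixes v w :: "nat \<Rightarrow> 'a::field"
  assumes K: "subfield K" and "m < r"
    and span: "\<And>j. j < r \<Longrightarrow> \<exists>k. (\<forall>i<m. k i \<in> K) \<and> w j = (\<Sum>i<m. k i * v i)"
  shows "\<exists>c. (\<forall>j<r. c j \<in> K) \<and> (\<exists>j<r. c j \<noteq> 0) \<and> (\<Sum>j<r. c j * w j) = 0"
  using dependent_in_span[OF K, of "{..<m}" "{..<r}" w v] assms by (simp add: Ball_def Bex_def)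

text \<open>Independence over \<open>E\<close> implies independence over \<open>K\<close>, which
  bounds the length by \<open>m\<close>; a longest family spans.\<close>

lemma kbasis_exists:
  assumes E: "subfield E" and K: "subfield K" "K \<subseteq> E" and v: "kbasis K UNIV m v"
  shows "\<exists>r u. kbasis E UNIV r u"
proof -
  define P where "P r \<longleftrightarrow> (\<exists>u. \<forall>c. (\<forall>i<r. c i \<in> E) \<longrightarrow> (\<Sum>i<r. c i * u i) = 0 \<longrightarrow> (\<forall>i<r. c i = 0))" for r :: nat
  have "P 0" by (simp add: P_def)
  moreover have "r \<le> m" if "P r" for r
  proof (rule ccontr)
    assume "\<not> r \<le> m"
    obtain u where u: "\<And>c. (\<forall>i<r. c i \<in> E) \<Longrightarrow> (\<Sum>i<r. c i * u i) = 0 \<Longrightarrow> (\<forall>i<r. c i = 0)"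
      using \<open>P r\<close> unfolding P_def by blast
    have "\<exists>c. (\<forall>j<r. c j \<in> K) \<and> (\<exists>j<r. c j \<noteq> 0) \<and> (\<Sum>j<r. c j * u j) = 0"
      by (rule dependent_nat[OF K(1), of m r u v]) (use \<open>\<not> r \<le> m\<close> kbasisD(2)[OF v] in auto)
    then show False using u K(2) by blast
  qed
  ultimately obtain r where r: "P r" "\<not> P (Suc r)" using bounded_nat_maximal[of P m] by blast
  then obtain u where u: "\<And>c. (\<forall>i<r. c i \<in> E) \<Longrightarrow> (\<Sum>i<r. c i * u i) = 0 \<Longrightarrow> (\<forall>i<r. c i = 0)"
    unfolding P_def by blast
  have "\<exists>c. (\<forall>i<r. c i \<in> E) \<and> y = (\<Sum>i<r. c i * u i)" for y
  proof -
    have "\<not> (\<forall>c. (\<forall>i<Suc r. c i \<in> E) \<longrightarrow> (\<Sum>i<Suc r. c i * (u(r := y)) i) = 0 \<longrightarrow> (\<forall>i<Suc r. c i = 0))"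
      using r(2) unfolding P_def by blast
    then obtain c where c: "\<forall>i<Suc r. c i \<in> E" "(\<Sum>i<Suc r. c i * (u(r := y)) i) = 0" "\<not> (\<forall>i<Suc r. c i = 0)"
      by blast
    have "(\<Sum>i<r. c i * (u(r := y)) i) = (\<Sum>i<r. c i * u i)" by (rule sum.cong) auto
    then have rel: "(\<Sum>i<r. c i * u i) + c r * y = 0" using c(2) by simp
    have "c r \<noteq> 0"
    proof
      assume "c r = 0"
      then have "(\<Sum>i<r. c i * u i) = 0" using rel by simp
      moreover have "\<forall>i<r. c i \<in> E" using c(1) by simp
      ultimately have "\<forall>i<r. c i = 0" using u by blast
      then show False using c(3) \<open>c r = 0\<close> less_Suc_eq by auto
    qed
    have "y = - (\<Sum>i<r. c i * u i) / c r"
      using solve_linear[OF rel \<open>c r \<noteq> 0\<close>] .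
    also have "\<dots> = (\<Sum>i<r. (- c i / c r) * u i)"
      by (simp add: sum_divide_distrib sum_negf)
    finally show ?thesis using c(1) E
      by (intro exI[of _ "\<lambda>i. - c i / c r"]) (auto intro!: subfield_intros)
  qed
  then have "kbasis E UNIV r u" unfolding kbasis_def using u by blast
  then show ?thesis by blast
qed

section \<open>The simple extension generated by c\<close>

definition pspan :: "'a::field set \<Rightarrow> 'a \<Rightarrow> nat \<Rightarrow> 'a set" where
  "pspan K c d = {x. \<exists>k. (\<forall>i<d. k i \<in> K) \<and> x = (\<Sum>i<d. k i * c ^ i)}"

text \<open>Division by the highest nonzero coefficient reduces a power to lower ones. Such
  reductions stand in for monic polynomials with root \<open>c\<close>.\<close>

lemma leading_power:
  assumes K: "subfield K" and x: "\<And>i. i < N \<Longrightarrow> x i \<in> K" "\<exists>i<N. x i \<noteq> 0" "(\<Sum>i<N. x i * c ^ i) = 0"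
  shows "\<exists>j<N. c ^ j \<in> pspan K c j"
proof -
  define j where "j = Max {i. i < N \<and> x i \<noteq> 0}"
  have fin: "finite {i. i < N \<and> x i \<noteq> 0}" by simp
  have "j \<in> {i. i < N \<and> x i \<noteq> 0}" unfolding j_def using x(2) by (intro Max_in[OF fin]) auto
  then have j: "j < N" "x j \<noteq> 0" by auto
  have above: "x i = 0" if "j < i" "i < N" for i
    using Max_ge[OF fin, of i] that unfolding j_def[symmetric] by auto
  have "(\<Sum>i<N. x i * c ^ i) = (\<Sum>i<Suc j. x i * c ^ i)"
    using j above by (intro sum.mono_neutral_right) auto
  then have "(\<Sum>i<j. x i * c ^ i) + x j * c ^ j = 0" using x(3) by simp
  then have "c ^ j = - (\<Sum>i<j. x i * c ^ i) / x j" using solve_linear j by blast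
  also have "\<dots> = (\<Sum>i<j. (- x i / x j) * c ^ i)" by (simp add: sum_divide_distrib sum_negf)
  finally have "c ^ j \<in> pspan K c j" unfolding pspan_def
    using x(1) j K by (auto intro!: exI[of _ "\<lambda>i. - x i / x j"] subfield_intros)
  then show ?thesis using j by blast
qed

lemma pspan_zero: "subfield K \<Longrightarrow> 0 \<in> pspan K c d"
  unfolding pspan_def using subfield_zero by (auto intro!: exI[of _ "\<lambda>_. 0"])

lemma pspan_add:
  assumes K: "subfield K" and xy: "x \<in> pspan K c d" "y \<in> pspan K c d"
  shows "x + y \<in> pspan K c d"
proof -
  obtain k l where "\<forall>i<d. k i \<in> K" "x = (\<Sum>i<d. k i * c ^ i)" "\<forall>i<d. l i \<in> K" "y = (\<Sum>i<d. l i * c ^ i)"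
    using xy unfolding pspan_def by blast
  then show ?thesis unfolding pspan_def using subfield_add[OF K]
    by (auto intro!: exI[of _ "\<lambda>i. k i + l i"] simp: distrib_right sum.distrib)
qed

lemma pspan_scale:
  assumes K: "subfield K" and kx: "k \<in> K" "x \<in> pspan K c d"
  shows "k * x \<in> pspan K c d"
proof -
  obtain l where "\<forall>i<d. l i \<in> K" "x = (\<Sum>i<d. l i * c ^ i)" using kx unfolding pspan_def by blast
  then show ?thesis unfolding pspan_def using subfield_mult[OF K] kx(1)
    by (auto intro!: exI[of _ "\<lambda>i. k * l i"] simp: sum_distrib_left mult.assoc)
qed

lemma pspan_power_less:
  assumes K: "subfield K" and "i < d"
  shows "c ^ i \<in> pspan K c d"
proof -
  have "(\<Sum>j<d. of_bool (j = i) * c ^ j) = (\<Sum>j<d. if j = i then c ^ j else 0)" by (rule sum.cong) auto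
  then show ?thesis unfolding pspan_def using assms(2) subfield_zero[OF K] subfield_one[OF K]
    by (auto intro!: exI[of _ "\<lambda>j. of_bool (j = i)"])
qed

lemma pspan_sum: "subfield K \<Longrightarrow> (\<And>i. i \<in> I \<Longrightarrow> f i \<in> pspan K c d) \<Longrightarrow> sum f I \<in> pspan K c d"
  by (rule sum_closed) (auto simp: pspan_zero pspan_add)

lemma pspan_mono:
  assumes "subfield K" "x \<in> pspan K c m" "m \<le> d"
  shows "x \<in> pspan K c d"
proof -
  obtain l where l: "\<forall>i<m. l i \<in> K" "x = (\<Sum>i<m. l i * c ^ i)" using assms unfolding pspan_def by blast
  show ?thesis unfolding l(2)
    by (intro pspan_sum pspan_scale pspan_power_less assms) (use l assms in auto)
qed

lemma pspan_power_mult: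
  assumes K: "subfield K" and d: "c ^ d \<in> pspan K c d" and x: "x \<in> pspan K c d"
  shows "c ^ j * x \<in> pspan K c d"
proof (induction j)
  case (Suc j)
  obtain l where l: "\<forall>i<d. l i \<in> K" "c ^ j * x = (\<Sum>i<d. l i * c ^ i)" using Suc unfolding pspan_def by blast
  have "c ^ i \<in> pspan K c d" if "i \<le> d" for i
    using that d pspan_power_less[OF K] by (cases "i = d") auto
  then have "(\<Sum>i<d. l i * c ^ Suc i) \<in> pspan K c d"
    using l(1) by (intro pspan_sum pspan_scale K) (auto simp del: power_Suc)
  also have "(\<Sum>i<d. l i * c ^ Suc i) = c * (\<Sum>i<d. l i * c ^ i)"
    by (simp add: sum_distrib_left mult_ac)
  also have "\<dots> = c ^ Suc j * x" unfolding l(2)[symmetric] by (simp add: mult.assoc)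
  finally show ?case .
qed (use x in simp)

lemma pspan_mult:
  assumes K: "subfield K" and d: "c ^ d \<in> pspan K c d" and xy: "x \<in> pspan K c d" "y \<in> pspan K c d"
  shows "x * y \<in> pspan K c d"
proof -
  obtain l where l: "\<forall>i<d. l i \<in> K" "x = (\<Sum>i<d. l i * c ^ i)" using xy(1) unfolding pspan_def by blast
  have "x * y = (\<Sum>i<d. l i * (c ^ i * y))" by (simp add: l(2) sum_distrib_right mult.assoc)
  also have "\<dots> \<in> pspan K c d" by (intro pspan_sum pspan_scale pspan_power_mult K d xy(2)) (use l in auto)
  finally show ?thesis .
qed

text \<open>Take the least \<open>d\<close> whose power reduces to lower ones: reducibility makes
  the span a ring, minimality makes the powers independent.\<close>

lemma simple_extension:
  assumes K: "subfield K" and v: "kbasis K UNIV m v"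
  shows "\<exists>d. 0 < d \<and> c ^ d \<in> pspan K c d \<and> subfield (pspan K c d) \<and> K \<subseteq> pspan K c d \<and>
    kbasis K (pspan K c d) d (\<lambda>i. c ^ i)"
proof -
  have "\<exists>x. (\<forall>j<Suc m. x j \<in> K) \<and> (\<exists>j<Suc m. x j \<noteq> 0) \<and> (\<Sum>j<Suc m. x j * c ^ j) = 0"
    by (rule dependent_nat[OF K, of m "Suc m" "\<lambda>j. c ^ j" v]) (use kbasisD(2)[OF v] in auto)
  then have ex: "\<exists>j. c ^ j \<in> pspan K c j" using leading_power[OF K] by meson
  define d where "d = (LEAST j. c ^ j \<in> pspan K c j)"
  have d: "c ^ d \<in> pspan K c d" unfolding d_def using ex by (rule LeastI_ex)
  have least: "c ^ j \<notin> pspan K c j" if "j < d" for j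
    using not_less_Least that unfolding d_def by blast
  have d0: "0 < d" using d by (cases d) (auto simp: pspan_def)
  have indep: "\<forall>i<d. k i = 0" if "\<forall>i<d. k i \<in> K" "(\<Sum>i<d. k i * c ^ i) = 0" for k
    using leading_power[OF K, of d k c] that least by blast
  define E where "E = pspan K c d"
  note Eadd = pspan_add[OF K, of _ c d, folded E_def] and Esc = pspan_scale[OF K, of _ _ c d, folded E_def]
    and E0 = pspan_zero[OF K, of c d, folded E_def] and Esum = pspan_sum[OF K, of _ _ c d, folded E_def]
    and Epow = pspan_power_less[OF K, of _ d c, folded E_def] and Emult = pspan_mult[OF K d, folded E_def]
  have E1: "1 \<in> E" using Epow[of 0] d0 by simp
  have KE: "k \<in> E" if "k \<in> K" for k using Esc[OF that E1] by simp
  have Einv: "inverse x \<in> E" if x: "x \<in> E" "x \<noteq> 0" for x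
  proof -
    \<comment> \<open>Here \<open>d + 1\<close> elements lie in a span of \<open>d\<close> powers.
      Independence of the powers forces 1 to occur in the relation, which then inverts
      \<open>x\<close>.\<close>
    define w where "w j = (if j < d then x * c ^ j else 1)" for j
    have "w j \<in> E" for j using Emult[OF x(1) Epow] E1 by (auto simp: w_def)
    then have "\<exists>y. (\<forall>j<Suc d. y j \<in> K) \<and> (\<exists>j<Suc d. y j \<noteq> 0) \<and> (\<Sum>j<Suc d. y j * w j) = 0"
      by (intro dependent_nat[OF K, of d "Suc d" w "\<lambda>i. c ^ i"]) (auto simp: E_def pspan_def)
    then obtain y where y: "\<forall>j<Suc d. y j \<in> K" "\<exists>j<Suc d. y j \<noteq> 0" "(\<Sum>j<Suc d. y j * w j) = 0" by blast
    have "(\<Sum>j<d. y j * w j) = x * (\<Sum>j<d. y j * c ^ j)"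
      unfolding sum_distrib_left by (rule sum.cong) (auto simp: w_def mult_ac)
    then have rel: "x * (\<Sum>j<d. y j * c ^ j) + y d = 0" using y(3) by (simp add: w_def)
    have "y d \<noteq> 0"
    proof
      assume "y d = 0"
      then have "(\<Sum>j<d. y j * c ^ j) = 0" using rel x by simp
      then have "\<forall>j<d. y j = 0" using indep y(1) by simp
      then show False using y(2) \<open>y d = 0\<close> less_Suc_eq by auto
    qed
    have "x * (\<Sum>j<d. y j * c ^ j) = - y d" using rel by (simp only: eq_neg_iff_add_eq_0)
    then have "x * ((- 1 / y d) * (\<Sum>j<d. y j * c ^ j)) = 1"
      using \<open>y d \<noteq> 0\<close> by (simp add: mult.left_commute[of x])
    then have "inverse x = (- 1 / y d) * (\<Sum>j<d. y j * c ^ j)" by (rule inverse_unique)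
    also have "\<dots> \<in> E"
      by (intro Esc Esum Epow) (use y K in \<open>auto intro!: subfield_intros\<close>)
    finally show ?thesis .
  qed
  have "- x \<in> E" if "x \<in> E" for x
    using Esc[OF _ that, of "- 1"] subfield_intros(2,5)[OF K] by simp
  then have "subfield E" unfolding subfield_def using E0 E1 Eadd Emult Einv by auto
  moreover have "kbasis K E d (\<lambda>i. c ^ i)" unfolding kbasis_def
    using Epow indep by (auto simp: E_def pspan_def)
  ultimately show ?thesis using d0 d KE unfolding E_def by blast
qed

section \<open>The norm as a power of the constant term\<close>

lemma mdet_transpose: "mdet n (\<lambda>i j. M j i) = mdet n M"
proof -
  have "transpose_mat (mat n n (\<lambda>(i,j). M i j)) = mat n n (\<lambda>(i,j). M j i)" by (rule eq_matI) auto
  then show ?thesis unfolding mdet_det by (metis det_transpose mat_carrier)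
qed

lemma mdet_upper_triangular:
  assumes "\<And>i j. j < i \<Longrightarrow> i < n \<Longrightarrow> M i j = 0"
  shows "mdet n M = (\<Prod>i<n. M i i)"
proof -
  have "upper_triangular (mat n n (\<lambda>(i,j). M i j))" using assms by (auto simp: upper_triangular_def)
  then have "mdet n M = prod_list (diag_mat (mat n n (\<lambda>(i,j). M i j)))"
    unfolding mdet_det by (intro det_upper_triangular[of _ n]) auto
  also have "\<dots> = (\<Prod>i<n. M i i)"
    by (simp add: prod_list_diag_prod lessThan_atLeast0)
  finally show ?thesis .
qed

text \<open>The two matrices are conjugate through the change of basis \<open>P\<close>. This frees
  the norm from the basis picked by \<open>SOME\<close>.\<close>

lemma mdet_basis_change:
  fixes a :: "'a::field"
  assumes K: "subfield K" and b: "kbasis K UNIV m b" and b': "kbasis K UNIV m' b'"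
    and M: "\<And>i j. i < m \<Longrightarrow> j < m \<Longrightarrow> M i j \<in> K" "\<And>j. j < m \<Longrightarrow> a * b j = (\<Sum>i<m. M i j * b i)"
    and M': "\<And>i j. i < m' \<Longrightarrow> j < m' \<Longrightarrow> M' i j \<in> K" "\<And>j. j < m' \<Longrightarrow> a * b' j = (\<Sum>i<m'. M' i j * b' i)"
  shows "mdet m M = mdet m' M'"
proof -
  have le: "r \<le> s" if v: "kbasis K UNIV r v" and w: "kbasis K UNIV s w" for r s v w
  proof (rule ccontr)
    assume "\<not> r \<le> s"
    have "\<exists>c. (\<forall>j<r. c j \<in> K) \<and> (\<exists>j<r. c j \<noteq> 0) \<and> (\<Sum>j<r. c j * v j) = 0"
      by (rule dependent_nat[OF K, of s r v w]) (use \<open>\<not> r \<le> s\<close> kbasisD(2)[OF w] in auto)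
    then show False using kbasisD(3)[OF v] by blast
  qed
  have m: "m' = m" using le[OF b b'] le[OF b' b] by simp
  obtain co where co: "\<And>x i. i < m \<Longrightarrow> co x i \<in> K" "\<And>x. x = (\<Sum>i<m. co x i * b i)"
    using kbasis_coordinates[OF K subfield_UNIV subset_UNIV b] by (metis UNIV_I)
  obtain co' where co': "\<And>x i. i < m \<Longrightarrow> co' x i \<in> K" "\<And>x. x = (\<Sum>i<m. co' x i * b' i)"
    using kbasis_coordinates[OF K subfield_UNIV subset_UNIV b'] unfolding m by (metis UNIV_I)
  define P where "P i j = co (b' j) i" for i j
  define Q where "Q i j = co' (b j) i" for i j
  have P: "P i j \<in> K" if "i < m" for i j
    using co(1)[of i "b' j"] that unfolding P_def by auto
  have P2: "b' j = (\<Sum>i<m. P i j * b i)" for j using co(2)[of "b' j"] unfolding P_def by auto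
  have Q: "Q i j \<in> K" if "i < m" for i j using co'(1)[of i "b j"] that unfolding Q_def by auto
  have Q2: "b j = (\<Sum>i<m. Q i j * b' i)" for j using co'(2)[of "b j"] unfolding Q_def by auto
  have swap: "(\<Sum>l<m. x l * b' l) = (\<Sum>i<m. (\<Sum>l<m. P i l * x l) * b i)" for x
  proof -
    have "(\<Sum>l<m. x l * b' l) = (\<Sum>l<m. \<Sum>i<m. P i l * x l * b i)"
      by (subst P2) (simp add: sum_distrib_left mult_ac)
    then show ?thesis by (subst (asm) sum.swap) (simp add: sum_distrib_right)
  qed
  have PQ: "(\<Sum>l<m. P i l * Q l j) = of_bool (i = j)" if ij: "i < m" "j < m" for i j
  proof -
    have "(\<Sum>i<m. of_bool (i = j) * b i) = (\<Sum>i<m. if i = j then b i else 0)" by (rule sum.cong) auto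
    also have "\<dots> = b j" using ij by simp
    also have "\<dots> = (\<Sum>l<m. Q l j * b' l)" by (rule Q2)
    also have "\<dots> = (\<Sum>i<m. (\<Sum>l<m. P i l * Q l j) * b i)" by (rule swap)
    finally have eq: "(\<Sum>i<m. (\<Sum>l<m. P i l * Q l j) * b i) = (\<Sum>i<m. of_bool (i = j) * b i)" by simp
    show ?thesis
      by (rule kbasis_unique[OF K b _ _ eq ij(1)])
        (use P Q K in \<open>auto intro!: subfield_intros simp: of_bool_def\<close>)
  qed
  have MP: "(\<Sum>l<m. M i l * P l j) = (\<Sum>l<m. P i l * M' l j)" if ij: "i < m" "j < m" for i j
  proof -
    have "a * b' j = (\<Sum>l<m. P l j * (a * b l))" by (subst P2) (simp add: sum_distrib_left mult_ac)
    also have "\<dots> = (\<Sum>l<m. \<Sum>i<m. M i l * P l j * b i)"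
      by (rule sum.cong) (simp_all add: M(2) sum_distrib_left mult_ac)
    also have "\<dots> = (\<Sum>i<m. (\<Sum>l<m. M i l * P l j) * b i)"
      by (subst sum.swap) (simp add: sum_distrib_right)
    finally have 1: "a * b' j = (\<Sum>i<m. (\<Sum>l<m. M i l * P l j) * b i)" .
    have "a * b' j = (\<Sum>l<m. M' l j * b' l)" using M'(2) m ij by simp
    also have "\<dots> = (\<Sum>i<m. (\<Sum>l<m. P i l * M' l j) * b i)" by (rule swap)
    finally have eq: "(\<Sum>i<m. (\<Sum>l<m. M i l * P l j) * b i) = (\<Sum>i<m. (\<Sum>l<m. P i l * M' l j) * b i)"
      using 1 by simp
    show ?thesis
      by (rule kbasis_unique[OF K b _ _ eq ij(1)])
        (use P M(1) M'(1) K m ij in \<open>auto intro!: subfield_intros\<close>)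
  qed
  have "mdet m P * mdet m Q = mdet m (\<lambda>i j. of_bool (i = j))"
    unfolding mdet_mult[symmetric] by (rule mdet_cong) (rule PQ)
  then have nz: "mdet m P \<noteq> 0" by (auto simp: mdet_one)
  have "mdet m M * mdet m P = mdet m P * mdet m M'"
    unfolding mdet_mult[symmetric] by (rule mdet_cong) (rule MP)
  then show ?thesis using nz m by simp
qed

lemma sum_block:
  assumes "0 < d"
  shows "(\<Sum>l<r * d. f l) = (\<Sum>i<r. \<Sum>j<d. f (i * d + j :: nat))"
proof -
  have "sum f {i * d..<i * d + d} = (\<Sum>j<d. f (i * d + j))" for i
    using sum.shift_bounds_nat_ivl[of f 0 "i * d" d] by (simp add: lessThan_atLeast0 add.commute)
  then show ?thesis using sum.nat_group[of f d r] by simp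
qed

text \<open>The index \<open>l\<close> codes the pair of \<open>l div d\<close> and
  \<open>l mod d\<close>: each block of \<open>d\<close> indices is the power basis times one
  \<open>u i\<close>.\<close>

lemma kbasis_tower:
  fixes c :: "'a::field"
  assumes K: "subfield K" and E: "subfield E" "K \<subseteq> E" and d: "0 < d" and c: "kbasis K E d (\<lambda>i. c ^ i)"
    and u: "kbasis E UNIV r u"
  shows "kbasis K UNIV (r * d) (\<lambda>l. u (l div d) * c ^ (l mod d))"
proof -
  define \<beta> where "\<beta> l = u (l div d) * c ^ (l mod d)" for l
  have split: "(\<Sum>l<r * d. k l * \<beta> l) = (\<Sum>i<r. (\<Sum>j<d. k (i * d + j) * c ^ j) * u i)" for k
  proof -
    have "(\<Sum>l<r * d. k l * \<beta> l) = (\<Sum>i<r. \<Sum>j<d. k (i * d + j) * \<beta> (i * d + j))"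
      by (rule sum_block[OF d])
    also have "\<dots> = (\<Sum>i<r. (\<Sum>j<d. k (i * d + j) * c ^ j) * u i)"
      unfolding sum_distrib_right by (intro sum.cong) (auto simp: \<beta>_def mult_ac)
    finally show ?thesis .
  qed
  have lt: "i * d + j < r * d" if "i < r" "j < d" for i j
  proof -
    have "i * d + j < Suc i * d" using that by simp
    also have "\<dots> \<le> r * d" using that by (intro mult_le_mono1) simp
    finally show ?thesis .
  qed
  have "\<exists>k. (\<forall>l<r * d. k l \<in> K) \<and> x = (\<Sum>l<r * d. k l * \<beta> l)" for x
  proof -
    obtain e where e: "\<forall>i<r. e i \<in> E" "x = (\<Sum>i<r. e i * u i)" using kbasisD(2)[OF u, of x] by auto
    have "\<forall>i. \<exists>k. i < r \<longrightarrow> (\<forall>j<d. k j \<in> K) \<and> e i = (\<Sum>j<d. k j * c ^ j)"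
      using kbasisD(2)[OF c] e(1) by blast
    then obtain k where k: "\<forall>i. i < r \<longrightarrow> (\<forall>j<d. k i j \<in> K) \<and> e i = (\<Sum>j<d. k i j * c ^ j)"
      by (rule choice[THEN exE])
    define k' where "k' l = k (l div d) (l mod d)" for l
    have "k' l \<in> K" if "l < r * d" for l
    proof -
      have "l div d < r" using that by (rule less_mult_imp_div_less)
      then show ?thesis using k d by (simp add: k'_def)
    qed
    moreover have "(\<Sum>l<r * d. k' l * \<beta> l) = (\<Sum>i<r. e i * u i)"
      unfolding split
    proof (rule sum.cong[OF refl])
      fix i assume "i \<in> {..<r}"
      moreover have "(\<Sum>j<d. k' (i * d + j) * c ^ j) = (\<Sum>j<d. k i j * c ^ j)"
        by (rule sum.cong) (auto simp: k'_def)
      ultimately show "(\<Sum>j<d. k' (i * d + j) * c ^ j) * u i = e i * u i" using k by simp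
    qed
    ultimately show ?thesis using e(2) by (intro exI[of _ k']) simp
  qed
  moreover have "k l = 0" if k: "\<forall>l<r * d. k l \<in> K" "(\<Sum>l<r * d. k l * \<beta> l) = 0" and l: "l < r * d" for k l
  proof -
    have kd: "k (i * d + j) \<in> K" if "i < r" "j < d" for i j using k(1) lt that by blast
    have inE: "(\<Sum>j<d. k (i * d + j) * c ^ j) \<in> E" if "i < r" for i
      using kd that kbasisD(1)[OF c] E(2) by (intro subfield_sum[OF E(1)] subfield_mult[OF E(1)]) auto
    have z: "(\<Sum>j<d. k (i * d + j) * c ^ j) = 0" if "i < r" for i
      using kbasisD(3)[OF u, of "\<lambda>i. \<Sum>j<d. k (i * d + j) * c ^ j" i] inE k(2) that unfolding split by blast
    have "l div d < r" using l by (rule less_mult_imp_div_less)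
    then have "k (l div d * d + l mod d) = 0"
      using kbasisD(3)[OF c, of "\<lambda>j. k (l div d * d + j)" "l mod d"] kd z d by auto
    then show ?thesis by simp
  qed
  ultimately have "kbasis K UNIV (r * d) \<beta>" unfolding kbasis_def by blast
  then show ?thesis unfolding \<beta>_def .
qed

lemma is_basis_over_kbasis:
  assumes K: "subfield K" and b: "is_basis_over K m b"
  shows "kbasis K UNIV m b" "\<And>y i. i < m \<Longrightarrow> coords K m b y i \<in> K" "\<And>y. y = (\<Sum>i<m. coords K m b y i * b i)"
proof -
  let ?Q = "\<lambda>y c. (\<forall>i<m. c i \<in> K) \<and> (\<forall>i\<ge>m. c i = 0) \<and> y = (\<Sum>i<m. c i * b i)"
  have ex1: "\<exists>!c. ?Q y c" for y using b unfolding is_basis_over_def by blast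
  have co: "?Q y (coords K m b y)" for y unfolding coords_def by (rule theI'[OF ex1])
  then show 1: "\<And>y i. i < m \<Longrightarrow> coords K m b y i \<in> K" "\<And>y. y = (\<Sum>i<m. coords K m b y i * b i)"
    by blast+
  have "c i = 0" if c: "\<forall>i<m. c i \<in> K" "(\<Sum>i<m. c i * b i) = 0" "i < m" for c i
  proof -
    have "?Q 0 (restr m c)" using c by (auto simp: restr_def)
    moreover have "?Q 0 (\<lambda>_. 0)" using subfield_zero[OF K] by simp
    ultimately have "restr m c = (\<lambda>_. 0)"
      using the1_equality[OF ex1[of 0], of "restr m c"] the1_equality[OF ex1[of 0], of "\<lambda>_. 0"] by simp
    then show ?thesis using c(3) by (metis restr_def)
  qed
  then show "kbasis K UNIV m b" unfolding kbasis_def using 1 by blast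
qed

text \<open>Multiplication by \<open>c\<close> in the basis \<open>u\<^sub>i c\<^sup>j\<close> is the block-cyclic shift times an upper
triangular matrix; in characteristic 2 the shift has determinant 1.\<close>

lemma field_norm_simple:
  fixes c :: "'a::field"
  assumes K: "subfield K" and char2: "(2::'a) = 0" and fin: "finite_ext K" and E: "subfield E" "K \<subseteq> E"
    and d: "0 < d" and c: "kbasis K E d (\<lambda>i. c ^ i)" and u: "kbasis E UNIV r u"
    and P: "\<And>i. i < d \<Longrightarrow> P i \<in> K" "c ^ d = (\<Sum>i<d. P i * c ^ i)"
  shows "field_norm K c = P 0 ^ r"
proof -
  obtain m b where mb: "(SOME (m, b). is_basis_over K m b) = (m, b)" by fastforce
  have "\<exists>z. case z of (m, b) \<Rightarrow> is_basis_over K m b" using fin unfolding finite_ext_def by auto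
  then have "case (SOME (m, b). is_basis_over K m b) of (m, b) \<Rightarrow> is_basis_over K m b" by (rule someI_ex)
  then have b: "is_basis_over K m b" using mb by simp
  define \<beta> where "\<beta> l = u (l div d) * c ^ (l mod d)" for l
  have \<beta>: "kbasis K UNIV (r * d) \<beta>" unfolding \<beta>_def by (rule kbasis_tower[OF K E d c u])
  \<comment> \<open>The cyclic successor inside a block; the last index wraps to the start of its
    own block.\<close>
  define s where "s l = (if Suc (l mod d) = d then l - l mod d else Suc l)" for l
  define S :: "nat \<Rightarrow> nat \<Rightarrow> 'a" where "S i l = of_bool (i = s l)" for i l
  \<comment> \<open>The companion column with its rows rotated by one: \<open>P 0\<close> lands on
    the diagonal once per block, and the other columns are unit vectors.\<close>
  define U where "U k l = (if Suc (l mod d) = d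
      then (if k div d = l div d then P (Suc (k mod d) mod d) else 0) else of_bool (k = l))" for k l
  have sdm: "s l div d = l div d" "s l mod d = Suc (l mod d) mod d" for l
  proof -
    have "s l = (l div d) * d + Suc (l mod d) mod d"
    proof (cases "Suc (l mod d) = d")
      case True
      then show ?thesis by (simp add: s_def minus_mod_eq_div_mult)
    next
      case False
      then have "Suc (l mod d) < d" using mod_less_divisor[OF d, of l] False by linarith
      then show ?thesis using False div_mult_mod_eq[of l d] by (simp add: s_def)
    qed
    moreover have "Suc (l mod d) mod d < d" using d by simp
    ultimately show "s l div d = l div d" "s l mod d = Suc (l mod d) mod d" by auto
  qed
  have s_lt: "s l < r * d" if "l < r * d" for l
  proof -
    have "l div d < r" using that by (rule less_mult_imp_div_less)
    then show ?thesis using sdm(1)[of l] d by (metis div_less_iff_less_mult)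
  qed
  have s_inj: "l = l'" if "s l = s l'" for l l'
  proof -
    have "l div d = l' div d" using sdm(1)[of l] sdm(1)[of l'] that by simp
    moreover have "Suc (l mod d) mod d = Suc (l' mod d) mod d" using sdm(2)[of l] sdm(2)[of l'] that by simp
    then have "l mod d = l' mod d"
      using mod_less_divisor[OF d, of l] mod_less_divisor[OF d, of l'] by (auto simp: mod_Suc split: if_splits)
    ultimately show ?thesis by (metis div_mult_mod_eq)
  qed
  \<comment> \<open>\<open>S\<close> is a permutation matrix, so its transpose inverts it. In
    characteristic 2 a determinant with square 1 equals 1.\<close>
  have "mdet (r * d) S * mdet (r * d) S = 1"
  proof -
    have "mdet (r * d) S * mdet (r * d) S = mdet (r * d) (\<lambda>i j. S j i) * mdet (r * d) S"
      unfolding mdet_transpose[of "r * d" S] ..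
    also have "\<dots> = mdet (r * d) (\<lambda>i j. \<Sum>k<r * d. S k i * S k j)" by (rule mdet_mult[symmetric])
    also have "\<dots> = mdet (r * d) (\<lambda>i j. of_bool (i = j))"
    proof (rule mdet_cong)
      fix i j assume ij: "i < r * d" "j < r * d"
      have "(\<Sum>k<r * d. S k i * S k j) = (\<Sum>k<r * d. if k = s i then of_bool (i = j) else 0)"
        using s_inj by (intro sum.cong) (auto simp: S_def)
      then show "(\<Sum>k<r * d. S k i * S k j) = of_bool (i = j)" using s_lt[OF ij(1)] by simp
    qed
    finally show ?thesis by (simp add: mdet_one)
  qed
  then have detS: "mdet (r * d) S = 1"
  proof -
    assume a: "mdet (r * d) S * mdet (r * d) S = 1"
    have "(mdet (r * d) S - 1) * (mdet (r * d) S - 1) = mdet (r * d) S * mdet (r * d) S + 1 - 2 * mdet (r * d) S"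
      by (simp add: algebra_simps)
    also have "\<dots> = 2 - 2 * mdet (r * d) S" by (simp add: a)
    also have "\<dots> = 0" by (simp only: char2 mult_zero_left diff_zero)
    finally show ?thesis by simp
  qed
  have detU: "mdet (r * d) U = P 0 ^ r"
  proof -
    have "mdet (r * d) U = (\<Prod>l<r * d. U l l)"
    proof (rule mdet_upper_triangular)
      fix k l assume kl: "l < k" "k < r * d"
      show "U k l = 0"
      proof (cases "Suc (l mod d) = d \<and> k div d = l div d")
        case True
        have "k mod d < d" using d by simp
        then have "k mod d \<le> l mod d" using True by linarith
        then have "k \<le> l" using True div_mult_mod_eq[of k d] div_mult_mod_eq[of l d] by (metis add_le_cancel_left)
        then show ?thesis using kl by simp
      qed (use kl in \<open>auto simp: U_def\<close>)
    qed
    also have "\<dots> = (\<Prod>i<r. prod (\<lambda>l. U l l) {i * d..<i * d + d})" by (rule prod.nat_group[symmetric])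
    also have "\<dots> = (\<Prod>i<r. P 0)"
    proof (rule prod.cong[OF refl])
      fix i
      have "prod (\<lambda>l. U l l) {i * d..<i * d + d} = (\<Prod>j<d. U (i * d + j) (i * d + j))"
        using prod.shift_bounds_nat_ivl[of "\<lambda>l. U l l" 0 "i * d" d] by (simp add: lessThan_atLeast0 add.commute)
      also have "\<dots> = (\<Prod>j<d. if j = d - 1 then P 0 else 1)"
      proof (rule prod.cong[OF refl])
        fix j assume "j \<in> {..<d}"
        then have m: "(i * d + j) mod d = j" by simp
        show "U (i * d + j) (i * d + j) = (if j = d - 1 then P 0 else 1)"
          unfolding U_def m using d by auto
      qed
      also have "\<dots> = P 0" using d by simp
      finally show "prod (\<lambda>l. U l l) {i * d..<i * d + d} = P 0" .
    qed
    finally show ?thesis by simp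
  qed
  define M' where "M' i l = (\<Sum>k<r * d. S i k * U k l)" for i l
  have UK: "U k l \<in> K" for k l using P(1) d K by (auto simp: U_def of_bool_def subfield_intros)
  have M'K: "M' i l \<in> K" for i l unfolding M'_def
    using UK K by (intro subfield_intros) (auto simp: S_def of_bool_def subfield_intros)
  have M'c: "c * \<beta> l = (\<Sum>i<r * d. M' i l * \<beta> i)" if l: "l < r * d" for l
  proof -
    have "(\<Sum>i<r * d. M' i l * \<beta> i) = (\<Sum>i<r * d. \<Sum>k<r * d. U k l * (S i k * \<beta> i))"
      unfolding M'_def sum_distrib_right by (simp add: mult_ac)
    also have "\<dots> = (\<Sum>k<r * d. U k l * (\<Sum>i<r * d. S i k * \<beta> i))"
      by (subst sum.swap) (simp add: sum_distrib_left)
    also have "\<dots> = (\<Sum>k<r * d. U k l * \<beta> (s k))"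
    proof (rule sum.cong[OF refl])
      fix k assume k: "k \<in> {..<r * d}"
      have "(\<Sum>i<r * d. S i k * \<beta> i) = (\<Sum>i<r * d. if i = s k then \<beta> i else 0)"
        by (rule sum.cong) (auto simp: S_def)
      then show "U k l * (\<Sum>i<r * d. S i k * \<beta> i) = U k l * \<beta> (s k)" using s_lt k by simp
    qed
    also have "\<dots> = c * \<beta> l"
    proof (cases "Suc (l mod d) = d")
      case False
      have "(\<Sum>k<r * d. U k l * \<beta> (s k)) = (\<Sum>k<r * d. if k = l then \<beta> (s k) else 0)"
        using False by (intro sum.cong) (auto simp: U_def)
      also have "\<dots> = \<beta> (s l)" using l by simp
      also have "\<dots> = c * \<beta> l"
      proof -
        have "Suc (l mod d) < d" using mod_less_divisor[OF d, of l] False by linarith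
        then have "Suc (l mod d) mod d = Suc (l mod d)" by simp
        then show ?thesis by (simp add: \<beta>_def sdm mult_ac)
      qed
      finally show ?thesis .
    next
      case True
      define i where "i = l div d"
      have ir: "i < r" unfolding i_def using l by (rule less_mult_imp_div_less)
      have "(\<Sum>k<r * d. U k l * \<beta> (s k)) = (\<Sum>i'<r. \<Sum>j<d. U (i' * d + j) l * \<beta> (s (i' * d + j)))"
        by (rule sum_block[OF d])
      also have "\<dots> = (\<Sum>i'<r. if i' = i then (\<Sum>j<d. P (Suc j mod d) * (u i * c ^ (Suc j mod d))) else 0)"
      proof (rule sum.cong[OF refl])
        fix i'
        show "(\<Sum>j<d. U (i' * d + j) l * \<beta> (s (i' * d + j))) =
          (if i' = i then (\<Sum>j<d. P (Suc j mod d) * (u i * c ^ (Suc j mod d))) else 0)"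
          using True by (auto simp: U_def \<beta>_def sdm i_def intro!: sum.cong)
      qed
      also have "\<dots> = (\<Sum>j<d. P (Suc j mod d) * (u i * c ^ (Suc j mod d)))" using ir by simp
      also have "\<dots> = u i * (\<Sum>j<d. P (Suc j mod d) * c ^ (Suc j mod d))"
        by (simp add: sum_distrib_left mult_ac)
      also have "(\<Sum>j<d. P (Suc j mod d) * c ^ (Suc j mod d)) = (\<Sum>j<d. P j * c ^ j)"
      proof -
        obtain e where e: "d = Suc e" using d by (cases d) auto
        have "(\<Sum>j<e. P (Suc j mod Suc e) * c ^ (Suc j mod Suc e)) = (\<Sum>j<e. P (Suc j) * c ^ Suc j)"
          by (rule sum.cong) auto
        then show ?thesis unfolding e sum.lessThan_Suc_shift[of "\<lambda>j. P j * c ^ j"] by simp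
      qed
      also have "u i * (\<Sum>j<d. P j * c ^ j) = c * \<beta> l"
      proof -
        have "c ^ d = c * c ^ (l mod d)" using True by (metis power_Suc)
        then show ?thesis unfolding P(2)[symmetric] by (simp add: \<beta>_def i_def mult_ac)
      qed
      finally show ?thesis .
    qed
    finally show ?thesis by simp
  qed
  note bb = is_basis_over_kbasis[OF K b]
  have "field_norm K c = mdet m (\<lambda>i j. coords K m b (c * b j) i)"
    unfolding field_norm_def mb by simp
  also have "\<dots> = mdet (r * d) M'"
    by (rule mdet_basis_change[OF K bb(1) \<beta>, where a = c]) (use bb(2,3) M'K M'c in auto)
  also have "\<dots> = P 0 ^ r" unfolding M'_def mdet_mult detS detU by simp
  finally show ?thesis .
qed

section \<open>Trace forms in characteristic 2\<close>

lemma char2_double: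
  assumes "(2::'a::field) = 0"
  shows "(x::'a) + x = 0"
  using assms by (metis mult_2 mult_zero_left)

text \<open>Off-diagonal terms come in equal pairs and cancel. Both the trace identity and the
  squaring of sums reduce to this.\<close>

lemma sum_symmetric_char2:
  fixes f :: "nat \<Rightarrow> nat \<Rightarrow> 'a::field"
  assumes "(2::'a) = 0" "\<And>i j. i < r \<Longrightarrow> j < r \<Longrightarrow> f i j = f j i"
  shows "(\<Sum>i<r. \<Sum>j<r. f i j) = (\<Sum>i<r. f i i)"
  using assms(2)
proof (induction r)
  case (Suc r)
  have "(\<Sum>i<Suc r. \<Sum>j<Suc r. f i j) = (\<Sum>i<r. \<Sum>j<r. f i j) + ((\<Sum>i<r. f i r) + (\<Sum>j<r. f r j)) + f r r"
    by (simp add: sum.distrib algebra_simps)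
  also have "(\<Sum>j<r. f r j) = (\<Sum>i<r. f i r)" using Suc.prems by (intro sum.cong) auto
  also have "(\<Sum>i<r. f i r) + (\<Sum>i<r. f i r) = 0" by (rule char2_double[OF assms(1)])
  finally show ?case using Suc by simp
qed simp

text \<open>In characteristic 2 every square matrix satisfies \<open>tr (M\<^sup>2) = (tr M)\<^sup>2\<close>.\<close>

lemma trace_exists:
  fixes u :: "nat \<Rightarrow> 'a::field"
  assumes E: "subfield E" and char2: "(2::'a) = 0" and u: "kbasis E UNIV r u" and odd: "odd r"
  shows "\<exists>tr. (\<forall>x. tr x \<in> E) \<and> (\<forall>x y. tr (x + y) = tr x + tr y) \<and> (\<forall>k\<in>E. \<forall>x. tr (k * x) = k * tr x) \<and>
    (\<forall>x. tr (x * x) = tr x * tr x) \<and> tr 1 = 1"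
proof -
  obtain co where "\<And>x i. x \<in> UNIV \<Longrightarrow> i < r \<Longrightarrow> co x i \<in> E" "\<And>x. x \<in> UNIV \<Longrightarrow> x = (\<Sum>i<r. co x i * u i)"
    and uniq: "\<And>c i. (\<And>i. i < r \<Longrightarrow> c i \<in> E) \<Longrightarrow> i < r \<Longrightarrow> co (\<Sum>i<r. c i * u i) i = c i"
    and "\<And>x y i. x \<in> UNIV \<Longrightarrow> y \<in> UNIV \<Longrightarrow> i < r \<Longrightarrow> co (x + y) i = co x i + co y i"
    "\<And>k x i. k \<in> E \<Longrightarrow> x \<in> UNIV \<Longrightarrow> i < r \<Longrightarrow> co (k * x) i = k * co x i"
    using kbasis_coordinates[OF E subfield_UNIV subset_UNIV u] by blast
  then have co: "\<And>x i. i < r \<Longrightarrow> co x i \<in> E" "\<And>x. x = (\<Sum>i<r. co x i * u i)"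
    "\<And>x y i. i < r \<Longrightarrow> co (x + y) i = co x i + co y i"
    "\<And>k x i. k \<in> E \<Longrightarrow> i < r \<Longrightarrow> co (k * x) i = k * co x i" by blast+
  define M where "M x i j = co (x * u j) i" for x i j
  define tr where "tr x = (\<Sum>i<r. M x i i)" for x
  have MK: "M x i j \<in> E" if "i < r" for x i j using co(1) that by (simp add: M_def)
  have xu: "x * u j = (\<Sum>i<r. M x i j * u i)" for x j unfolding M_def by (rule co(2))
  have MM: "M (x * x) i j = (\<Sum>l<r. M x i l * M x l j)" if "i < r" for x i j
  proof -
    have "x * x * u j = (\<Sum>l<r. M x l j * (x * u l))"
      using xu[of x j] by (simp add: mult.assoc sum_distrib_left mult_ac)
    also have "\<dots> = (\<Sum>l<r. \<Sum>i<r. M x i l * M x l j * u i)"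
      by (subst xu) (simp add: sum_distrib_left mult_ac)
    also have "\<dots> = (\<Sum>i<r. (\<Sum>l<r. M x i l * M x l j) * u i)"
      by (subst sum.swap) (simp add: sum_distrib_right)
    finally have "co (x * x * u j) i = co (\<Sum>i<r. (\<Sum>l<r. M x i l * M x l j) * u i) i" by simp
    also have "\<dots> = (\<Sum>l<r. M x i l * M x l j)"
      using MK E that by (intro uniq) (auto intro!: subfield_intros)
    finally show ?thesis by (simp add: M_def)
  qed
  have "tr x \<in> E" for x unfolding tr_def using MK E by (intro subfield_intros) auto
  moreover have "tr (x + y) = tr x + tr y" for x y
    unfolding tr_def M_def using co(3) by (simp add: distrib_right sum.distrib)
  moreover have "tr (k * x) = k * tr x" if "k \<in> E" for k x
    unfolding tr_def M_def using co(4) that by (simp add: mult.assoc sum_distrib_left)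
  moreover have "tr (x * x) = tr x * tr x" for x
  proof -
    have "tr (x * x) = (\<Sum>i<r. \<Sum>l<r. M x i l * M x l i)" unfolding tr_def using MM by simp
    also have "\<dots> = (\<Sum>i<r. M x i i * M x i i)" by (rule sum_symmetric_char2[OF char2]) (simp add: mult.commute)
    also have "\<dots> = (\<Sum>i<r. \<Sum>l<r. M x i i * M x l l)"
      by (rule sum_symmetric_char2[OF char2, symmetric]) (simp add: mult.commute)
    also have "\<dots> = tr x * tr x" unfolding tr_def by (simp add: sum_product)
    finally show ?thesis .
  qed
  \<comment> \<open>The trace of 1 is the degree \<open>r\<close>, which is odd.\<close>
  moreover have "tr 1 = 1"
  proof -
    have "M 1 i i = 1" if i: "i < r" for i
    proof -
      have "u i = (\<Sum>j<r. of_bool (j = i) * u j)"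
      proof -
        have "(\<Sum>j<r. of_bool (j = i) * u j) = (\<Sum>j<r. if j = i then u j else 0)" by (rule sum.cong) auto
        then show ?thesis using i by simp
      qed
      then have "co (u i) i = co (\<Sum>j<r. of_bool (j = i) * u j) i" by (rule arg_cong[where f = "\<lambda>z. co z i"])
      also have "\<dots> = of_bool (i = i)"
        using E i by (intro uniq) (auto simp: of_bool_def subfield_intros)
      finally show ?thesis by (simp add: M_def)
    qed
    then have "tr 1 = of_nat r" by (simp add: tr_def)
    moreover obtain k where k: "r = 2 * k + 1" using odd by (elim oddE)
    ultimately have "tr 1 = 2 * of_nat k + 1" by simp
    also have "\<dots> = 1" by (simp only: char2 mult_zero_left add_0_left)
    finally show ?thesis .
  qed
  ultimately show ?thesis by (intro exI[of _ tr]) blast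
qed

text \<open>As \<open>tr 1 = 1\<close>, the scalars split off from the kernel of \<open>tr\<close>
  orthogonally, and on that kernel the trace form is alternating by
  \<open>tr (x * x) = tr x * tr x\<close>. A longest symplectic family there is complete because a
  nonzero remainder could be paired with one built from its inverse.\<close>

lemma trace_symplectic_basis:
  fixes u :: "nat \<Rightarrow> 'a::field"
  assumes E: "subfield E" and char2: "(2::'a) = 0" and u: "kbasis E UNIV r u"
    and tr: "\<And>x. tr x \<in> E" "\<And>x y. tr (x + y) = tr x + tr y" "\<And>k x. k \<in> E \<Longrightarrow> tr (k * x) = k * tr x"
      "\<And>x. tr (x * x) = tr x * tr x" "tr 1 = 1"
  shows "\<exists>(h::nat) \<alpha> \<beta>. (\<forall>i<h. tr (\<alpha> i) = 0 \<and> tr (\<beta> i) = 0) \<and>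
    (\<forall>i<h. \<forall>j<h. tr (\<alpha> i * \<alpha> j) = 0 \<and> tr (\<beta> i * \<beta> j) = 0 \<and> tr (\<alpha> i * \<beta> j) = of_bool (i = j)) \<and>
    (\<forall>x. x = tr x + (\<Sum>j<h. tr (x * \<beta> j) * \<alpha> j) + (\<Sum>j<h. tr (x * \<alpha> j) * \<beta> j))"
proof -
  note c2 = char2_double[OF char2]
  have c2l: "(x::'a) + (x + y) = y" for x y using c2[of x] by (simp add: add.assoc[symmetric])
  have tr0: "tr 0 = 0" using tr(3)[OF subfield_zero[OF E], of 0] by simp
  have trs: "tr (sum f I) = (\<Sum>i\<in>I. tr (f i))" for f and I :: "nat set"
    by (rule additive_sum) (rule tr0 tr(2))+
  have trE: "tr k = k" if "k \<in> E" for k using tr(3)[OF that, of 1] tr(5) by simp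
  define Q where "Q h \<alpha> \<beta> \<longleftrightarrow> (\<forall>i<h. tr (\<alpha> i) = 0 \<and> tr (\<beta> i) = 0) \<and>
    (\<forall>i<h. \<forall>j<h. tr (\<alpha> i * \<alpha> j) = 0 \<and> tr (\<beta> i * \<beta> j) = 0 \<and> tr (\<alpha> i * \<beta> j) = of_bool (i = j))"
    for h :: nat and \<alpha> \<beta>
  have Q0: "\<exists>\<alpha> \<beta>. Q 0 \<alpha> \<beta>" by (simp add: Q_def)
  have bound: "h \<le> r" if h: "\<exists>\<alpha> \<beta>. Q h \<alpha> \<beta>" for h
  proof (rule ccontr)
    assume "\<not> h \<le> r"
    obtain \<alpha> \<beta> where ab: "Q h \<alpha> \<beta>" using h by blast
    have "\<exists>c. (\<forall>j<h. c j \<in> E) \<and> (\<exists>j<h. c j \<noteq> 0) \<and> (\<Sum>j<h. c j * \<alpha> j) = 0"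
      by (rule dependent_nat[OF E, of r h \<alpha> u]) (use \<open>\<not> h \<le> r\<close> kbasisD(2)[OF u] in auto)
    then obtain c l where c: "\<forall>j<h. c j \<in> E" "l < h" "c l \<noteq> 0" "(\<Sum>j<h. c j * \<alpha> j) = 0" by blast
    have "0 = tr ((\<Sum>j<h. c j * \<alpha> j) * \<beta> l)" using c(4) tr0 by simp
    also have "\<dots> = (\<Sum>j<h. tr (c j * (\<alpha> j * \<beta> l)))" by (simp add: sum_distrib_right trs mult.assoc)
    also have "\<dots> = (\<Sum>j<h. if j = l then c j else 0)"
      using c(1,2) tr(3) ab unfolding Q_def by (intro sum.cong) auto
    also have "\<dots> = c l" using c(2) by simp
    finally show False using c(3) by simp
  qed
  obtain h where h: "\<exists>\<alpha> \<beta>. Q h \<alpha> \<beta>" "\<not> (\<exists>\<alpha> \<beta>. Q (Suc h) \<alpha> \<beta>)"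
    using bounded_nat_maximal[of "\<lambda>h. \<exists>\<alpha> \<beta>. Q h \<alpha> \<beta>" r] Q0 bound by blast
  then obtain \<alpha> \<beta> where ab: "Q h \<alpha> \<beta>" by blast
  have q: "tr (\<alpha> i) = 0" "tr (\<beta> i) = 0" "tr (\<alpha> i * \<alpha> j) = 0" "tr (\<beta> i * \<beta> j) = 0"
    "tr (\<alpha> i * \<beta> j) = of_bool (i = j)" "tr (\<beta> i * \<alpha> j) = of_bool (i = j)" if "i < h" "j < h" for i j
    using ab that unfolding Q_def by (auto simp: mult.commute[of "\<beta> i"])
  \<comment> \<open>The component orthogonal to 1 and to the whole family, with plus for
    minus.\<close>
  define R where "R x = x + (tr x + (\<Sum>j<h. tr (x * \<beta> j) * \<alpha> j) + (\<Sum>j<h. tr (x * \<alpha> j) * \<beta> j))" for x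
  have trR: "tr (R x * y) = tr (x * y) + (tr x * tr y + (\<Sum>j<h. tr (x * \<beta> j) * tr (\<alpha> j * y)) + (\<Sum>j<h. tr (x * \<alpha> j) * tr (\<beta> j * y)))"
    for x y
    by (simp add: R_def distrib_right tr(2) sum_distrib_right trs mult.assoc tr(3) tr(1))
  have R1: "tr (R x) = 0" for x
    using trR[of x 1] q by (simp add: tr(5) c2)
  have Ra: "tr (R x * \<alpha> l) = 0" if l: "l < h" for x l
  proof -
    have "(\<Sum>j<h. tr (x * \<beta> j) * tr (\<alpha> j * \<alpha> l)) = 0" using q l by simp
    moreover have "(\<Sum>j<h. tr (x * \<alpha> j) * tr (\<beta> j * \<alpha> l)) = (\<Sum>j<h. if j = l then tr (x * \<alpha> j) else 0)"
      using q l by (intro sum.cong) auto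
    ultimately show ?thesis unfolding trR using q l by (simp add: c2)
  qed
  have Rb: "tr (R x * \<beta> l) = 0" if l: "l < h" for x l
  proof -
    have "(\<Sum>j<h. tr (x * \<alpha> j) * tr (\<beta> j * \<beta> l)) = 0" using q l by simp
    moreover have "(\<Sum>j<h. tr (x * \<beta> j) * tr (\<alpha> j * \<beta> l)) = (\<Sum>j<h. if j = l then tr (x * \<beta> j) else 0)"
      using q l by (intro sum.cong) auto
    ultimately show ?thesis unfolding trR using q l by (simp add: c2)
  qed
  have "R x = 0" for x
  proof (rule ccontr)
    assume x: "R x \<noteq> 0"
    \<comment> \<open>\<open>z * R x = 1\<close> has trace 1. Passing from \<open>z\<close> to its
      remainder \<open>R z\<close> keeps this value, since \<open>R x\<close> is orthogonal to what
      is removed.\<close>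
    define z where "z = inverse (R x)"
    have "tr (R z * R x) = tr (z * R x)"
      unfolding trR using Ra[of _ x] Rb[of _ x] R1[of x] by (simp add: mult.commute[of _ "R x"])
    then have zx: "tr (R x * R z) = 1" using x tr(5) by (simp add: z_def mult.commute)
    have comm: "tr (\<alpha> l * R y) = 0" "tr (\<beta> l * R y) = 0" if "l < h" for l y
      using Ra[OF that] Rb[OF that] by (simp_all add: mult.commute)
    have "tr (R y * R y) = 0" for y using tr(4)[of "R y"] R1 by simp
    then have "Q (Suc h) (\<alpha>(h := R x)) (\<beta>(h := R z))"
      unfolding Q_def using q Ra Rb R1 zx comm by (auto simp: less_Suc_eq)
    then show False using h(2) by blast
  qed
  then have "x = tr x + (\<Sum>j<h. tr (x * \<beta> j) * \<alpha> j) + (\<Sum>j<h. tr (x * \<alpha> j) * \<beta> j)" for x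
  proof -
    have "x + (tr x + (\<Sum>j<h. tr (x * \<beta> j) * \<alpha> j) + (\<Sum>j<h. tr (x * \<alpha> j) * \<beta> j)) = x + x"
      using \<open>\<And>x. R x = 0\<close>[of x] c2[of x] unfolding R_def by simp
    then show ?thesis by (simp only: add_left_cancel)
  qed
  then show ?thesis using ab unfolding Q_def by blast
qed

definition scp :: "'a::field \<Rightarrow> (nat \<Rightarrow> 'a) \<times> (nat \<Rightarrow> 'a) \<Rightarrow> (nat \<Rightarrow> 'a) \<times> (nat \<Rightarrow> 'a)" where
  "scp k w = (sc k (fst w), sc k (snd w))"

lemma module_scp: "Modules.module scp"
  by standard (auto simp: scp_def fun_eq_iff algebra_simps)

section \<open>Transfer\<close>

text \<open>The form \<open>s\<^sub>*(\<nu> \<phi>\<^sub>E) \<bottom> \<kappa> \<phi>\<close> over \<open>K\<close>, obtained by transfer along \<open>s : E \<rightarrow> K\<close>.\<close>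

locale transfer = nform b q \<epsilon> n K for b q \<epsilon> n and K :: "'a::field set" +
  fixes E :: "'a set" and s :: "'a \<Rightarrow> 'a" and \<kappa> :: 'a
  assumes E: "subfield E" "K \<subseteq> E"
    and s_in: "\<And>x. x \<in> E \<Longrightarrow> s x \<in> K"
    and s_add: "\<And>x y. x \<in> E \<Longrightarrow> y \<in> E \<Longrightarrow> s (x + y) = s x + s y"
    and s_scale: "\<And>k x. k \<in> K \<Longrightarrow> x \<in> E \<Longrightarrow> s (k * x) = k * s x"
    and \<kappa>: "\<kappa> \<in> K"
begin

text \<open>For \<open>\<kappa> = 0\<close> the second summand must be absent and not merely null,
  as otherwise no frame could exhaust the space.\<close>

definition Z :: "'a set" where "Z = (if \<kappa> = 0 then {0} else K)"

definition Zv :: "(nat \<Rightarrow> 'a) set" where "Zv = (if \<kappa> = 0 then {0} else kvec K n)"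

definition W :: "((nat \<Rightarrow> 'a) \<times> (nat \<Rightarrow> 'a)) set" where "W = kvec E n \<times> Zv"

definition bt :: "'a \<Rightarrow> (nat \<Rightarrow> 'a) \<times> (nat \<Rightarrow> 'a) \<Rightarrow> (nat \<Rightarrow> 'a) \<times> (nat \<Rightarrow> 'a) \<Rightarrow> 'a" where
  "bt \<nu> w w' = s (\<nu> * b (fst w) (fst w')) + \<kappa> * b (snd w) (snd w')"

definition qt :: "'a \<Rightarrow> (nat \<Rightarrow> 'a) \<times> (nat \<Rightarrow> 'a) \<Rightarrow> 'a" where
  "qt \<nu> w = s (\<nu> * q (fst w)) + \<kappa> * q (snd w)"

text \<open>The scalar form on pairs from \<open>E\<close> and \<open>Z\<close> whose tensor product
  with \<open>b\<close> is \<open>bt\<close>; correspondingly \<open>emb p\<close> is tensoring with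
  \<open>p\<close>.\<close>

definition gram :: "'a \<Rightarrow> 'a \<times> 'a \<Rightarrow> 'a \<times> 'a \<Rightarrow> 'a" where
  "gram \<nu> p p' = s (\<nu> * (fst p * fst p')) + \<kappa> * (snd p * snd p')"

definition emb :: "'a \<times> 'a \<Rightarrow> (nat \<Rightarrow> 'a) \<Rightarrow> (nat \<Rightarrow> 'a) \<times> (nat \<Rightarrow> 'a)" where
  "emb p x = (sc (fst p) x, sc (snd p) x)"

lemma s_zero: "s 0 = 0"
  using s_scale[of 0 0] subfield_zero[OF K] subfield_zero[OF E(1)] by simp

lemma eps_in: "\<epsilon> \<in> K"
  using eps subfield_zero[OF K] subfield_one[OF K] by auto

lemma b_E: "x \<in> kvec E n \<Longrightarrow> y \<in> kvec E n \<Longrightarrow> b x y \<in> E" and q_E: "x \<in> kvec E n \<Longrightarrow> q x \<in> E"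
  using b_in q_in E by auto

lemma Zv_sub: "x \<in> Zv \<Longrightarrow> x \<in> kvec K n"
  by (auto simp: Zv_def kvec_zero K split: if_splits)

lemma form_space_transfer:
  assumes \<nu>: "\<nu> \<in> E"
  shows "form_space scp K W (bt \<nu>) (qt \<nu>) \<epsilon>"
proof (intro form_space.intro form_space_axioms.intro module_scp)
  note EI = subfield_intros[OF E(1)]
  show "0 \<in> W" by (simp add: W_def Zv_def zero_prod_def kvec_zero E K)
  show "x + y \<in> W" if "x \<in> W" "y \<in> W" for x y
    using that by (auto simp: W_def Zv_def kvec_add E K split: if_splits)
  show "scp k x \<in> W" if "k \<in> K" "x \<in> W" for k x
  proof -
    have "sc k (0 :: nat \<Rightarrow> 'a) = 0" by (simp add: fun_eq_iff)
    then show ?thesis using that E(2) by (auto simp: W_def Zv_def kvec_sc E(1) K scp_def split: if_splits)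
  qed
  show "bt \<nu> x y \<in> K" if "x \<in> W" "y \<in> W" for x y
    using that \<nu> \<kappa> b_E V.b_in Zv_sub unfolding W_def bt_def
    by (auto intro!: subfield_add[OF K] subfield_mult[OF K] s_in EI)
  show "qt \<nu> x \<in> K" if "x \<in> W" for x
    using that \<nu> \<kappa> q_E V.q_in Zv_sub unfolding W_def qt_def
    by (auto intro!: subfield_add[OF K] subfield_mult[OF K] s_in EI)
  show "bt \<nu> x y = bt \<nu> y x" for x y unfolding bt_def by (simp only: b_sym)
  show "bt \<nu> (x + y) z = bt \<nu> x z + bt \<nu> y z" if "x \<in> W" "y \<in> W" "z \<in> W" for x y z
  proof -
    have "s (\<nu> * b (fst (x + y)) (fst z)) = s (\<nu> * b (fst x) (fst z)) + s (\<nu> * b (fst y) (fst z))"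
      using that \<nu> b_E by (auto simp: W_def b_add distrib_left s_add EI)
    then show ?thesis by (simp add: bt_def b_add algebra_simps)
  qed
  show "bt \<nu> (scp k x) z = k * bt \<nu> x z" if "k \<in> K" "x \<in> W" "z \<in> W" for k x z
  proof -
    have "s (k * (\<nu> * b (fst x) (fst z))) = k * s (\<nu> * b (fst x) (fst z))"
      using that \<nu> b_E by (intro s_scale) (auto simp: W_def EI)
    then show ?thesis by (simp add: bt_def scp_def b_sc distrib_left mult.left_commute)
  qed
  show "qt \<nu> (x + y) = qt \<nu> x + qt \<nu> y + \<epsilon> * bt \<nu> x y" if xy: "x \<in> W" "y \<in> W" for x y
  proof -
    have m: "fst x \<in> kvec E n" "fst y \<in> kvec E n" using xy by (auto simp: W_def)
    have "s (\<nu> * q (fst (x + y))) = s (\<nu> * q (fst x) + \<nu> * q (fst y) + \<epsilon> * (\<nu> * b (fst x) (fst y)))"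
      by (simp add: q_add distrib_left mult.left_commute)
    also have "\<dots> = s (\<nu> * q (fst x)) + s (\<nu> * q (fst y)) + \<epsilon> * s (\<nu> * b (fst x) (fst y))"
      using m \<nu> b_E q_E eps_in E(2) by (simp add: s_add s_scale EI subset_iff)
    finally show ?thesis by (simp add: qt_def bt_def q_add algebra_simps)
  qed
  show "qt \<nu> (scp k x) = k * k * qt \<nu> x" if "k \<in> K" "x \<in> W" for k x
  proof -
    have "s ((k * k) * (\<nu> * q (fst x))) = (k * k) * s (\<nu> * q (fst x))"
      using that \<nu> q_E by (intro s_scale) (auto simp: W_def EI subfield_mult[OF K])
    then show ?thesis by (simp add: qt_def scp_def q_sc distrib_left mult.left_commute)
  qed
  show "bt \<nu> x x = (1 + \<epsilon>) * qt \<nu> x" if "x \<in> W" for x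
  proof -
    have "s ((1 + \<epsilon>) * (\<nu> * q (fst x))) = (1 + \<epsilon>) * s (\<nu> * q (fst x))"
      using that \<nu> q_E eps_in by (intro s_scale) (auto simp: W_def EI subfield_add[OF K] subfield_one[OF K])
    then show ?thesis by (simp add: bt_def qt_def b_diag distrib_left mult.left_commute)
  qed
qed (fact K char2 eps)+

lemma emb_in:
  assumes "fst p \<in> E" "snd p \<in> Z" "x \<in> kvec K n"
  shows "emb p x \<in> W"
proof -
  have "x \<in> kvec E n" using assms(3) kvec_mono[OF E(2)] by blast
  then have "sc (fst p) x \<in> kvec E n" using assms kvec_sc[OF E(1)] by blast
  moreover have "sc (snd p) x \<in> Zv"
  proof (cases "\<kappa> = 0")
    case True
    then have "snd p = 0" using assms(2) unfolding Z_def by simp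
    then have "sc (snd p) x = 0" by (simp add: fun_eq_iff)
    then show ?thesis using True unfolding Zv_def by simp
  next
    case False
    then show ?thesis using assms kvec_sc[OF K] unfolding Zv_def Z_def by simp
  qed
  ultimately show ?thesis by (simp add: emb_def W_def)
qed

lemma lin_emb:
  assumes "fst p \<in> E" "snd p \<in> Z"
  shows "lin_on K sc scp (kvec K n) W (emb p)"
  unfolding lin_on_def using emb_in[OF assms]
  by (auto simp: emb_def scp_def fun_eq_iff algebra_simps)

lemma gram_in:
  assumes "\<nu> \<in> E" "fst p \<in> E" "snd p \<in> Z" "fst p' \<in> E" "snd p' \<in> Z"
  shows "gram \<nu> p p' \<in> K"
proof -
  have "snd p \<in> K" "snd p' \<in> K" using assms subfield_zero[OF K] by (auto simp: Z_def split: if_splits)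
  moreover have "\<nu> * (fst p * fst p') \<in> E" using assms by (intro subfield_mult[OF E(1)])
  ultimately show ?thesis unfolding gram_def using \<kappa> s_in
    by (intro subfield_add[OF K] subfield_mult[OF K]) auto
qed

lemma bt_emb:
  assumes "\<nu> \<in> E" "fst p \<in> E" "fst p' \<in> E" "x \<in> kvec K n" "y \<in> kvec K n"
  shows "bt \<nu> (emb p x) (emb p' y) = gram \<nu> p p' * b x y"
proof -
  have "s (b x y * (\<nu> * (fst p * fst p'))) = b x y * s (\<nu> * (fst p * fst p'))"
    using assms V.b_in by (intro s_scale subfield_mult[OF E(1)]) auto
  then show ?thesis by (simp add: bt_def emb_def gram_def b_sc b_sc_right algebra_simps)
qed

lemma qt_emb:
  assumes "\<nu> \<in> E" "fst p \<in> E" "x \<in> kvec K n"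
  shows "qt \<nu> (emb p x) = gram \<nu> p p * q x"
proof -
  have "s (q x * (\<nu> * (fst p * fst p))) = q x * s (\<nu> * (fst p * fst p))"
    using assms V.q_in by (intro s_scale subfield_mult[OF E(1)]) auto
  then show ?thesis by (simp add: qt_def emb_def gram_def q_sc algebra_simps)
qed

text \<open>The conditions of a frame at the level of scalars; tensoring with coordinate space gives
  the actual frame. The Gram matrix of the \<open>\<beta>\<close> is left free and becomes
  \<open>d\<close>.\<close>

definition scalar_frame :: "'a \<Rightarrow> nat \<Rightarrow> 'a \<Rightarrow> 'a \<times> 'a \<Rightarrow> (nat \<Rightarrow> 'a \<times> 'a) \<Rightarrow> (nat \<Rightarrow> 'a \<times> 'a) \<Rightarrow> bool" where
  "scalar_frame \<nu> h u \<omega> \<alpha> \<beta> \<longleftrightarrow> \<nu> \<in> E \<and> fst \<omega> \<in> E \<and> snd \<omega> \<in> Z \<and>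
     (\<forall>j<h. fst (\<alpha> j) \<in> E \<and> snd (\<alpha> j) \<in> Z \<and> fst (\<beta> j) \<in> E \<and> snd (\<beta> j) \<in> Z) \<and> gram \<nu> \<omega> \<omega> = u \<and>
     (\<forall>j<h. gram \<nu> \<omega> (\<alpha> j) = 0 \<and> gram \<nu> \<omega> (\<beta> j) = 0) \<and>
     (\<forall>i<h. \<forall>j<h. gram \<nu> (\<alpha> i) (\<alpha> j) = 0 \<and> gram \<nu> (\<alpha> i) (\<beta> j) = of_bool (i = j))"

lemma frame_of_scalars:
  assumes "scalar_frame \<nu> h u \<omega> \<alpha> \<beta>"
  shows "frame sc K (kvec K n) b q \<epsilon> scp W (bt \<nu>) (qt \<nu>) h u (\<lambda>i j. gram \<nu> (\<beta> i) (\<beta> j))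
    (emb \<omega>) (\<lambda>j. emb (\<alpha> j)) (\<lambda>j. emb (\<beta> j))"
proof -
  note f = assms[unfolded scalar_frame_def]
  have \<nu>: "\<nu> \<in> E" using f by simp
  have o: "fst \<omega> \<in> E" "snd \<omega> \<in> Z" "gram \<nu> \<omega> \<omega> = u" using f by auto
  have a: "fst (\<alpha> j) \<in> E" "snd (\<alpha> j) \<in> Z" "fst (\<beta> j) \<in> E" "snd (\<beta> j) \<in> Z"
    "gram \<nu> \<omega> (\<alpha> j) = 0" "gram \<nu> \<omega> (\<beta> j) = 0" if "j < h" for j using f that by auto
  have g: "gram \<nu> (\<alpha> i) (\<alpha> j) = 0" "gram \<nu> (\<alpha> i) (\<beta> j) = of_bool (i = j)" if "i < h" "j < h" for i j
    using f that by auto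
  have u: "u \<in> K" using gram_in[OF \<nu> o(1,2) o(1,2)] o(3) by simp
  show ?thesis
    by (intro frame.intro V.form_space_axioms form_space_transfer[OF \<nu>] frame_axioms.intro lin_emb)
      (auto simp: bt_emb qt_emb \<nu> o a g u)
qed

text \<open>Reduces cancellation to scalar computations plus multiplier conditions. On the source
  side the entries are divided by \<open>u\<close>, because the copy that absorbs them carries
  \<open>q\<close> scaled by \<open>u\<close>.\<close>

theorem transfer_cancellation:
  assumes src: "scalar_frame \<nu> h u \<omega> \<alpha> \<beta>" and tgt: "scalar_frame \<nu>' h 1 \<omega>' \<alpha>' \<beta>'"
    and complete: "\<And>p. fst p \<in> E \<Longrightarrow> snd p \<in> Z \<Longrightarrow>
      (\<exists>x. (\<forall>j<h. x j \<in> K) \<and>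
        fst p = gram \<nu>' p \<omega>' * fst \<omega>' + (\<Sum>j<h. x j * fst (\<alpha>' j)) + (\<Sum>j<h. gram \<nu>' p (\<alpha>' j) * fst (\<beta>' j)) \<and>
        snd p = gram \<nu>' p \<omega>' * snd \<omega>' + (\<Sum>j<h. x j * snd (\<alpha>' j)) + (\<Sum>j<h. gram \<nu>' p (\<alpha>' j) * snd (\<beta>' j)))"
    and T: "lin_on K sc sc (kvec E n) (kvec E n) T"
      "\<And>x y. x \<in> kvec E n \<Longrightarrow> y \<in> kvec E n \<Longrightarrow> \<nu>' * b (T x) (T y) = \<nu> * b x y"
      "\<And>x. x \<in> kvec E n \<Longrightarrow> \<nu>' * q (T x) = \<nu> * q x"
    and mult: "\<And>j. j < h \<Longrightarrow> gram \<nu> (\<beta> j) (\<beta> j) / u \<in> multipliers"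
      "\<And>j. j < h \<Longrightarrow> gram \<nu>' (\<beta>' j) (\<beta>' j) \<in> multipliers"
    and u: "u \<noteq> 0"
  shows "similitude_factor u"
proof -
  note f = tgt[unfolded scalar_frame_def]
  have \<nu>: "\<nu>' \<in> E" using f by simp
  have o: "fst \<omega>' \<in> E" "snd \<omega>' \<in> Z" using f by auto
  have a: "fst (\<alpha>' j) \<in> E" "snd (\<alpha>' j) \<in> Z" if "j < h" for j using f that by auto
  have gram_add: "gram \<nu>' (x + x', z + z') r = gram \<nu>' (x, z) r + gram \<nu>' (x', z') r"
    if "x \<in> E" "x' \<in> E" "fst r \<in> E" for x x' z z' r
  proof -
    have "s (\<nu>' * (x * fst r) + \<nu>' * (x' * fst r)) = s (\<nu>' * (x * fst r)) + s (\<nu>' * (x' * fst r))"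
      using that \<nu> by (intro s_add subfield_mult[OF E(1)]) auto
    then show ?thesis by (simp add: gram_def algebra_simps)
  qed
  have gram_scale: "gram \<nu>' (k * x, k * z) r = k * gram \<nu>' (x, z) r"
    if "k \<in> K" "x \<in> E" "fst r \<in> E" for k x z r
  proof -
    have "s (k * (\<nu>' * (x * fst r))) = k * s (\<nu>' * (x * fst r))"
      using that \<nu> by (intro s_scale subfield_mult[OF E(1)]) auto
    then show ?thesis by (simp add: gram_def distrib_left mult.left_commute mult.assoc)
  qed
  \<comment> \<open>Pairing with \<open>r\<close> in each coordinate separately. For
    \<open>\<omega>'\<close> and the \<open>\<alpha>' j\<close> this yields the coordinate maps of
    the complete frame.\<close>
  define C where "C r w = (\<lambda>i. gram \<nu>' (fst w i, snd w i) r)" for r and w :: "(nat \<Rightarrow> 'a) \<times> (nat \<Rightarrow> 'a)"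
  have comp: "fst w i \<in> E" "snd w i \<in> Z" if "w \<in> W" for w i
  proof -
    show "fst w i \<in> E" using that subfield_zero[OF E(1)] by (cases "i < n") (auto simp: W_def kvec_def)
    show "snd w i \<in> Z" using that subfield_zero[OF K]
      by (cases "i < n") (auto simp: W_def Zv_def Z_def kvec_def split: if_splits)
  qed
  have outside: "fst w i = 0" "snd w i = 0" if "w \<in> W" "\<not> i < n" for w i
    using that by (auto simp: W_def Zv_def kvec_def split: if_splits)
  have lin_C: "lin_on K scp sc W (kvec K n) (C r)" if r: "fst r \<in> E" "snd r \<in> Z" for r
  proof -
    have "C r w \<in> kvec K n" if "w \<in> W" for w
      using gram_in[OF \<nu> _ _ r, of "(fst w _, snd w _)"] comp[OF that] outside[OF that]
      by (auto simp: C_def kvec_def gram_def s_zero)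
    moreover have "C r (x + y) = C r x + C r y" if "x \<in> W" "y \<in> W" for x y
      using gram_add[OF comp(1)[OF that(1)] comp(1)[OF that(2)] r(1)] by (simp add: C_def fun_eq_iff)
    moreover have "C r (scp k x) = sc k (C r x)" if "k \<in> K" "x \<in> W" for k x
      using gram_scale[OF that(1) comp(1)[OF that(2)] r(1)] by (auto simp: C_def fun_eq_iff scp_def)
    ultimately show ?thesis unfolding lin_on_def by blast
  qed
  have "\<forall>p. \<exists>x. fst p \<in> E \<longrightarrow> snd p \<in> Z \<longrightarrow> (\<forall>j<h. x j \<in> K) \<and>
        fst p = gram \<nu>' p \<omega>' * fst \<omega>' + (\<Sum>j<h. x j * fst (\<alpha>' j)) + (\<Sum>j<h. gram \<nu>' p (\<alpha>' j) * fst (\<beta>' j)) \<and>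
        snd p = gram \<nu>' p \<omega>' * snd \<omega>' + (\<Sum>j<h. x j * snd (\<alpha>' j)) + (\<Sum>j<h. gram \<nu>' p (\<alpha>' j) * snd (\<beta>' j))"
    using complete by blast
  then obtain \<xi> where \<xi>: "\<forall>p. fst p \<in> E \<longrightarrow> snd p \<in> Z \<longrightarrow> (\<forall>j<h. \<xi> p j \<in> K) \<and>
        fst p = gram \<nu>' p \<omega>' * fst \<omega>' + (\<Sum>j<h. \<xi> p j * fst (\<alpha>' j)) + (\<Sum>j<h. gram \<nu>' p (\<alpha>' j) * fst (\<beta>' j)) \<and>
        snd p = gram \<nu>' p \<omega>' * snd \<omega>' + (\<Sum>j<h. \<xi> p j * snd (\<alpha>' j)) + (\<Sum>j<h. gram \<nu>' p (\<alpha>' j) * snd (\<beta>' j))"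
    by (rule choice[THEN exE])
  define X where "X j w = (\<lambda>i. if i < n then \<xi> (fst w i, snd w i) j else 0)" for j and w :: "(nat \<Rightarrow> 'a) \<times> (nat \<Rightarrow> 'a)"
  have cf: "complete_frame sc K (kvec K n) b q \<epsilon> scp W (bt \<nu>') (qt \<nu>') h 1 (\<lambda>i j. gram \<nu>' (\<beta>' i) (\<beta>' j))
    (emb \<omega>') (\<lambda>j. emb (\<alpha>' j)) (\<lambda>j. emb (\<beta>' j)) (C \<omega>') X (\<lambda>j. C (\<alpha>' j))"
  proof (intro complete_frame.intro complete_frame_axioms.intro frame_of_scalars[OF tgt])
    show "lin_on K scp sc W (kvec K n) (C \<omega>')" by (rule lin_C[OF o])
    show "lin_on K scp sc W (kvec K n) (C (\<alpha>' j))" if "j < h" for j by (rule lin_C[OF a[OF that]])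
    show "X j w \<in> kvec K n" if "j < h" "w \<in> W" for j w
      using \<xi> that comp[OF that(2)] by (auto simp: X_def kvec_def)
    show "w = emb \<omega>' (C \<omega>' w) + (\<Sum>j<h. emb (\<alpha>' j) (X j w)) + (\<Sum>j<h. emb (\<beta>' j) (C (\<alpha>' j) w))" if w: "w \<in> W" for w
    proof (rule prod_eqI)
      have in_n: "fst w i = gram \<nu>' (fst w i, snd w i) \<omega>' * fst \<omega>' + (\<Sum>j<h. \<xi> (fst w i, snd w i) j * fst (\<alpha>' j)) + (\<Sum>j<h. gram \<nu>' (fst w i, snd w i) (\<alpha>' j) * fst (\<beta>' j))"
        "snd w i = gram \<nu>' (fst w i, snd w i) \<omega>' * snd \<omega>' + (\<Sum>j<h. \<xi> (fst w i, snd w i) j * snd (\<alpha>' j)) + (\<Sum>j<h. gram \<nu>' (fst w i, snd w i) (\<alpha>' j) * snd (\<beta>' j))" for i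
        using \<xi>[THEN spec, of "(fst w i, snd w i)"] comp[OF w, of i] by auto
      have 0: "C r w i = 0" if "\<not> i < n" for r i
        using outside[OF w that] by (simp add: C_def gram_def s_zero)
      show "fst w = fst (emb \<omega>' (C \<omega>' w) + (\<Sum>j<h. emb (\<alpha>' j) (X j w)) + (\<Sum>j<h. emb (\<beta>' j) (C (\<alpha>' j) w)))"
      proof
        fix i show "fst w i = fst (emb \<omega>' (C \<omega>' w) + (\<Sum>j<h. emb (\<alpha>' j) (X j w)) + (\<Sum>j<h. emb (\<beta>' j) (C (\<alpha>' j) w))) i"
          using in_n(1)[of i] outside(1)[OF w, of i] 0[of i]
          by (cases "i < n") (auto simp: emb_def fst_sum sum_fun_apply X_def C_def mult.commute)
      qed
      show "snd w = snd (emb \<omega>' (C \<omega>' w) + (\<Sum>j<h. emb (\<alpha>' j) (X j w)) + (\<Sum>j<h. emb (\<beta>' j) (C (\<alpha>' j) w)))"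
      proof
        fix i show "snd w i = snd (emb \<omega>' (C \<omega>' w) + (\<Sum>j<h. emb (\<alpha>' j) (X j w)) + (\<Sum>j<h. emb (\<beta>' j) (C (\<alpha>' j) w))) i"
          using in_n(2)[of i] outside(2)[OF w, of i] 0[of i]
          by (cases "i < n") (auto simp: emb_def snd_sum sum_fun_apply X_def C_def mult.commute)
      qed
    qed
  qed
  obtain r p p' where dual: "V.dual_system r p p'" using dual_system_exists by blast
  have "\<forall>j. \<exists>g. j < h \<longrightarrow> lin_on K sc sc (kvec K n) (kvec K n) g \<and>
      (\<forall>y\<in>Rq. g y \<in> Rq \<and> q (g y) = gram \<nu> (\<beta> j) (\<beta> j) / u * q y)"
    using multiplier_map mult(1) by blast
  then obtain g where g: "\<forall>j. j < h \<longrightarrow> lin_on K sc sc (kvec K n) (kvec K n) (g j) \<and>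
      (\<forall>y\<in>Rq. g j y \<in> Rq \<and> q (g j y) = gram \<nu> (\<beta> j) (\<beta> j) / u * q y)"
    by (rule choice[THEN exE])
  have "\<forall>j. \<exists>g. j < h \<longrightarrow> lin_on K sc sc (kvec K n) (kvec K n) g \<and>
      (\<forall>y\<in>Rq. g y \<in> Rq \<and> q (g y) = gram \<nu>' (\<beta>' j) (\<beta>' j) * q y)"
    using multiplier_map mult(2) by blast
  then obtain g' where g': "\<forall>j. j < h \<longrightarrow> lin_on K sc sc (kvec K n) (kvec K n) (g' j) \<and>
      (\<forall>y\<in>Rq. g' j y \<in> Rq \<and> q (g' j y) = gram \<nu>' (\<beta>' j) (\<beta>' j) * q y)"
    by (rule choice[THEN exE])
  have Rq0: "Rq = kvec K n" if "\<epsilon> = 0" unfolding Rq_def using that by auto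
  have Rq1: "Rq = V.Rad" if "\<epsilon> = 1" unfolding Rq_def V.Rad_def using that by auto
  \<comment> \<open>For bilinear forms, orthogonality to the unit vectors is orthogonality over the
    whole field, so nondegeneracy makes the radical zero already over \<open>K\<close>.\<close>
  have Rad0: "y = 0" if "\<epsilon> = 0" "y \<in> V.Rad" for y
  proof
    fix i
    have yV: "y \<in> kvec K n" using that by (simp add: V.Rad_def)
    have "b y z = 0" for z
    proof -
      have "b y z = b (restr n z) y" using b_restr b_sym by metis
      also have "restr n z = (\<Sum>j<n. sc (restr n z j) (evec j))"
        by (rule kvec_expand[of _ UNIV]) (auto simp: kvec_def restr_def)
      also have "b \<dots> y = (\<Sum>j<n. restr n z j * b (evec j) y)" by (simp only: b_sum b_sc)
      also have "\<dots> = 0" using that(2) kvec_evec[OF K] b_sym[of y] unfolding V.Rad_def by (intro sum.neutral) auto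
      finally show ?thesis .
    qed
    then show "y i = 0 i" using nondeg[OF that(1), of y i] yV by (cases "i < n") (auto simp: kvec_def)
  qed
  \<comment> \<open>The added summand is common to source and target, so the identity is used
    there.\<close>
  define T' where "T' w = (T (fst w), snd w)" for w :: "(nat \<Rightarrow> 'a) \<times> (nat \<Rightarrow> 'a)"
  have "\<exists>S. lin_on K sc sc (kvec K n) (kvec K n) S \<and>
    (\<forall>x\<in>kvec K n. \<forall>y\<in>kvec K n. b (S x) (S y) = u * b x y) \<and> (\<forall>x\<in>kvec K n. q (S x) = u * q x)"
  proof (rule metabolic_cancellation[OF frame_of_scalars[OF src] cf, of T' r p p' g g'])
    show "lin_on K scp scp W W T'"
      using lin_onD[OF T(1)] unfolding lin_on_def W_def T'_def scp_def by auto
    show "bt \<nu>' (T' x) (T' y) = bt \<nu> x y" if "x \<in> W" "y \<in> W" for x y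
      using T(2)[of "fst x" "fst y"] that by (auto simp: bt_def T'_def W_def)
    show "qt \<nu>' (T' x) = qt \<nu> x" if "x \<in> W" for x
      using T(3)[of "fst x"] that by (auto simp: qt_def T'_def W_def)
    show "V.dual_system r p p'" by (rule dual)
    show "lin_on K sc sc (kvec K n) (kvec K n) (g j)" if "j < h" for j using g that by blast
    show "lin_on K sc sc (kvec K n) (kvec K n) (g' j)" if "j < h" for j using g' that by blast
    show "u * q (g j y) = gram \<nu> (\<beta> j) (\<beta> j) * q y" if "\<epsilon> = 0" "j < h" "y \<in> kvec K n" for j y
      using g that Rq0 u by simp
    show "q (g' j y) = gram \<nu>' (\<beta>' j) (\<beta>' j) * q y" if "\<epsilon> = 0" "j < h" "y \<in> kvec K n" for j y
      using g' that Rq0 by simp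
    show "g' j y \<in> V.Rad \<and> q (g' j y) = gram \<nu>' (\<beta>' j) (\<beta>' j) * q y" if "j < h" "y \<in> V.Rad" for j y
    proof (cases "\<epsilon> = 0")
      case True
      have lin: "lin_on K sc sc (kvec K n) (kvec K n) (g' j)" using g' that by blast
      have "y = 0" using Rad0 True that by blast
      moreover have "g' j 0 = 0" using lin_onD(2)[OF lin V.W_zero V.W_zero] by simp
      ultimately show ?thesis using that V.q_zero by simp
    next
      case False
      then show ?thesis using g' that Rq1 eps by auto
    qed
  qed
  then show ?thesis using similitude_from_morphism[of _ u] u by blast
qed

end

lemma square_sum_char2:
  fixes f :: "nat \<Rightarrow> 'a::field"
  assumes "(2::'a) = 0"
  shows "(\<Sum>i<r. f i) * (\<Sum>i<r. f i) = (\<Sum>i<r. f i * f i)"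
  unfolding sum_product by (rule sum_symmetric_char2[OF assms]) (rule mult.commute)

section \<open>The norm principle\<close>

text \<open>Because \<open>c\<close> lies in \<open>K\<close>, the trace form of the multiple by
  \<open>c\<close> again splits off the line of 1, now with value \<open>c\<close>. The complement
  is alternating, so all diagonal entries are 0 and no absorption is called for.\<close>

lemma (in nform) odd_degree_descent:
  assumes u: "kbasis K UNIV r u" and r: "odd r" and c: "c \<in> K" "c \<noteq> 0"
    and sim: "nform.similitude_factor b q n UNIV c"
  shows "similitude_factor c"
proof -
  interpret U: nform b q \<epsilon> n UNIV by (rule nform_ext[OF subfield_UNIV subset_UNIV])
  obtain \<tau> where \<tau>: "lin_on UNIV sc sc (kvec UNIV n) (kvec UNIV n) \<tau>"
    "\<forall>x\<in>kvec UNIV n. \<forall>y\<in>kvec UNIV n. b (\<tau> x) (\<tau> y) = c * b x y" "\<forall>x\<in>kvec UNIV n. q (\<tau> x) = c * q x"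
    using U.morphism_from_similitude[OF sim] by blast
  obtain tr where tr: "\<forall>x. tr x \<in> K" "\<forall>x y. tr (x + y) = tr x + tr y" "\<forall>k\<in>K. \<forall>x. tr (k * x) = k * tr x"
    "\<forall>x. tr (x * x) = tr x * tr x" "tr 1 = 1"
    using trace_exists[OF K char2 u r] by blast
  have "\<exists>(h::nat) \<alpha> \<beta>. (\<forall>i<h. tr (\<alpha> i) = 0 \<and> tr (\<beta> i) = 0) \<and>
    (\<forall>i<h. \<forall>j<h. tr (\<alpha> i * \<alpha> j) = 0 \<and> tr (\<beta> i * \<beta> j) = 0 \<and> tr (\<alpha> i * \<beta> j) = of_bool (i = j)) \<and>
    (\<forall>x. x = tr x + (\<Sum>j<h. tr (x * \<beta> j) * \<alpha> j) + (\<Sum>j<h. tr (x * \<alpha> j) * \<beta> j))"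
    by (rule trace_symplectic_basis[OF K char2 u]) (use tr in blast)+
  then obtain h :: nat and \<alpha> \<beta> where ab: "\<forall>i<h. tr (\<alpha> i) = 0 \<and> tr (\<beta> i) = 0"
    "\<forall>i<h. \<forall>j<h. tr (\<alpha> i * \<alpha> j) = 0 \<and> tr (\<beta> i * \<beta> j) = 0 \<and> tr (\<alpha> i * \<beta> j) = of_bool (i = j)"
    "\<forall>x. x = tr x + (\<Sum>j<h. tr (x * \<beta> j) * \<alpha> j) + (\<Sum>j<h. tr (x * \<alpha> j) * \<beta> j)" by blast
  interpret T: transfer b q \<epsilon> n K UNIV tr 0
    by unfold_locales (use tr subfield_UNIV subfield_zero[OF K] in auto)
  have Z: "T.Z = {0}" unfolding T.Z_def by simp
  have gram: "T.gram \<nu> (x, 0) (y, 0) = tr (\<nu> * (x * y))" for \<nu> x y unfolding T.gram_def by simp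
  have trc: "tr (c * x) = c * tr x" "tr (inverse c * x) = inverse c * tr x" for x
    using tr(3) c(1) subfield_inverse[OF K c(1)] by auto
  have tr_c: "tr c = c" using trc(1)[of 1] tr(5) by simp
  show ?thesis
  \<comment> \<open>The factor \<open>inverse c\<close> on \<open>\<beta> j\<close> restores the
    pairing 1 with \<open>\<alpha> j\<close> after scaling by \<open>c\<close>.\<close>
  proof (rule T.transfer_cancellation[of c h c "(1, 0)" "\<lambda>j. (\<alpha> j, 0)" "\<lambda>j. (inverse c * \<beta> j, 0)"
        1 "(1, 0)" "\<lambda>j. (\<alpha> j, 0)" "\<lambda>j. (\<beta> j, 0)" \<tau>])
    have cc: "c * (x * (inverse c * y)) = x * y" for x y using c by simp
    have ccc: "c * (inverse c * x * (inverse c * y)) = inverse c * (x * y)" for x y using c by simp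
    show "T.scalar_frame c h c (1, 0) (\<lambda>j. (\<alpha> j, 0)) (\<lambda>j. (inverse c * \<beta> j, 0))"
      unfolding T.scalar_frame_def gram Z using ab(1,2) tr(5) tr_c by (auto simp: trc cc)
    show "T.scalar_frame 1 h 1 (1, 0) (\<lambda>j. (\<alpha> j, 0)) (\<lambda>j. (\<beta> j, 0))"
      unfolding T.scalar_frame_def gram Z using ab(1,2) tr(5) by auto
    show "T.gram c (inverse c * \<beta> j, 0) (inverse c * \<beta> j, 0) / c \<in> multipliers" if "j < h" for j
      unfolding gram ccc trc using ab(2) that subfield_zero[OF subfield_multipliers] by simp
    show "T.gram 1 (\<beta> j, 0) (\<beta> j, 0) \<in> multipliers" if "j < h" for j
      unfolding gram using ab(2) that subfield_zero[OF subfield_multipliers] by simp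
    show "\<exists>x. (\<forall>j<h. x j \<in> K) \<and>
        fst p = T.gram 1 p (1, 0) * fst (1, 0) + (\<Sum>j<h. x j * fst (\<alpha> j, 0)) + (\<Sum>j<h. T.gram 1 p (\<alpha> j, 0) * fst (\<beta> j, 0)) \<and>
        snd p = T.gram 1 p (1, 0) * snd (1, 0) + (\<Sum>j<h. x j * snd (\<alpha> j, 0)) + (\<Sum>j<h. T.gram 1 p (\<alpha> j, 0) * snd (\<beta> j, 0))"
      if pZ: "snd p \<in> T.Z" for p
    proof -
      obtain x where p: "p = (x, 0)" using pZ unfolding Z by (cases p) auto
      show ?thesis unfolding p gram using ab(3)[THEN spec, of x] tr(1)
        by (intro exI[of _ "\<lambda>j. tr (x * \<beta> j)"]) simp
    qed
    show "lin_on K sc sc (kvec UNIV n) (kvec UNIV n) \<tau>" using \<tau>(1) unfolding lin_on_def by auto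
  qed (use \<tau> c in auto)
qed

section \<open>Rationality of the minimal polynomial\<close>

text \<open>Expand the image of \<open>y\<close> under the similitude in powers of \<open>c\<close>
  and apply \<open>q\<close>, which squares the scalars. The coefficient vectors stay in
  \<open>Rq\<close>, since the similitude preserves the radical and the powers of \<open>c\<close>
  are independent, so no mixed terms arise.\<close>

lemma (in nform) norm_relation:
  assumes E: "subfield E" "K \<subseteq> E" and c: "kbasis K E d (\<lambda>i. c ^ i)"
    and sim: "nform.similitude_factor b q n E c" and y: "y \<in> Rq"
  shows "\<exists>x. (\<forall>k<d. x k \<in> Rq) \<and> c * q y = (\<Sum>k<d. q (x k) * (c * c) ^ k)"
proof -
  interpret N: nform b q \<epsilon> n E by (rule nform_ext[OF E])
  obtain \<tau> where \<tau>: "lin_on E sc sc (kvec E n) (kvec E n) \<tau>" "\<forall>x\<in>kvec E n. q (\<tau> x) = c * q x" "\<forall>y\<in>N.V.Rad. \<tau> y \<in> N.V.Rad"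
    using N.morphism_from_similitude[OF sim] by blast
  obtain co where co: "\<And>x i. x \<in> E \<Longrightarrow> i < d \<Longrightarrow> co x i \<in> K" "\<And>x. x \<in> E \<Longrightarrow> x = (\<Sum>i<d. co x i * c ^ i)"
    using kbasis_coordinates[OF K E c] by metis
  have yK: "y \<in> kvec K n" using y by (simp add: Rq_def)
  then have yE: "y \<in> kvec E n" using kvec_mono[OF E(2)] by blast
  define t where "t = \<tau> y"
  have tE: "t \<in> kvec E n" unfolding t_def using lin_onD(1)[OF \<tau>(1) yE] .
  define x where "x k = (\<lambda>i. if i < n then co (t i) k else 0)" for k
  have xK: "x k \<in> kvec K n" if "k < d" for k using co(1) tE that by (auto simp: x_def kvec_def)
  have t: "t = (\<Sum>k<d. sc (c ^ k) (x k))"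
  proof
    fix i show "t i = (\<Sum>k<d. sc (c ^ k) (x k)) i"
      unfolding sum_fun_apply using tE co(2)[of "t i"] by (cases "i < n") (auto simp: kvec_def x_def mult.commute)
  qed
  have cE: "c ^ k \<in> E" if "k < d" for k using kbasisD(1)[OF c] that by blast
  have xb: "b (x k) z = 0" if "\<epsilon> = 1" and k: "k < d" and z: "z \<in> kvec K n" for k z
  proof -
    have "y \<in> N.V.Rad"
    proof -
      have "b y w = 0" if w: "w \<in> kvec E n" for w
      proof -
        have "b w y = b (\<Sum>j<n. sc (w j) (evec j)) y" using kvec_expand[OF w] by simp
        also have "\<dots> = (\<Sum>j<n. w j * b (evec j) y)" by (simp only: b_sum b_sc)
        also have "\<dots> = 0" using y \<open>\<epsilon> = 1\<close> kvec_evec[OF K] b_sym[of y] unfolding Rq_def by (intro sum.neutral) auto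
        finally show ?thesis using b_sym by metis
      qed
      then show ?thesis using yE by (simp add: N.V.Rad_def)
    qed
    then have "t \<in> N.V.Rad" unfolding t_def using \<tau>(3) by blast
    moreover have "z \<in> kvec E n" using z kvec_mono[OF E(2)] by blast
    ultimately have "b t z = 0" by (simp add: N.V.Rad_def)
    moreover have "b t z = (\<Sum>k<d. c ^ k * b (x k) z)" unfolding t by (simp only: b_sum b_sc)
    ultimately have "(\<Sum>k<d. b (x k) z * c ^ k) = 0" by (simp add: mult.commute)
    then show ?thesis using kbasisD(3)[OF c, of "\<lambda>k. b (x k) z" k] V.b_in[OF xK z] k by blast
  qed
  have xR: "x k \<in> Rq" if "k < d" for k
    using xK[OF that] xb[OF _ that] eps unfolding Rq_def by auto
  have "c * q y = q t" unfolding t_def using \<tau>(2) yE by simp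
  also have "\<dots> = (\<Sum>k<d. q (sc (c ^ k) (x k)))" unfolding t
  proof (rule N.V.q_sum)
    show "sc (c ^ k) (x k) \<in> kvec E n" if "k \<in> {..<d}" for k
      using xK that cE kvec_mono[OF E(2)] kvec_sc[OF E(1)] by blast
    show "\<epsilon> * b (sc (c ^ k) (x k)) (sc (c ^ l) (x l)) = 0" if "k \<in> {..<d}" "l \<in> {..<d}" for k l
      using xR[of k] xK[of l] that unfolding Rq_def by (auto simp: b_sc b_sc_right)
  qed
  also have "\<dots> = (\<Sum>k<d. q (x k) * (c * c) ^ k)"
    by (simp only: q_sc power_mult_distrib mult.commute)
  finally show ?thesis using xR by blast
qed

text \<open>Either \<open>q\<close> vanishes on \<open>Rq\<close> and all of \<open>K\<close>
  multiplies, or the powers of \<open>\<gamma>\<close>, the square of \<open>c\<close>, form a basis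
  in which \<open>c\<close> and \<open>\<gamma> ^ d\<close> have multiplier coefficients. Then
  \<open>c\<close> satisfies a relation of degree at most \<open>d\<close> over the multipliers, and
  uniqueness over \<open>K\<close> identifies it with the given one.\<close>

lemma (in nform) minimal_polynomial_multipliers:
  assumes E: "subfield E" "K \<subseteq> E" and c: "kbasis K E d (\<lambda>i. c ^ i)"
    and sim: "nform.similitude_factor b q n E c"
    and P: "\<And>i. i < d \<Longrightarrow> P i \<in> K" "c ^ d = (\<Sum>i<d. P i * c ^ i)" and i: "i < d"
  shows "P i \<in> multipliers"
proof (cases "\<forall>y\<in>Rq. q y = 0")
  case True
  then show ?thesis using P(1)[OF i] Rq_zero unfolding multipliers_def by auto
next
  case False
  then obtain y0 where y0: "y0 \<in> Rq" "q y0 \<noteq> 0" by blast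
  note rel = norm_relation[OF E c sim]
  have RqK: "q y \<in> K" if "y \<in> Rq" for y using that V.q_in unfolding Rq_def by blast
  define \<gamma> where "\<gamma> = c * c"
  obtain x0 where x0: "\<forall>k<d. x0 k \<in> Rq" "c * q y0 = (\<Sum>k<d. q (x0 k) * \<gamma> ^ k)"
    using rel[OF y0(1)] unfolding \<gamma>_def by blast
  define a where "a k = q (x0 k) / q y0" for k
  have aK: "a k \<in> K" if "k < d" for k unfolding a_def using x0(1) that RqK y0 by (intro subfield_divide[OF K]) auto
  have ca: "c = (\<Sum>k<d. a k * \<gamma> ^ k)"
  proof -
    have "c = (\<Sum>k<d. q (x0 k) * \<gamma> ^ k) / q y0" using x0(2) y0(2) by (metis nonzero_mult_div_cancel_right)
    then show ?thesis by (simp add: a_def sum_divide_distrib)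
  qed
  have gd: "\<gamma> ^ d = (\<Sum>i<d. (P i * P i) * \<gamma> ^ i)"
  proof -
    have "\<gamma> ^ d = c ^ d * c ^ d" by (simp add: \<gamma>_def power_mult_distrib)
    also have "\<dots> = (\<Sum>i<d. (P i * c ^ i) * (P i * c ^ i))" unfolding P(2) by (rule square_sum_char2[OF char2])
    finally show ?thesis by (simp add: \<gamma>_def power_mult_distrib mult_ac)
  qed
  have gen: "c ^ j \<in> pspan F \<gamma> m" if F: "subfield F" and m: "\<gamma> ^ m \<in> pspan F \<gamma> m" "0 < m" and "c \<in> pspan F \<gamma> m" for F m j
  proof (induction j)
    case 0
    then show ?case using pspan_power_less[OF F m(2), of \<gamma>] by simp
  next
    case (Suc j)
    then show ?case using pspan_mult[OF F m(1)] that by simp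
  qed
  have least: False if j: "j < d" "c ^ j \<in> pspan K c j" for j
  proof -
    obtain k where k: "\<forall>i<j. k i \<in> K" "c ^ j = (\<Sum>i<j. k i * c ^ i)" using j unfolding pspan_def by blast
    have "(\<Sum>i<d. of_bool (i = j) * c ^ i) = (\<Sum>i<d. if i = j then c ^ i else 0)" by (rule sum.cong) auto
    also have "\<dots> = (\<Sum>i<j. k i * c ^ i)" using j k(2) by simp
    also have "\<dots> = (\<Sum>i<d. (if i < j then k i else 0) * c ^ i)"
      using j by (intro sum.mono_neutral_cong_left) auto
    finally have eq: "(\<Sum>i<d. of_bool (i = j) * c ^ i) = (\<Sum>i<d. (if i < j then k i else 0) * c ^ i)" .
    have "of_bool (j = j) = (if j < j then k j else 0)"
      by (rule kbasis_unique[OF K c _ _ eq j(1)]) (use k K in \<open>auto simp: of_bool_def subfield_intros\<close>)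
    then show False by simp
  qed
  have d0: "0 < d" using i by simp
  have dep: False if F: "subfield F" "F \<subseteq> K" and m: "m < d" "\<And>j. j < d \<Longrightarrow> c ^ j \<in> pspan F \<gamma> m" for F m
  proof -
    have "\<exists>x. (\<forall>j<d. x j \<in> F) \<and> (\<exists>j<d. x j \<noteq> 0) \<and> (\<Sum>j<d. x j * c ^ j) = 0"
      by (rule dependent_nat[OF F(1) m(1), of _ "\<lambda>i. \<gamma> ^ i"]) (use m(2) in \<open>simp add: pspan_def\<close>)
    then obtain x j where x: "\<forall>j<d. x j \<in> F" "j < d" "x j \<noteq> 0" "(\<Sum>j<d. x j * c ^ j) = 0" by blast
    then have "x j = 0" using kbasisD(3)[OF c, of x j] F(2) by blast
    then show False using x(3) by simp
  qed
  \<comment> \<open>A relation would put \<open>c\<close>, and with it all its powers, into a span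
    of fewer than \<open>d\<close> powers of \<open>\<gamma>\<close>.\<close>
  have gind: "f k = 0" if f: "\<And>k. k < d \<Longrightarrow> f k \<in> K" "(\<Sum>k<d. f k * \<gamma> ^ k) = 0" and k: "k < d" for f k
  proof (rule ccontr)
    assume "f k \<noteq> 0"
    then obtain j where j: "j < d" "\<gamma> ^ j \<in> pspan K \<gamma> j" using leading_power[OF K f(1) _ f(2)] k by blast
    have j0: "0 < j" using j(2) by (cases j) (auto simp: pspan_def)
    have one: "1 \<in> pspan K \<gamma> j" using pspan_power_less[OF K j0, of \<gamma>] by simp
    have "\<gamma> ^ k \<in> pspan K \<gamma> j" for k using pspan_power_mult[OF K j(2) one, of k] by simp
    then have "c \<in> pspan K \<gamma> j" unfolding ca using aK by (intro pspan_sum pspan_scale K) auto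
    then show False using dep[OF K subset_refl j(1)] gen[OF K j(2) j0] by blast
  qed
  \<comment> \<open>The expansion of \<open>c * q y\<close> in powers of \<open>\<gamma>\<close> is
    unique, so \<open>a k * q y\<close> must be the value of \<open>q\<close> at a vector of
    \<open>Rq\<close>.\<close>
  have aA: "a k \<in> multipliers" if k: "k < d" for k
  proof -
    have "\<exists>z\<in>Rq. q z = a k * q y" if y: "y \<in> Rq" for y
    proof -
      obtain x where x: "\<forall>k<d. x k \<in> Rq" "c * q y = (\<Sum>k<d. q (x k) * \<gamma> ^ k)"
        using rel[OF y] unfolding \<gamma>_def by blast
      have "c * q y = (\<Sum>k<d. a k * q y * \<gamma> ^ k)"
        by (subst ca) (simp add: sum_distrib_right sum_distrib_left mult_ac)
      then have "(\<Sum>k<d. (q (x k) - a k * q y) * \<gamma> ^ k) = 0"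
        using x(2) by (simp add: left_diff_distrib sum_subtractf)
      then have "q (x k) - a k * q y = 0"
        using gind[of "\<lambda>k. q (x k) - a k * q y" k] k x(1) aK RqK y K by (simp add: subfield_intros)
      then show ?thesis using x(1) k by auto
    qed
    then show ?thesis using aK k by (simp add: multipliers_def)
  qed
  note A = subfield_multipliers
  have AK: "multipliers \<subseteq> K" by (auto simp: multipliers_def)
  \<comment> \<open>By Frobenius its coefficients are squares of elements of \<open>K\<close>, hence
    multipliers.\<close>
  have gdA: "\<gamma> ^ d \<in> pspan multipliers \<gamma> d"
    unfolding gd using multipliers_square P(1) by (intro pspan_sum pspan_scale pspan_power_less A) auto
  have "(\<Sum>k<d. a k * \<gamma> ^ k) \<in> pspan multipliers \<gamma> d"
    using aA by (intro pspan_sum pspan_scale pspan_power_less A) auto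
  then have cA: "c \<in> pspan multipliers \<gamma> d" by (simp only: ca[symmetric])
  have "\<exists>x. (\<forall>j<Suc d. x j \<in> multipliers) \<and> (\<exists>j<Suc d. x j \<noteq> 0) \<and> (\<Sum>j<Suc d. x j * c ^ j) = 0"
    by (rule dependent_nat[where w = "\<lambda>j. c ^ j" and v = "\<lambda>i. \<gamma> ^ i" and m = d, OF A lessI])
      (use gen[OF A gdA d0 cA] in \<open>simp add: pspan_def\<close>)
  then obtain x where x: "\<forall>j<Suc d. x j \<in> multipliers" "\<exists>j<Suc d. x j \<noteq> 0" "(\<Sum>j<Suc d. x j * c ^ j) = 0" by blast
  then obtain j where j: "j < Suc d" "c ^ j \<in> pspan multipliers c j"
    using leading_power[OF A, of "Suc d" x c] by blast
  have "c ^ j \<in> pspan K c j"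
  proof -
    obtain k where "\<forall>i<j. k i \<in> multipliers" "c ^ j = (\<Sum>i<j. k i * c ^ i)" using j(2) unfolding pspan_def by blast
    moreover then have "\<forall>i<j. k i \<in> K" using AK by blast
    ultimately show ?thesis unfolding pspan_def by blast
  qed
  \<comment> \<open>A relation of smaller degree over the multipliers would be one over
    \<open>K\<close>.\<close>
  then have "j = d" using j(1) least[of j] by fastforce
  then obtain k where k: "\<forall>i<d. k i \<in> multipliers" "c ^ d = (\<Sum>i<d. k i * c ^ i)" using j(2) unfolding pspan_def by blast
  have "P i = k i"
    by (rule kbasis_unique[OF K c _ _ _ i]) (use P k AK in auto)
  then show ?thesis using k(1) i by simp
qed

section \<open>Euler's dual basis and the simple extension\<close>

text \<open>With \<open>s\<close> the coefficient of \<open>c\<^bsup>d-1\<^esup>\<close>, the \<open>\<theta>\<^sub>l\<close> are Euler's dual basis of the powers of \<open>c\<close>.\<close>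

lemma coefficient_functional:
  fixes c :: "'a::field"
  assumes char2: "(2::'a) = 0" and K: "subfield K" and E: "subfield E" "K \<subseteq> E" and d: "0 < d"
    and c: "kbasis K E d (\<lambda>i. c ^ i)"
    and P: "\<And>i. i < d \<Longrightarrow> P i \<in> K" "c ^ d = (\<Sum>i<d. P i * c ^ i)"
  obtains s \<theta> where "\<And>x. x \<in> E \<Longrightarrow> s x \<in> K" "\<And>x y. x \<in> E \<Longrightarrow> y \<in> E \<Longrightarrow> s (x + y) = s x + s y"
    "\<And>k x. k \<in> K \<Longrightarrow> x \<in> E \<Longrightarrow> s (k * x) = k * s x"
    "\<And>i. i < d \<Longrightarrow> s (c ^ i) = of_bool (Suc i = d)"
    "\<And>i l. i < d \<Longrightarrow> l < d \<Longrightarrow> s (c ^ i * \<theta> l) = of_bool (i = l)"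
    "c * \<theta> 0 = P 0" "\<And>l. l < d \<Longrightarrow> \<theta> l \<in> E"
    "\<And>A l. subfield A \<Longrightarrow> (\<And>i. i < d \<Longrightarrow> P i \<in> A) \<Longrightarrow> l < d \<Longrightarrow> \<theta> l \<in> pspan A c (d - l)"
    "\<And>A x. subfield A \<Longrightarrow> A \<subseteq> K \<Longrightarrow> x \<in> pspan A c d \<Longrightarrow> s x \<in> A"
    "\<And>x. x \<in> E \<Longrightarrow> x = (\<Sum>l<d. s (x * c ^ l) * \<theta> l)"
proof -
  obtain co where co: "\<And>x i. x \<in> E \<Longrightarrow> i < d \<Longrightarrow> co x i \<in> K" "\<And>x. x \<in> E \<Longrightarrow> x = (\<Sum>i<d. co x i * c ^ i)"
    "\<And>k i. (\<And>i. i < d \<Longrightarrow> k i \<in> K) \<Longrightarrow> i < d \<Longrightarrow> co (\<Sum>i<d. k i * c ^ i) i = k i"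
    "\<And>x y i. x \<in> E \<Longrightarrow> y \<in> E \<Longrightarrow> i < d \<Longrightarrow> co (x + y) i = co x i + co y i"
    "\<And>k x i. k \<in> K \<Longrightarrow> x \<in> E \<Longrightarrow> i < d \<Longrightarrow> co (k * x) i = k * co x i"
    using kbasis_coordinates[OF K E c] by blast
  define s where "s x = co x (d - 1)" for x
  have s: "\<And>x. x \<in> E \<Longrightarrow> s x \<in> K" "\<And>x y. x \<in> E \<Longrightarrow> y \<in> E \<Longrightarrow> s (x + y) = s x + s y"
    "\<And>k x. k \<in> K \<Longrightarrow> x \<in> E \<Longrightarrow> s (k * x) = k * s x"
    using co d by (auto simp: s_def)
  have s_span: "s (\<Sum>i<d. k i * c ^ i) = k (d - 1)" if "\<And>i. i < d \<Longrightarrow> k i \<in> K" for k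
    using co(3)[of k "d - 1"] that d by (simp add: s_def)
  have s_pow: "s (c ^ i) = of_bool (Suc i = d)" if "i < d" for i
  proof -
    have "(\<Sum>j<d. of_bool (j = i) * c ^ j) = (\<Sum>j<d. if j = i then c ^ j else 0)" by (rule sum.cong) auto
    then have "s (c ^ i) = s (\<Sum>j<d. of_bool (j = i) * c ^ j)" using that by simp
    also have "\<dots> = of_bool (d - 1 = i)"
      by (rule s_span) (use K in \<open>auto simp: of_bool_def subfield_intros\<close>)
    finally show ?thesis using d that by auto
  qed
  have cE: "c ^ i \<in> E" if "i < d" for i using kbasisD(1)[OF c] that by blast
  have spanE: "pspan K c m \<subseteq> E" if "m \<le> d" for m
  proof
    fix x assume "x \<in> pspan K c m"
    then obtain k where "\<forall>i<m. k i \<in> K" "x = (\<Sum>i<m. k i * c ^ i)" unfolding pspan_def by blast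
    then show "x \<in> E" using cE that E by (auto intro!: subfield_sum subfield_mult)
  qed
  \<comment> \<open>The coefficients of the minimal polynomial, leading 1 included; signs do not
    matter in characteristic 2.\<close>
  define R where "R j = (if j = d then 1 else P j)" for j
  have RA: "R j \<in> A" if "subfield A" "\<And>i. i < d \<Longrightarrow> P i \<in> A" "j \<le> d" for A j
    using that subfield_one by (auto simp: R_def)
  \<comment> \<open>The coefficients of the quotient of the minimal polynomial by X - c. Horner's
    recursion links neighbours.\<close>
  define \<theta> where "\<theta> l = (\<Sum>i<d - l. R (Suc (l + i)) * c ^ i)" for l
  have \<theta>A: "\<theta> l \<in> pspan A c (d - l)" if "subfield A" "\<And>i. i < d \<Longrightarrow> P i \<in> A" "l < d" for A l
  proof -
    have "R (Suc (l + i)) \<in> A" if "i < d - l" for i using RA[OF \<open>subfield A\<close> \<open>\<And>i. i < d \<Longrightarrow> P i \<in> A\<close>] that by simp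
    then show ?thesis unfolding \<theta>_def pspan_def by (auto intro!: exI[of _ "\<lambda>i. R (Suc (l + i))"])
  qed
  have \<theta>E: "\<theta> l \<in> E" if "l < d" for l
    using \<theta>A[OF K P(1) that] spanE[of "d - l"] by auto
  have rec: "\<theta> l = R (Suc l) + c * \<theta> (Suc l)" if "l < d" for l
  proof -
    have "d - l = Suc (d - Suc l)" using that by simp
    then have "\<theta> l = R (Suc l) + (\<Sum>i<d - Suc l. R (Suc (l + Suc i)) * c ^ Suc i)"
      unfolding \<theta>_def by (simp only: sum.lessThan_Suc_shift) simp
    also have "(\<Sum>i<d - Suc l. R (Suc (l + Suc i)) * c ^ Suc i) = c * \<theta> (Suc l)"
      by (simp add: \<theta>_def sum_distrib_left mult_ac)
    finally show ?thesis .
  qed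
  have \<theta>0: "c * \<theta> 0 = P 0"
  proof -
    have "R 0 + c * \<theta> 0 = (\<Sum>j<Suc d. R j * c ^ j)"
      unfolding sum.lessThan_Suc_shift by (simp add: \<theta>_def sum_distrib_left mult_ac)
    also have "\<dots> = (\<Sum>j<d. R j * c ^ j) + c ^ d" by (simp add: R_def)
    also have "(\<Sum>j<d. R j * c ^ j) = c ^ d" unfolding P(2) by (rule sum.cong) (auto simp: R_def)
    also have "c ^ d + c ^ d = 0" by (rule char2_double[OF char2])
    finally have "P 0 + c * \<theta> 0 = P 0 + P 0" using d char2_double[OF char2, of "P 0"] by (simp add: R_def)
    then show ?thesis by (simp only: add_left_cancel)
  qed
  have s\<theta>: "s (c ^ i * \<theta> l) = of_bool (i = l)" if "i < d" "l < d" for i l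
    using that
  proof (induction i arbitrary: l)
    case 0
    define k where "k i = (if i < d - l then R (Suc (l + i)) else 0)" for i
    have "\<theta> l = (\<Sum>i<d. k i * c ^ i)"
      unfolding \<theta>_def k_def by (rule sum.mono_neutral_cong_left) auto
    moreover have "k i \<in> K" if "i < d" for i
      using RA[OF K P(1)] subfield_zero[OF K] by (auto simp: k_def)
    ultimately have "s (\<theta> l) = k (d - 1)" using s_span by simp
    also have "\<dots> = of_bool (0 = l)" using 0 by (auto simp: k_def R_def)
    finally show ?case by simp
  next
    case (Suc i)
    have ci: "c ^ i \<in> E" "s (c ^ i) = 0" using Suc.prems cE s_pow by auto
    note IH = Suc.IH and prems = Suc.prems
    show ?case
    proof (cases l)
      case 0
      have "c ^ Suc i * \<theta> l = c ^ i * (c * \<theta> 0)" using 0 by (simp add: mult_ac)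
      also have "\<dots> = P 0 * c ^ i" by (simp only: \<theta>0 mult.commute)
      finally have "c ^ Suc i * \<theta> l = P 0 * c ^ i" .
      then have "s (c ^ Suc i * \<theta> l) = P 0 * s (c ^ i)" by (simp only: s(3)[OF P(1)[OF d] ci(1)])
      then show ?thesis using ci 0 by simp
    next
      case (Suc l')
      have l': "l' < d" using Suc \<open>l < d\<close> by simp
      have r: "R (Suc l') \<in> K" using RA[OF K P(1)] l' by simp
      have "\<theta> l' + R (Suc l') = c * \<theta> l + (R (Suc l') + R (Suc l'))"
        using rec[OF l'] Suc by (simp add: ac_simps)
      then have cl: "c * \<theta> l = \<theta> l' + R (Suc l')" by (simp only: char2_double[OF char2] add_0_right)
      have "c ^ Suc i * \<theta> l = c ^ i * (c * \<theta> l)" by (simp add: mult_ac)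
      also have "\<dots> = c ^ i * \<theta> l' + R (Suc l') * c ^ i" unfolding cl by (simp add: distrib_left mult.commute)
      finally have eq: "c ^ Suc i * \<theta> l = c ^ i * \<theta> l' + R (Suc l') * c ^ i" .
      have "c ^ i * \<theta> l' \<in> E" "R (Suc l') * c ^ i \<in> E" using ci(1) \<theta>E[OF l'] r E by (auto intro!: subfield_mult)
      then have "s (c ^ Suc i * \<theta> l) = s (c ^ i * \<theta> l') + R (Suc l') * s (c ^ i)"
        unfolding eq by (simp only: s(2) s(3)[OF r ci(1)])
      then show ?thesis using IH[OF _ l'] prems ci Suc by simp
    qed
  qed
  have s0: "s 0 = 0" using s(3)[OF subfield_zero[OF K] subfield_zero[OF E(1)]] by simp
  have s_sum: "s (sum f I) = (\<Sum>i\<in>I. s (f i))" if "\<And>i. i \<in> I \<Longrightarrow> f i \<in> E" for f and I :: "nat set"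
    using that
  proof (induction I rule: infinite_finite_induct)
    case (insert i I)
    then show ?case using s(2)[of "f i" "sum f I"] subfield_sum[OF E(1), of I f] by simp
  qed (auto simp: s0)
  \<comment> \<open>If \<open>D\<close> were invertible, \<open>c ^ (d - 1)\<close> would be
    \<open>D\<close> times a combination of the \<open>c ^ i\<close>, hence killed by
    \<open>s\<close>, which takes the value 1 there.\<close>
  have nondeg: "D = 0" if D: "D \<in> E" "\<And>i. i < d \<Longrightarrow> s (D * c ^ i) = 0" for D
  proof (rule ccontr)
    assume "D \<noteq> 0"
    have "inverse D * c ^ (d - 1) \<in> E" using D cE[of "d - 1"] d by (intro subfield_mult[OF E(1)] subfield_inverse[OF E(1)]) auto
    then obtain k where k: "\<forall>i<d. k i \<in> K" "inverse D * c ^ (d - 1) = (\<Sum>i<d. k i * c ^ i)" using kbasisD(2)[OF c] by blast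
    have "c ^ (d - 1) = D * (inverse D * c ^ (d - 1))" using \<open>D \<noteq> 0\<close> by simp
    also have "\<dots> = (\<Sum>i<d. k i * (D * c ^ i))" unfolding k(2) by (simp add: sum_distrib_left mult.left_commute)
    finally have "s (c ^ (d - 1)) = s (\<Sum>i<d. k i * (D * c ^ i))" by simp
    also have "\<dots> = (\<Sum>i<d. s (k i * (D * c ^ i)))"
      using k(1) D(1) cE E by (intro s_sum) (auto intro!: subfield_mult)
    also have "\<dots> = 0" using k(1) D cE E s(3) by (intro sum.neutral) (auto simp: subfield_mult)
    finally show False using s_pow[of "d - 1"] d by simp
  qed
  have "x = (\<Sum>l<d. s (x * c ^ l) * \<theta> l)" if x: "x \<in> E" for x
  proof -
    have coef: "s (x * c ^ l) \<in> K" if "l < d" for l using x cE[OF that] E by (intro s(1) subfield_mult) auto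
    define D where "D = x + (\<Sum>l<d. s (x * c ^ l) * \<theta> l)"
    have SE: "(\<Sum>l<d. s (x * c ^ l) * \<theta> l) \<in> E" using coef \<theta>E E by (intro subfield_sum subfield_mult) auto
    have "s (D * c ^ i) = 0" if i: "i < d" for i
    proof -
      have "D * c ^ i = x * c ^ i + (\<Sum>l<d. s (x * c ^ l) * (c ^ i * \<theta> l))"
        unfolding D_def distrib_right sum_distrib_right by (simp add: mult_ac)
      also have "s \<dots> = s (x * c ^ i) + s (\<Sum>l<d. s (x * c ^ l) * (c ^ i * \<theta> l))"
        using x cE[OF i] coef \<theta>E E by (intro s(2) subfield_sum subfield_mult) auto
      also have "s (\<Sum>l<d. s (x * c ^ l) * (c ^ i * \<theta> l)) = (\<Sum>l<d. s (s (x * c ^ l) * (c ^ i * \<theta> l)))"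
        using cE[OF i] coef \<theta>E E by (intro s_sum) (auto intro!: subfield_mult)
      also have "\<dots> = (\<Sum>l<d. if l = i then s (x * c ^ l) else 0)"
        using i cE[OF i] coef \<theta>E E s(3) s\<theta> by (intro sum.cong) (auto simp: subfield_mult)
      also have "\<dots> = s (x * c ^ i)" using i by simp
      also have "s (x * c ^ i) + s (x * c ^ i) = 0" by (rule char2_double[OF char2])
      finally show ?thesis .
    qed
    then have "D = 0" using nondeg[of D] x SE subfield_add[OF E(1)] unfolding D_def by blast
    then have "x + (\<Sum>l<d. s (x * c ^ l) * \<theta> l) = x + x" unfolding D_def using char2_double[OF char2, of x] by simp
    then show ?thesis by (simp only: add_left_cancel)
  qed
  moreover have "s x \<in> A" if A: "subfield A" "A \<subseteq> K" "x \<in> pspan A c d" for A x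
  proof -
    obtain k where k: "\<forall>i<d. k i \<in> A" "x = (\<Sum>i<d. k i * c ^ i)" using A(3) unfolding pspan_def by blast
    then have "s x = k (d - 1)" using s_span[of k] A(2) by auto
    then show ?thesis using k d by simp
  qed
  ultimately show thesis using that[of s \<theta>] s s_pow s\<theta> \<theta>0 \<theta>E \<theta>A by blast
qed

text \<open>From \<open>inverse c = inverse (P 0) * \<theta> 0\<close> the functional takes the
  value \<open>inverse (P 0)\<close> at \<open>inverse c\<close>, so in the source the vector 1
  spans the line with that value. Cancellation gives the factor \<open>inverse (P 0)\<close>, and a
  square turns it into \<open>P 0\<close>.\<close>

lemma (in nform) simple_norm_similitude:
  assumes E: "subfield E" "K \<subseteq> E" and d: "0 < d" and c: "kbasis K E d (\<lambda>i. c ^ i)" "c \<noteq> 0" "c \<in> E"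
    and P: "\<And>i. i < d \<Longrightarrow> P i \<in> K" "c ^ d = (\<Sum>i<d. P i * c ^ i)"
    and sim: "nform.similitude_factor b q n E c"
  shows "P 0 \<noteq> 0 \<and> similitude_factor (P 0)"
proof -
  obtain s \<theta> where s: "\<And>x. x \<in> E \<Longrightarrow> s x \<in> K" "\<And>x y. x \<in> E \<Longrightarrow> y \<in> E \<Longrightarrow> s (x + y) = s x + s y"
    "\<And>k x. k \<in> K \<Longrightarrow> x \<in> E \<Longrightarrow> s (k * x) = k * s x"
    and s_pow: "\<And>i. i < d \<Longrightarrow> s (c ^ i) = of_bool (Suc i = d)"
    and s\<theta>: "\<And>i l. i < d \<Longrightarrow> l < d \<Longrightarrow> s (c ^ i * \<theta> l) = of_bool (i = l)"
    and \<theta>0: "c * \<theta> 0 = P 0" and \<theta>E: "\<And>l. l < d \<Longrightarrow> \<theta> l \<in> E"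
    and \<theta>A: "\<And>A l. subfield A \<Longrightarrow> (\<And>i. i < d \<Longrightarrow> P i \<in> A) \<Longrightarrow> l < d \<Longrightarrow> \<theta> l \<in> pspan A c (d - l)"
    and sA: "\<And>A x. subfield A \<Longrightarrow> A \<subseteq> K \<Longrightarrow> x \<in> pspan A c d \<Longrightarrow> s x \<in> A"
    and expand: "\<And>x. x \<in> E \<Longrightarrow> x = (\<Sum>l<d. s (x * c ^ l) * \<theta> l)"
    using coefficient_functional[OF char2 K E d c(1) P] by blast
  note EI = subfield_mult[OF E(1)] subfield_power[OF E(1) c(3)] subfield_sum[OF E(1)] subfield_add[OF E(1)]
  have KE: "x \<in> E" if "x \<in> K" for x using that E(2) by blast
  have s0: "s 0 = 0" using s(3)[OF subfield_zero[OF K] subfield_zero[OF E(1)]] by simp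
  have s_sum: "s (\<Sum>j\<in>I. k j * e j) = (\<Sum>j\<in>I. k j * s (e j))"
    if "\<And>j. j \<in> I \<Longrightarrow> k j \<in> K" "\<And>j. j \<in> I \<Longrightarrow> e j \<in> E" for k e and I :: "nat set"
    using that
  proof (induction I rule: infinite_finite_induct)
    case (insert i I)
    then have "k i * e i \<in> E" "(\<Sum>j\<in>I. k j * e j) \<in> E" using KE by (auto intro!: EI)
    then show ?case using insert s(2,3) by simp
  qed (auto simp: s0)
  have "s (\<theta> 0) = 1" using s\<theta>[of 0 0] d by simp
  then have "\<theta> 0 \<noteq> 0" using s0 by auto
  then have P0: "P 0 \<noteq> 0" using \<theta>0 c(2) by auto
  have icE: "inverse c \<in> E" by (rule subfield_inverse[OF E(1) c(3)])
  have s_ic: "s (inverse c) = inverse (P 0)"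
  proof -
    have "inverse c = inverse (P 0) * \<theta> 0" using \<theta>0[symmetric] c(2) \<open>\<theta> 0 \<noteq> 0\<close> by simp
    then show ?thesis using s(3)[OF subfield_inverse[OF K P(1)[OF d]] \<theta>E[OF d]] \<open>s (\<theta> 0) = 1\<close> by simp
  qed
  note A = subfield_multipliers
  have AK: "multipliers \<subseteq> K" by (auto simp: multipliers_def)
  have PA: "P i \<in> multipliers" if "i < d" for i
    by (rule minimal_polynomial_multipliers[OF E c(1) sim P that])
  have cdA: "c ^ d \<in> pspan multipliers c d" unfolding P(2)
    using PA by (intro pspan_sum pspan_scale pspan_power_less A) auto
  have \<theta>d: "\<theta> l \<in> pspan multipliers c d" if "l < d" for l
    using pspan_mono[OF A \<theta>A[OF A PA that]] by simp
  \<comment> \<open>These are the Gram entries of the metabolic planes. The multiplier-span of the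
    powers of \<open>c\<close> is a ring containing the \<open>\<theta> l\<close>, and
    \<open>s\<close> maps it to multipliers.\<close>
  have s\<theta>\<theta>: "s (\<theta> i * \<theta> j) \<in> multipliers" "s (c * (\<theta> i * \<theta> j)) \<in> multipliers" if "i < d" "j < d" for i j
  proof -
    have *: "\<theta> i * \<theta> j \<in> pspan multipliers c d" by (rule pspan_mult[OF A cdA \<theta>d[OF that(1)] \<theta>d[OF that(2)]])
    then show "s (\<theta> i * \<theta> j) \<in> multipliers" by (rule sA[OF A AK])
    show "s (c * (\<theta> i * \<theta> j)) \<in> multipliers"
      using sA[OF A AK pspan_power_mult[OF A cdA *, of 1]] by simp
  qed
  interpret N: nform b q \<epsilon> n E by (rule nform_ext[OF E])
  obtain \<tau> where \<tau>: "lin_on E sc sc (kvec E n) (kvec E n) \<tau>"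
    "\<forall>x\<in>kvec E n. \<forall>y\<in>kvec E n. b (\<tau> x) (\<tau> y) = c * b x y" "\<forall>x\<in>kvec E n. q (\<tau> x) = c * q x"
    using N.morphism_from_similitude[OF sim] by blast
  \<comment> \<open>Dividing a similitude of factor \<open>c\<close> by \<open>c\<close> gives one
    of factor \<open>inverse c\<close>.\<close>
  define T where "T x = sc (inverse c) (\<tau> x)" for x
  have T: "lin_on K sc sc (kvec E n) (kvec E n) T"
    "\<And>x y. x \<in> kvec E n \<Longrightarrow> y \<in> kvec E n \<Longrightarrow> 1 * b (T x) (T y) = inverse c * b x y"
    "\<And>x. x \<in> kvec E n \<Longrightarrow> 1 * q (T x) = inverse c * q x"
  proof -
    show "lin_on K sc sc (kvec E n) (kvec E n) T"
      using lin_onD[OF \<tau>(1)] KE kvec_sc[OF E(1) icE] unfolding lin_on_def T_def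
      by (auto simp: fun_eq_iff algebra_simps)
    show "1 * b (T x) (T y) = inverse c * b x y" if "x \<in> kvec E n" "y \<in> kvec E n" for x y
      using \<tau>(2) that c(2) by (simp add: T_def b_sc b_sc_right)
    show "1 * q (T x) = inverse c * q x" if "x \<in> kvec E n" for x
      using \<tau>(3) that c(2) by (simp add: T_def q_sc)
  qed
  \<comment> \<open>The coefficient of \<open>c ^ j\<close> in the decomposition. The sum
    compensates for the \<open>\<theta> l\<close> not being isotropic.\<close>
  define \<xi> where "\<xi> k x j = s (x * \<theta> j) + (\<Sum>l<k. s (x * c ^ l) * s (\<theta> l * \<theta> j))" for k x j
  have \<xi>K: "\<xi> k x j \<in> K" if "x \<in> E" "k \<le> d" "j < k" for k x j
    unfolding \<xi>_def using that \<theta>E by (intro subfield_add[OF K] subfield_sum[OF K] subfield_mult[OF K] s(1) EI) auto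
  \<comment> \<open>The first tests leave only the \<open>\<theta> l\<close> with
    \<open>l \<ge> d - k\<close>, which are polynomials in \<open>c\<close> of degree below
    \<open>k\<close>; pairing with \<open>\<theta> j\<close> then kills their coefficients.\<close>
  have nondeg: "D = 0" if k: "k \<le> d" and D: "D \<in> E" "\<And>i. i < d - k \<Longrightarrow> s (D * c ^ i) = 0" "\<And>j. j < k \<Longrightarrow> s (D * \<theta> j) = 0" for k D
  proof -
    have "s (D * c ^ l) * \<theta> l \<in> pspan K c k" if l: "l < d" for l
    proof (cases "l < d - k")
      case True
      then show ?thesis using D(2) pspan_zero[OF K] by simp
    next
      case False
      have "\<theta> l \<in> pspan K c k" by (rule pspan_mono[OF K \<theta>A[OF K P(1) l]]) (use False in auto)
      then show ?thesis using D(1) by (intro pspan_scale[OF K] s(1) EI) auto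
    qed
    then have "(\<Sum>l<d. s (D * c ^ l) * \<theta> l) \<in> pspan K c k" by (intro pspan_sum[OF K]) auto
    then have "D \<in> pspan K c k" using expand[OF D(1)] by simp
    then obtain e where e: "\<forall>i<k. e i \<in> K" "D = (\<Sum>i<k. e i * c ^ i)" unfolding pspan_def by blast
    have "e j = 0" if j: "j < k" for j
    proof -
      have "D * \<theta> j = (\<Sum>i<k. e i * (c ^ i * \<theta> j))" unfolding e(2) by (simp add: sum_distrib_right mult.assoc)
      then have "s (D * \<theta> j) = (\<Sum>i<k. e i * s (c ^ i * \<theta> j))"
        using e(1) \<theta>E j k by (simp only:) (intro s_sum EI, auto)
      also have "\<dots> = (\<Sum>i<k. if i = j then e i else 0)" using s\<theta> j k by (intro sum.cong) auto
      finally show ?thesis using D(3)[OF j] j by simp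
    qed
    then show ?thesis unfolding e(2) by simp
  qed
  \<comment> \<open>Here \<open>t\<close> is the part of \<open>x\<close> along the one-dimensional
    summand: a multiple of \<open>c ^ k\<close> for odd degree, and 0 for even degree, where that
    summand lies outside \<open>E\<close>.\<close>
  have decomp: "x = t + (\<Sum>j<k. \<xi> k x j * c ^ j) + (\<Sum>j<k. s (x * c ^ j) * \<theta> j)"
    if x: "x \<in> E" and k: "2 * k \<le> d" and t: "t \<in> E" "\<And>i. i < d - k \<Longrightarrow> s (t * c ^ i) = (if i < k then 0 else s (x * c ^ i))"
      "\<And>j. j < k \<Longrightarrow> s (t * \<theta> j) = 0" for x t k
  proof -
    have kd: "k \<le> d" using k by simp
    have sxK: "s (x * c ^ j) \<in> K" for j using x by (intro s(1) EI)
    define F where "F = (\<Sum>j<k. \<xi> k x j * c ^ j)"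
    define G where "G = (\<Sum>j<k. s (x * c ^ j) * \<theta> j)"
    have FE: "F \<in> E" unfolding F_def using \<xi>K[OF x kd] KE by (intro EI) auto
    have GE: "G \<in> E" unfolding G_def using sxK KE \<theta>E kd by (intro EI) auto
    have Fm: "s (F * y) = (\<Sum>j<k. \<xi> k x j * s (c ^ j * y))" if "y \<in> E" for y
    proof -
      have "F * y = (\<Sum>j<k. \<xi> k x j * (c ^ j * y))" by (simp add: F_def sum_distrib_right mult.assoc)
      then show ?thesis using \<xi>K[OF x kd] that by (simp only:) (intro s_sum EI, auto)
    qed
    have Gm: "s (G * y) = (\<Sum>j<k. s (x * c ^ j) * s (\<theta> j * y))" if "y \<in> E" for y
    proof -
      have "G * y = (\<Sum>j<k. s (x * c ^ j) * (\<theta> j * y))" by (simp add: G_def sum_distrib_right mult.assoc)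
      then show ?thesis using sxK that \<theta>E kd by (simp only:) (intro s_sum EI, auto)
    qed
    define D where "D = x + (t + F + G)"
    have Dm: "s (D * y) = s (x * y) + (s (t * y) + s (F * y) + s (G * y))" if "y \<in> E" for y
      unfolding D_def distrib_right using x t(1) FE GE that by (simp add: s(2) EI)
    have "D = 0"
    proof (rule nondeg[OF kd])
      show "D \<in> E" unfolding D_def using x t(1) FE GE by (intro EI)
      show "s (D * c ^ i) = 0" if i: "i < d - k" for i
      proof -
        have "s (F * c ^ i) = 0"
        proof -
          have "s (c ^ j * c ^ i) = 0" if "j < k" for j
            using s_pow[of "j + i"] that i k by (simp add: power_add)
          then show ?thesis using Fm EI(2) by simp
        qed
        moreover have "s (G * c ^ i) = (if i < k then s (x * c ^ i) else 0)"
        proof -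
          have "s (G * c ^ i) = (\<Sum>j<k. s (x * c ^ j) * s (\<theta> j * c ^ i))" using Gm EI(2) by blast
          also have "\<dots> = (\<Sum>j<k. if j = i then s (x * c ^ j) else 0)"
            using s\<theta> i kd by (intro sum.cong) (auto simp: mult.commute[of "\<theta> _"])
          finally show ?thesis by simp
        qed
        ultimately show ?thesis using Dm[OF EI(2)] t(2)[OF i] V.double_eq_0 by (auto split: if_splits)
      qed
      show "s (D * \<theta> j) = 0" if j: "j < k" for j
      proof -
        have jd: "j < d" using j kd by simp
        have "s (F * \<theta> j) = (\<Sum>i<k. \<xi> k x i * s (c ^ i * \<theta> j))" using Fm \<theta>E[OF jd] by blast
        also have "\<dots> = (\<Sum>i<k. if i = j then \<xi> k x i else 0)" using s\<theta> j kd by (intro sum.cong) auto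
        also have "\<dots> = \<xi> k x j" using j by simp
        finally have 1: "s (F * \<theta> j) = \<xi> k x j" .
        have 2: "s (G * \<theta> j) = (\<Sum>l<k. s (x * c ^ l) * s (\<theta> l * \<theta> j))" using Gm \<theta>E[OF jd] by blast
        show ?thesis unfolding Dm[OF \<theta>E[OF jd]] 1 2 t(3)[OF j] \<xi>_def
          by (simp add: algebra_simps V.c2)
      qed
    qed
    then have "x + (t + F + G) = x + x" unfolding D_def using V.double_eq_0[of x] by simp
    then show ?thesis unfolding F_def G_def by (simp only: add_left_cancel)
  qed
  have ic: "inverse c * (c ^ Suc i * y) = c ^ i * y" "inverse c * (c * y) = y" "inverse c * ((c * y) * z) = y * z" for i y z
    using c(2) by (simp_all add: mult.assoc)
  have ic': "inverse c * c ^ Suc i = c ^ i" for i using c(2) by simp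
  have cc: "inverse c * ((c * y) * (c * y)) = c * (y * y)" for y using c(2) by simp
  have iP: "inverse (P 0) \<noteq> 0" using P0 by simp
  have "similitude_factor (inverse (P 0))"
  proof (cases "odd d")
    case True
    then obtain k where k: "d = 2 * k + 1" by (elim oddE)
    interpret T: transfer b q \<epsilon> n K E s 0
      by unfold_locales (use E s subfield_zero[OF K] in auto)
    have Z: "T.Z = {0}" unfolding T.Z_def by simp
    have gram: "T.gram \<nu> (x, 0) (y, 0) = s (\<nu> * (x * y))" for \<nu> x y unfolding T.gram_def by simp
    \<comment> \<open>In the source, \<open>c ^ Suc i\<close> and \<open>c ^ Suc j\<close> pair to
      \<open>s (c ^ (i + j + 1))\<close>, with exponent below \<open>d - 1 = 2 * k\<close>. In the
      target the powers below \<open>k\<close> are isotropic, and the middle power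
      \<open>c ^ k\<close> has value 1.\<close>
    show ?thesis
    proof (rule T.transfer_cancellation[of "inverse c" k "inverse (P 0)" "(1, 0)" "\<lambda>j. (c ^ Suc j, 0)" "\<lambda>j. (c * \<theta> (Suc j), 0)"
          1 "(c ^ k, 0)" "\<lambda>j. (c ^ j, 0)" "\<lambda>j. (\<theta> j, 0)" T, OF _ _ _ T _ _ iP])
      have 1: "s (\<theta> (Suc j)) = 0" if "j < k" for j using s\<theta>[of 0 "Suc j"] that k by simp
      have 2: "s (c ^ i * c ^ Suc j) = 0" if "i < k" "j < k" for i j
        using s_pow[of "i + Suc j"] that k by (simp add: power_add[symmetric] del: power_Suc)
      have 3: "s (c * (c ^ i * \<theta> (Suc j))) = of_bool (i = j)" if "i < k" "j < k" for i j
        using s\<theta>[of "Suc i" "Suc j"] that k by (simp add: mult.assoc)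
      show "T.scalar_frame (inverse c) k (inverse (P 0)) (1, 0) (\<lambda>j. (c ^ Suc j, 0)) (\<lambda>j. (c * \<theta> (Suc j), 0))"
        unfolding T.scalar_frame_def gram Z mult_1 ic ic' fst_conv snd_conv mult_1_right s_ic
        using icE subfield_one[OF E(1)] c(3) \<theta>E k 1 2 3 s_pow
        by (auto intro!: EI simp del: power_Suc simp: mult.left_commute[of _ c] ic)
      show "T.scalar_frame 1 k 1 (c ^ k, 0) (\<lambda>j. (c ^ j, 0)) (\<lambda>j. (\<theta> j, 0))"
        unfolding T.scalar_frame_def gram Z mult_1 fst_conv snd_conv
        using subfield_one[OF E(1)] \<theta>E k s_pow s\<theta>
        by (auto intro!: EI simp: power_add[symmetric])
      show "T.gram (inverse c) (c * \<theta> (Suc j), 0) (c * \<theta> (Suc j), 0) / inverse (P 0) \<in> multipliers" if "j < k" for j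
        unfolding gram cc using s\<theta>\<theta>(2)[of "Suc j" "Suc j"] that k PA[OF d] A by (intro subfield_divide subfield_inverse) auto
      show "T.gram 1 (\<theta> j, 0) (\<theta> j, 0) \<in> multipliers" if "j < k" for j
        unfolding gram mult_1 using s\<theta>\<theta>(1)[of j j] that k by simp
      show "\<exists>x. (\<forall>j<k. x j \<in> K) \<and>
        fst p = T.gram 1 p (c ^ k, 0) * fst (c ^ k, 0) + (\<Sum>j<k. x j * fst (c ^ j, 0)) + (\<Sum>j<k. T.gram 1 p (c ^ j, 0) * fst (\<theta> j, 0)) \<and>
        snd p = T.gram 1 p (c ^ k, 0) * snd (c ^ k, 0) + (\<Sum>j<k. x j * snd (c ^ j, 0)) + (\<Sum>j<k. T.gram 1 p (c ^ j, 0) * snd (\<theta> j, 0))"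
        if pZ: "fst p \<in> E" "snd p \<in> T.Z" for p
      proof -
        obtain x where p: "p = (x, 0)" using pZ unfolding Z by (cases p) auto
        have x: "x \<in> E" using pZ p by simp
        have sx: "s (x * c ^ k) \<in> K" using x by (intro s(1) EI)
        have "x = s (x * c ^ k) * c ^ k + (\<Sum>j<k. \<xi> k x j * c ^ j) + (\<Sum>j<k. s (x * c ^ j) * \<theta> j)"
        proof (rule decomp[OF x])
          show "2 * k \<le> d" using k by simp
          show "s (x * c ^ k) * c ^ k \<in> E" using sx KE by (intro EI)
          show "s (s (x * c ^ k) * c ^ k * c ^ i) = (if i < k then 0 else s (x * c ^ i))" if "i < d - k" for i
          proof -
            have "s (s (x * c ^ k) * (c ^ (k + i))) = s (x * c ^ k) * s (c ^ (k + i))" by (rule s(3)[OF sx EI(2)])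
            moreover have "i < k \<or> i = k" using that k by auto
            ultimately show ?thesis using s_pow[of "k + i"] k by (auto simp: power_add mult.assoc)
          qed
          show "s (s (x * c ^ k) * c ^ k * \<theta> j) = 0" if "j < k" for j
          proof -
            have "s (s (x * c ^ k) * (c ^ k * \<theta> j)) = s (x * c ^ k) * s (c ^ k * \<theta> j)"
              using that k \<theta>E by (intro s(3)[OF sx] EI) auto
            then show ?thesis using s\<theta>[of k j] that k by (simp add: mult.assoc)
          qed
        qed
        then show ?thesis unfolding p gram mult_1 fst_conv snd_conv using \<xi>K[OF x, of k] k
          by (intro exI[of _ "\<xi> k x"]) simp
      qed
    qed
  next
    case False
    then obtain k where k: "d = 2 * k" by blast
    interpret T: transfer b q \<epsilon> n K E s 1
      by unfold_locales (use E s subfield_one[OF K] in auto)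
    have Z: "T.Z = K" unfolding T.Z_def by simp
    have gram: "T.gram \<nu> (x, z) (y, w) = s (\<nu> * (x * y)) + z * w" for \<nu> x y z w unfolding T.gram_def by simp
    \<comment> \<open>The last source power \<open>c ^ k\<close> now has value
      \<open>s (c ^ (2 * k - 1)) = 1\<close>. The added coordinate makes it isotropic by 1 + 1 = 0,
      and \<open>(0, 1)\<close> becomes its partner.\<close>
    define \<alpha> where "\<alpha> j = (c ^ Suc j, of_bool (Suc j = k) :: 'a)" for j
    define \<beta> where "\<beta> j = (if Suc j = k then 0 else c * \<theta> (Suc j), of_bool (Suc j = k) :: 'a)" for j
    have 0: "0 \<in> E" "0 \<in> K" "1 \<in> E" "1 \<in> K" using subfield_intros(1,2)[OF K] subfield_intros(1,2)[OF E(1)] by auto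
    \<comment> \<open>In the target the powers below \<open>k\<close> are isotropic and half the
      dimension of \<open>E\<close>, so the added line is all that remains.\<close>
    show ?thesis
    proof (rule T.transfer_cancellation[of "inverse c" k "inverse (P 0)" "(1, 0)" \<alpha> \<beta>
          1 "(0, 1)" "\<lambda>j. (c ^ j, 0)" "\<lambda>j. (\<theta> j, 0)" T, OF _ _ _ T _ _ iP])
      have 1: "s (\<theta> (Suc j)) = 0" if "j < k" "Suc j \<noteq> k" for j using s\<theta>[of 0 "Suc j"] that k by simp
      have 2: "s (c ^ i * c ^ Suc j) = of_bool (Suc i = k \<and> Suc j = k)" if "i < k" "j < k" for i j
        using s_pow[of "i + Suc j"] that k by (auto simp: power_add[symmetric] simp del: power_Suc)
      have 3: "s (c ^ j) = 0" if "j < k" for j using s_pow[of j] that k by simp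
      show "T.scalar_frame (inverse c) k (inverse (P 0)) (1, 0) \<alpha> \<beta>"
      proof -
        have "T.gram (inverse c) (1, 0) (\<alpha> j) = 0" "T.gram (inverse c) (1, 0) (\<beta> j) = 0" if "j < k" for j
          unfolding \<alpha>_def \<beta>_def gram mult_1 ic' using that 1 3 s0 by (auto simp: ic(2))
        moreover have "T.gram (inverse c) (\<alpha> i) (\<alpha> j) = 0" if "i < k" "j < k" for i j
          unfolding \<alpha>_def gram ic 2[OF that] using V.double_eq_0[of 1] by auto
        moreover have "T.gram (inverse c) (\<alpha> i) (\<beta> j) = of_bool (i = j)" if "i < k" "j < k" for i j
        proof (cases "Suc j = k")
          case True
          then show ?thesis unfolding \<alpha>_def \<beta>_def gram using s0 that by auto
        next
          case False
          have eq: "c ^ i * (c * \<theta> (Suc j)) = c ^ Suc i * \<theta> (Suc j)" by (simp add: mult_ac)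
          have "s (c ^ i * (c * \<theta> (Suc j))) = of_bool (i = j)"
            unfolding eq using s\<theta>[of "Suc i" "Suc j"] that k by (simp del: power_Suc)
          then show ?thesis unfolding \<alpha>_def \<beta>_def gram ic using False by simp
        qed
        moreover have "T.gram (inverse c) (1, 0) (1, 0) = inverse (P 0)" unfolding gram using s_ic by simp
        moreover have "fst (\<alpha> j) \<in> E \<and> snd (\<alpha> j) \<in> K \<and> fst (\<beta> j) \<in> E \<and> snd (\<beta> j) \<in> K" if "j < k" for j
          using that 0 \<theta>E[of "Suc j"] k EI(1)[OF c(3)] EI(2)[of "Suc j"] by (auto simp: \<alpha>_def \<beta>_def simp del: power_Suc)
        ultimately show ?thesis unfolding T.scalar_frame_def Z using icE 0 by simp
      qed
      show "T.scalar_frame 1 k 1 (0, 1) (\<lambda>j. (c ^ j, 0)) (\<lambda>j. (\<theta> j, 0))"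
      proof -
        have "s (c ^ i * c ^ j) = 0" if "i < k" "j < k" for i j
          using s_pow[of "i + j"] that k by (simp add: power_add[symmetric])
        then show ?thesis unfolding T.scalar_frame_def gram Z using 0 \<theta>E k s\<theta> s0 EI(2) by auto
      qed
      show "T.gram (inverse c) (\<beta> j) (\<beta> j) / inverse (P 0) \<in> multipliers" if "j < k" for j
      proof (rule subfield_divide[OF A _ subfield_inverse[OF A PA[OF d]]])
        show "T.gram (inverse c) (\<beta> j) (\<beta> j) \<in> multipliers"
        proof (cases "Suc j = k")
          case True
          then show ?thesis unfolding \<beta>_def gram using s0 subfield_one[OF A] by simp
        next
          case False
          then show ?thesis unfolding \<beta>_def gram using s\<theta>\<theta>(2)[of "Suc j" "Suc j"] that k by (simp add: cc)
        qed
      qed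
      show "T.gram 1 (\<theta> j, 0) (\<theta> j, 0) \<in> multipliers" if "j < k" for j
        unfolding gram using s\<theta>\<theta>(1)[of j j] that k by simp
      show "\<exists>x. (\<forall>j<k. x j \<in> K) \<and>
        fst p = T.gram 1 p (0, 1) * fst (0, 1) + (\<Sum>j<k. x j * fst (c ^ j, 0)) + (\<Sum>j<k. T.gram 1 p (c ^ j, 0) * fst (\<theta> j, 0)) \<and>
        snd p = T.gram 1 p (0, 1) * snd (0, 1) + (\<Sum>j<k. x j * snd (c ^ j, 0)) + (\<Sum>j<k. T.gram 1 p (c ^ j, 0) * snd (\<theta> j, 0))"
        if pZ: "fst p \<in> E" "snd p \<in> T.Z" for p
      proof -
        obtain x z where p: "p = (x, z)" by (cases p)
        have x: "x \<in> E" using pZ p by simp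
        have "x = 0 + (\<Sum>j<k. \<xi> k x j * c ^ j) + (\<Sum>j<k. s (x * c ^ j) * \<theta> j)"
          by (rule decomp[OF x]) (use k 0 s0 in auto)
        then show ?thesis unfolding p gram using \<xi>K[OF x, of k] k s0
          by (intro exI[of _ "\<xi> k x"]) simp
      qed
    qed
  qed
  then have "similitude_factor (inverse (P 0) * (P 0 * P 0))"
    by (rule similitude_factor_mult_square) (use P(1)[OF d] P0 in auto)
  moreover have "inverse (P 0) * (P 0 * P 0) = P 0" using P0 by (simp add: mult.assoc[symmetric])
  ultimately show ?thesis using P0 by simp
qed

lemma minimal_polynomial_constant_nonzero:
  fixes c :: "'a::field"
  assumes char2: "(2::'a) = 0" and K: "subfield K" and E: "subfield E" "K \<subseteq> E" and d: "0 < d"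
    and c: "kbasis K E d (\<lambda>i. c ^ i)" "c \<noteq> 0"
    and P: "\<And>i. i < d \<Longrightarrow> P i \<in> K" "c ^ d = (\<Sum>i<d. P i * c ^ i)"
  shows "P 0 \<noteq> 0"
proof (rule coefficient_functional[OF char2 K E d c(1) P])
  fix s \<theta>
  assume s: "\<And>k x. k \<in> K \<Longrightarrow> x \<in> E \<Longrightarrow> s (k * x) = k * s x"
    and s\<theta>: "\<And>i l. i < d \<Longrightarrow> l < d \<Longrightarrow> s (c ^ i * \<theta> l) = of_bool (i = l)"
    and \<theta>0: "c * \<theta> 0 = P 0"
  have "s (\<theta> 0) = 1" using s\<theta>[of 0 0] d by simp
  moreover have "s 0 = 0" using s[OF subfield_zero[OF K] subfield_zero[OF E(1)]] by simp
  ultimately have "\<theta> 0 \<noteq> 0" by auto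
  then show "P 0 \<noteq> 0" using \<theta>0 c(2) by auto
qed

lemma (in nform) norm_principle:
  assumes fin: "finite_ext K" and c: "c \<noteq> 0" and sim: "nform.similitude_factor b q n UNIV c"
  shows "field_norm K c \<in> K \<and> field_norm K c \<noteq> 0 \<and> similitude_factor (field_norm K c)"
proof -
  obtain m v where "is_basis_over K m v" using fin unfolding finite_ext_def by blast
  then have v: "kbasis K UNIV m v" by (rule is_basis_over_kbasis[OF K])
  obtain d where d: "0 < d" "c ^ d \<in> pspan K c d" and sub: "subfield (pspan K c d)" "K \<subseteq> pspan K c d"
    and basis: "kbasis K (pspan K c d) d (\<lambda>i. c ^ i)"
    using simple_extension[OF K v] by blast
  obtain P where P: "\<forall>i<d. P i \<in> K" "c ^ d = (\<Sum>i<d. P i * c ^ i)" using d(2) unfolding pspan_def by blast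
  have PK: "P i \<in> K" if "i < d" for i using P(1) that by blast
  have cE: "c \<in> pspan K c d"
  proof (cases "d = 1")
    case True
    then show ?thesis using d(2) by simp
  next
    case False
    then show ?thesis using pspan_power_less[OF K, of 1 d c] d(1) by simp
  qed
  obtain r u where u: "kbasis (pspan K c d) UNIV r u" using kbasis_exists[OF sub(1) K sub(2) v] by blast
  have norm: "field_norm K c = P 0 ^ r"
    by (rule field_norm_simple[OF K char2 fin sub d(1) basis u PK P(2)])
  have P0: "P 0 \<noteq> 0"
    by (rule minimal_polynomial_constant_nonzero[OF char2 K sub d(1) basis c PK P(2)])
  have "similitude_factor (P 0 ^ r)"
  proof (cases "even r")
    case True
    then obtain t where t: "r = 2 * t" by blast
    have "similitude_factor (1 * (P 0 ^ t * P 0 ^ t))"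
      by (rule similitude_factor_mult_square[OF similitude_factor_one])
        (use PK[OF d(1)] P0 subfield_power[OF K] in auto)
    then show ?thesis by (simp add: t mult_2 power_add)
  next
    case False
    then obtain t where t: "r = 2 * t + 1" by (elim oddE)
    interpret N: nform b q \<epsilon> n "pspan K c d" by (rule nform_ext[OF sub])
    \<comment> \<open>The descent applies because \<open>c\<close> itself lies in the intermediate
      field.\<close>
    have "N.similitude_factor c" by (rule N.odd_degree_descent[OF u False cE c sim])
    then have "similitude_factor (P 0)"
      using simple_norm_similitude[OF sub d(1) basis c cE PK P(2)] by blast
    then have "similitude_factor (P 0 * (P 0 ^ t * P 0 ^ t))"
      by (rule similitude_factor_mult_square) (use PK[OF d(1)] P0 subfield_power[OF K] in auto)
    then show ?thesis by (simp add: t mult_2 power_add)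
  qed
  then show ?thesis unfolding norm using P0 PK[OF d(1)] subfield_power[OF K] by simp
qed

section \<open>Specialisation to quadratic and bilinear forms\<close>

text \<open>Spelled out instead of defined by differences of \<open>qf\<close>, so that bilinearity
  and rationality hold term by term; the diagonal terms are doubled and vanish in characteristic
  2.\<close>

definition polar_qf :: "(nat \<Rightarrow> nat \<Rightarrow> 'a::comm_ring_1) \<Rightarrow> nat \<Rightarrow> (nat \<Rightarrow> 'a) \<Rightarrow> (nat \<Rightarrow> 'a) \<Rightarrow> 'a" where
  "polar_qf a n x y = (\<Sum>i<n. \<Sum>j\<in>{i..<n}. a i j * (x i * y j + x j * y i))"

lemma nform_qf:
  fixes a :: "nat \<Rightarrow> nat \<Rightarrow> 'a::field"
  assumes K: "subfield K" and char2: "(2::'a) = 0" and a: "is_qform K a n"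
  shows "nform (polar_qf a n) (qf a n) 1 n K"
proof
  show "polar_qf a n x y = polar_qf a n y x" for x y
    unfolding polar_qf_def by (intro sum.cong refl) (simp add: ac_simps)
  show "polar_qf a n (x + y) z = polar_qf a n x z + polar_qf a n y z" for x y z
    unfolding polar_qf_def sum.distrib[symmetric] by (intro sum.cong refl) (simp add: algebra_simps)
  show "polar_qf a n (sc k x) z = k * polar_qf a n x z" for k x z
    unfolding polar_qf_def sum_distrib_left by (intro sum.cong refl) (simp add: algebra_simps)
  show "qf a n (x + y) = qf a n x + qf a n y + 1 * polar_qf a n x y" for x y
    unfolding polar_qf_def qf_def sum.distrib[symmetric] mult_1 by (intro sum.cong refl) (simp add: algebra_simps)
  show "qf a n (sc k x) = k * k * qf a n x" for k x
    unfolding qf_def sum_distrib_left by (intro sum.cong refl) (simp add: algebra_simps)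
  show "polar_qf a n x x = (1 + 1) * qf a n x" for x
    unfolding qf_def polar_qf_def sum_distrib_left by (intro sum.cong refl) (simp add: algebra_simps)
  show "polar_qf a n x y \<in> E" if "subfield E" "K \<subseteq> E" "x \<in> kvec E n" "y \<in> kvec E n" for E x y
    using that a unfolding polar_qf_def is_qform_def kvec_def
    by (intro subfield_sum subfield_mult subfield_add) auto
  show "qf a n x \<in> E" if "subfield E" "K \<subseteq> E" "x \<in> kvec E n" for E x
    using that a unfolding qf_def is_qform_def kvec_def
    by (intro subfield_sum subfield_mult) auto
  show "polar_qf a n x z = polar_qf a n x' z" if "\<And>i. i < n \<Longrightarrow> x i = x' i" for x x' z
    using that unfolding polar_qf_def by (intro sum.cong refl) auto
  show "qf a n x = qf a n x'" if "\<And>i. i < n \<Longrightarrow> x i = x' i" for x x'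
    using that unfolding qf_def by (intro sum.cong refl) auto
qed (use K char2 in auto)

lemma nform_bf:
  fixes B :: "nat \<Rightarrow> nat \<Rightarrow> 'a::field"
  assumes K: "subfield K" and char2: "(2::'a) = 0" and B: "is_nonsing_sym_bform K B n"
  shows "nform (bf B n) (\<lambda>x. bf B n x x) 0 n K"
proof -
  have sym: "bf B n x y = bf B n y x" for x y
  proof -
    have "bf B n x y = (\<Sum>i<n. \<Sum>j<n. y j * B j i * x i)"
      unfolding bf_def using B unfolding is_nonsing_sym_bform_def by (intro sum.cong refl) auto
    then show ?thesis unfolding bf_def by (subst sum.swap)
  qed
  have add: "bf B n (x + y) z = bf B n x z + bf B n y z" for x y z
    unfolding bf_def sum.distrib[symmetric] by (intro sum.cong refl) (simp add: algebra_simps)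
  have scl: "bf B n (sc k x) z = k * bf B n x z" for k x z
    unfolding bf_def sum_distrib_left by (intro sum.cong refl) (simp add: algebra_simps)
  have add': "bf B n z (x + y) = bf B n z x + bf B n z y" and scl': "bf B n z (sc k x) = k * bf B n z x" for x y z k
    using add[of x y z] scl[of k x z] sym[of z] by simp_all
  have cong: "bf B n x z = bf B n x' z" if "\<And>i. i < n \<Longrightarrow> x i = x' i" for x x' z
    using that unfolding bf_def by (intro sum.cong refl) auto
  have inE: "bf B n x y \<in> E" if "subfield E" "K \<subseteq> E" "x \<in> kvec E n" "y \<in> kvec E n" for E x y
    using that B unfolding bf_def is_nonsing_sym_bform_def mat_in_def kvec_def
    by (intro subfield_sum subfield_mult) auto
  show ?thesis
  proof
    show "bf B n (x + y) (x + y) = bf B n x x + bf B n y y + 0 * bf B n x y" for x y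
    proof -
      have "bf B n (x + y) (x + y) = bf B n x x + bf B n y y + (bf B n x y + bf B n x y)"
        unfolding add add' sym[of y x] by (simp add: ac_simps)
      then show ?thesis by (simp add: char2_double[OF char2])
    qed
    show "x i = 0" if "\<And>y. bf B n x y = 0" "i < n" for x i
    proof -
      have "mdet n B \<noteq> 0" using B unfolding is_nonsing_sym_bform_def by blast
      then obtain R where R: "\<forall>i<n. \<forall>j<n. (\<Sum>k<n. B i k * R k j) = of_bool (i = j)"
        using mdet_nonzero_inverse by blast
      \<comment> \<open>Pairing with a column of the right inverse of \<open>B\<close> recovers one
        coordinate of \<open>x\<close>.\<close>
      have "bf B n x (\<lambda>k. R k i) = (\<Sum>l<n. x l * (\<Sum>k<n. B l k * R k i))"
        unfolding bf_def by (simp add: sum_distrib_left mult.assoc)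
      also have "\<dots> = (\<Sum>l<n. if l = i then x l else 0)" using R that(2) by (intro sum.cong) auto
      finally show ?thesis using that by simp
    qed
    show "bf B n x x = bf B n x' x'" if "\<And>i. i < n \<Longrightarrow> x i = x' i" for x x'
    proof -
      have "bf B n x x = bf B n x' x" using that by (rule cong)
      also have "\<dots> = bf B n x x'" by (rule sym)
      also have "\<dots> = bf B n x' x'" using that by (rule cong)
      finally show ?thesis .
    qed
    show "bf B n x z = bf B n x' z" if "\<And>i. i < n \<Longrightarrow> x i = x' i" for x x' z using that by (rule cong)
    show "bf B n x y = bf B n y x" for x y by (rule sym)
  qed (use K char2 add scl scl' inE in auto)
qed

theorem theorem7p3:
  fixes K :: "'a::field set"
  assumes "subfield K"
    and "(2::'a) = 0"
    and "finite_ext K"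
  shows "(\<forall>n (a :: nat \<Rightarrow> nat \<Rightarrow> 'a). is_qform K a n \<longrightarrow>
            field_norm K ` G_qf UNIV a n \<subseteq> G_qf K a n)
       \<and> (\<forall>n (B :: nat \<Rightarrow> nat \<Rightarrow> 'a). is_nonsing_sym_bform K B n \<longrightarrow>
            field_norm K ` G_bf UNIV B n \<subseteq> G_bf K B n)"
proof (intro conjI allI impI image_subsetI)
  fix n and a :: "nat \<Rightarrow> nat \<Rightarrow> 'a" and c
  assume a: "is_qform K a n" and c: "c \<in> G_qf UNIV a n"
  interpret nform "polar_qf a n" "qf a n" 1 n K by (rule nform_qf[OF assms(1,2) a])
  interpret U: nform "polar_qf a n" "qf a n" 1 n UNIV by (rule nform_ext[OF subfield_UNIV subset_UNIV])
  obtain T where T: "mat_in UNIV n T" "mdet n T \<noteq> 0" "\<And>x. qf a n (matvec n T x) = c * qf a n x"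
    using c unfolding G_qf_def qf_isom_scaled_def vec_in_def by auto
  \<comment> \<open>Only \<open>qf\<close> is assumed to be scaled; the polar form is a combination
    of its values and is scaled with it.\<close>
  have polar: "polar_qf a n x y = qf a n (x + y) - qf a n x - qf a n y" for x y using q_add[of x y] by simp
  have "polar_qf a n (matvec n T x) (matvec n T y) = c * polar_qf a n x y" for x y
    unfolding polar matvec_add[symmetric] T(3) by (simp add: algebra_simps)
  then have "U.similitude_factor c" unfolding U.similitude_factor_def using T by blast
  moreover have "c \<noteq> 0" using c unfolding G_qf_def by simp
  ultimately have "field_norm K c \<in> K \<and> field_norm K c \<noteq> 0 \<and> similitude_factor (field_norm K c)"
    by (intro norm_principle assms(3))
  then show "field_norm K c \<in> G_qf K a n"
    unfolding G_qf_def qf_isom_scaled_def similitude_factor_def by blast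
next
  fix n and B :: "nat \<Rightarrow> nat \<Rightarrow> 'a" and c
  assume B: "is_nonsing_sym_bform K B n" and c: "c \<in> G_bf UNIV B n"
  interpret nform "bf B n" "\<lambda>x. bf B n x x" 0 n K by (rule nform_bf[OF assms(1,2) B])
  interpret U: nform "bf B n" "\<lambda>x. bf B n x x" 0 n UNIV by (rule nform_ext[OF subfield_UNIV subset_UNIV])
  obtain T where T: "mat_in UNIV n T" "mdet n T \<noteq> 0"
    "\<And>x y. bf B n (matvec n T x) (matvec n T y) = c * bf B n x y"
    using c unfolding G_bf_def bf_isom_scaled_def vec_in_def by auto
  then have "U.similitude_factor c" unfolding U.similitude_factor_def by blast
  moreover have "c \<noteq> 0" using c unfolding G_bf_def by simp
  ultimately have "field_norm K c \<in> K \<and> field_norm K c \<noteq> 0 \<and> similitude_factor (field_norm K c)"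
    by (intro norm_principle assms(3))
  then show "field_norm K c \<in> G_bf K B n"
    unfolding G_bf_def bf_isom_scaled_def similitude_factor_def by blast
qed

end
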